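(* There exists a flow $(t,E)\mapsto E(t)$ of elements of $\mathcal L(\mathbb T)$, defined for $E\in\mathcal L(\mathbb T)$ and $t\in[0,T_E]$, having the following properties (for arbitrary $E,\tilde E,E_1,E_2,E_3\in\mathcal L(\mathbb T)$). 1. $E(0)=E$ and $E(T_E)=\mathbb T$. 2. $E(s)\subset E(t)$ whenever $s\le t$. 3. $|E(t)|=e^t|E|$ for all $t\in[0,T_E]$. 4. $|E(s)\,\Delta\,E(t)|\to0$ as $s\to t$. 5. If $E\subset\tilde E$ then $E(s)\subset\tilde E(s)$ for all $s\in[0,T_{\tilde E}]$. 6. $e^{-t}|E_1(t)\,\Delta\,E_2(t)|\le e^{-s}|E_1(s)\,\Delta\,E_2(s)|$ for all $E_1,E_2$ and every $0\le s\le t\le\min(T_{E_1},T_{E_2})$. 7. If $0\le s\le t\le T_E$ then $E(t)=(E(s))(t-s)$. 8. If $E$ is the rank one Bohr set $\{x:\|\phi(x)\|_{\mathbb T}\le r\}$ associated to a nonconstant continuous homomorphism $\phi:\mathbb T\to\mathbb T$, then $E(t)=\{x:\|\phi(x)\|_{\mathbb T}\le e^tr\}$. 9. $(E+y)(t)=E(t)+y$ for every $E\in\mathcal L(\mathbb T)$, $y\in\mathbb T$, and $t\le T_E$. Likewise, $(-E)(t)=-E(t)$. 10. The function $t\mapsto e^{-t}|E_1(t)+_0E_2(t)|$ is nonincreasing on $[0,\min(T_{E_1},T_{E_2})]$. 11. The function $t\mapsto e^{-2t}\,\mathcal T(E_1(t),E_2(t),E_3(t))$ is nondecreasing on $[0,\tau]$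 provided that $\tau\le\min_{j\in\{1,2,3\}}T_{E_j}$ and $\sum_{j=1}^3|E_j(\tau)|\le2$.
   Context: $\mathbb T=\mathbb R/\mathbb Z$ with Lebesgue measure, $|\mathbb T|=1$; $|E|$ denotes Lebesgue measure of $E\subset\mathbb T$. $\mathcal L(\mathbb T)$ is the class of all equivalence classes of Lebesgue measurable sets $E\subset\mathbb T$ with $|E|>0$, where $E$ is equivalent to $E'$ iff $|E\,\Delta\,E'|=0$ ($\Delta$ is symmetric difference). All conclusions are interpreted in terms of equivalence classes: $A\subset B$ means $|A\setminus B|=0$ for representatives, and equality means equality up to Lebesgue null sets. $T_E=-\ln(|E|)$. $A+_0B=\{x\in\mathbb T:\mathbf 1_A*\mathbf 1_B(x)>0\}$, where $f*g(x)=\int_{\mathbb T}f(x-y)g(y)\,dy$. $\mathcal T(E_1,E_2,E_3)=\iint_{\mathbb T^2}\mathbf 1_{E_1}(x)\mathbf 1_{E_2}(y)\mathbf 1_{E_3}(-x-y)\,dx\,dy$. For $x\in\mathbb T$, $\|x\|_{\mathbb T}=|y|$ where $y\in[-\frac12,\frac12]$ is congruent to $x$ mod $1$. In item 8, $r\in(0,\frac12]$ (so that $|E|>0$) and $t\in[0,T_E]$. *)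

theory Defs
  imports "HOL-Analysis.Analysis"
begin

text \<open>The circle as the quotient group of the reals by the integers; \<open>to_circle\<close> is the quotient map.\<close>

quotient_type circle = real / "\<lambda>x y. x - y \<in> \<int>"
  morphisms rep_circle to_circle
proof (rule equivpI)
  show "reflp (\<lambda>x y::real. x - y \<in> \<int>)"
    by (simp add: reflp_def)
  show "symp (\<lambda>x y::real. x - y \<in> \<int>)"
  proof (rule sympI)
    fix x y :: real
    assume "x - y \<in> \<int>"
    then have "- (x - y) \<in> \<int>" by (rule Ints_minus)
    then show "y - x \<in> \<int>" by simp
  qed
  show "transp (\<lambda>x y::real. x - y \<in> \<int>)"
  proof (rule transpI)
    fix x y z :: real
    assume "x - y \<in> \<int>" "y - z \<in> \<int>"
    then have "(x - y) + (y - z) \<in> \<int>" by (rule Ints_add)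
    then show "x - z \<in> \<int>" by simp
  qed
qed

instantiation circle :: ab_group_add
begin

lift_definition zero_circle :: circle is 0 .

lift_definition plus_circle :: "circle \<Rightarrow> circle \<Rightarrow> circle" is "(+)"
proof -
  fix a b c d :: real
  assume "a - b \<in> \<int>" "c - d \<in> \<int>"
  then have "(a - b) + (c - d) \<in> \<int>" by (rule Ints_add)
  then show "a + c - (b + d) \<in> \<int>" by (simp add: algebra_simps)
qed

lift_definition minus_circle :: "circle \<Rightarrow> circle \<Rightarrow> circle" is "(-)"
proof -
  fix a b c d :: real
  assume "a - b \<in> \<int>" "c - d \<in> \<int>"
  then have "(a - b) - (c - d) \<in> \<int>" by (rule Ints_diff)
  then show "a - c - (b - d) \<in> \<int>" by (simp add: algebra_simps)
qed

lift_definition uminus_circle :: "circle \<Rightarrow> circle" is uminus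
proof -
  fix a b :: real
  assume "a - b \<in> \<int>"
  then have "- (a - b) \<in> \<int>" by (rule Ints_minus)
  then show "- a - - b \<in> \<int>" by simp
qed

instance
  by standard (transfer, simp)+

end

text \<open>Quotient topology.\<close>

instantiation circle :: topological_space
begin

definition open_circle :: "circle set \<Rightarrow> bool"
  where "open_circle U \<longleftrightarrow> open (to_circle -` U)"

instance
proof
  show "open (UNIV :: circle set)"
    by (simp add: open_circle_def)
  show "open (S \<inter> T)" if "open S" "open T" for S T :: "circle set"
    using that by (simp add: open_circle_def vimage_Int open_Int)
  show "open (\<Union>K)" if "\<forall>S\<in>K. open S" for K :: "circle set set"
    using that by (auto simp: open_circle_def vimage_Union)
qed

end

text \<open>Since \<open>x - of_int (round x)\<close> is a representative of \<open>x\<close> in \<open>[-1/2, 1/2]\<close>, this is the norm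
  used on the circle; the lemma \<open>circle_norm_to_circle\<close> shows that the choice of representative in
  that interval is irrelevant.\<close>

lift_definition circle_norm :: "circle \<Rightarrow> real" is "\<lambda>x. \<bar>x - of_int (round x)\<bar>"
proof -
  fix a b :: real
  assume "a - b \<in> \<int>"
  then obtain k where "a - b = of_int k" by (auto elim: Ints_cases)
  then have a: "a = b + of_int k" by simp
  then have "a + 1/2 = (b + 1/2) + of_int k" by simp
  then have "round a = round b + k" by (simp only: round_def floor_add_int)
  with a show "\<bar>a - of_int (round a)\<bar> = \<bar>b - of_int (round b)\<bar>" by simp
qed

lemma circle_norm_to_circle:
  assumes "y \<in> {-1/2..1/2}"
  shows "circle_norm (to_circle y) = \<bar>y\<bar>"
proof (cases "y = 1/2")
  case True
  then have r: "round y = 1"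
    unfolding round_def by (intro floor_unique) auto
  show ?thesis unfolding circle_norm.abs_eq r using True by simp
next
  case False
  with assms have "round y = 0"
    unfolding round_def by (intro floor_unique) auto
  then show ?thesis by (simp add: circle_norm.abs_eq)
qed

text \<open>Lebesgue measure on the circle, as the image of Lebesgue measure on \<open>[0, 1)\<close>; its
  \<open>\<sigma>\<close>-algebra consists of all Lebesgue measurable sets (not only of the Borel sets).\<close>

definition circle_measure :: "circle measure"
  where "circle_measure =
    distr (lebesgue_on {0..<1})
      (sigma UNIV {E. to_circle -` E \<inter> {0..<1} \<in> sets lebesgue}) to_circle"

lemma sets_circle_measure:
  "sets circle_measure = {E. to_circle -` E \<inter> {0..<1} \<in> sets lebesgue}" (is "_ = ?S")
proof -
  have "sigma_algebra UNIV ?S"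
    unfolding sigma_algebra_iff2
  proof (intro conjI ballI allI impI)
    show "?S \<subseteq> Pow UNIV" unfolding Pow_UNIV by (rule subset_UNIV)
    show "{} \<in> ?S"
      unfolding mem_Collect_eq vimage_empty Int_empty_left by (rule sets.empty_sets)
    show "UNIV - E \<in> ?S" if "E \<in> ?S" for E
    proof -
      have "{0..<1::real} \<in> sets lebesgue" by simp
      then have "{0..<1} - (to_circle -` E \<inter> {0..<1}) \<in> sets lebesgue"
        using that unfolding mem_Collect_eq by (rule sets.Diff)
      moreover have "to_circle -` (UNIV - E) \<inter> {0..<1} = {0..<1} - (to_circle -` E \<inter> {0..<1})"
        by blast
      ultimately show ?thesis unfolding mem_Collect_eq by metis
    qed
    show "(\<Union>i. A i) \<in> ?S" if "range A \<subseteq> ?S" for A :: "nat \<Rightarrow> circle set"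
    proof -
      have "to_circle -` A i \<inter> {0..<1} \<in> sets lebesgue" for i
        using that by blast
      then have "(\<Union>i. to_circle -` A i \<inter> {0..<1}) \<in> sets lebesgue"
        by (intro sets.countable_UN) blast
      moreover have "to_circle -` (\<Union>i. A i) \<inter> {0..<1} = (\<Union>i. to_circle -` A i \<inter> {0..<1})"
        by blast
      ultimately show ?thesis unfolding mem_Collect_eq by metis
    qed
  qed
  then have "sigma_sets UNIV ?S = ?S" by (rule sigma_algebra.sigma_sets_eq)
  then show ?thesis
    unfolding circle_measure_def sets_distr by (subst sets_measure_of) simp_all
qed

lemma space_circle_measure [simp]: "space circle_measure = UNIV"
  by (simp add: circle_measure_def)

lemma emeasure_circle_measure:
  assumes "E \<in> sets circle_measure"
  shows "emeasure circle_measure E = emeasure lebesgue (to_circle -` E \<inter> {0..<1})"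
proof -
  let ?N = "sigma UNIV {E. to_circle -` E \<inter> {0..<1} \<in> sets lebesgue}"
  have N: "sets ?N = sets circle_measure" by (simp add: circle_measure_def)
  have *: "to_circle \<in> measurable (lebesgue_on {0..<1}) ?N"
  proof (rule measurableI)
    fix A assume "A \<in> sets ?N"
    then have "to_circle -` A \<inter> {0..<1} \<in> sets lebesgue"
      unfolding N sets_circle_measure by simp
    then show "to_circle -` A \<inter> space (lebesgue_on {0..<1}) \<in> sets (lebesgue_on {0..<1})"
      by (simp add: sets_restrict_space_iff)
  qed simp
  have "emeasure circle_measure E = emeasure (lebesgue_on {0..<1}) (to_circle -` E \<inter> {0..<1})"
    unfolding circle_measure_def using assms N by (subst emeasure_distr[OF *]) simp_all
  also have "\<dots> = emeasure lebesgue (to_circle -` E \<inter> {0..<1})"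
    by (rule emeasure_restrict_space) auto
  finally show ?thesis .
qed

lemma emeasure_circle_measure_UNIV: "emeasure circle_measure UNIV = 1"
  by (subst emeasure_circle_measure) (simp_all add: sets_circle_measure)

text \<open>Elements of \<open>L_sets\<close> represent the equivalence classes in \<open>\<L>(\<T>)\<close>; \<open>null_eq\<close> and
  \<open>null_subset\<close> are equality and inclusion of the classes.\<close>

definition L_sets :: "circle set set"
  where "L_sets = {E \<in> sets circle_measure. measure circle_measure E > 0}"

definition null_eq :: "circle set \<Rightarrow> circle set \<Rightarrow> bool"  (infix "\<doteq>" 50)
  where "A \<doteq> B \<longleftrightarrow> sym_diff A B \<in> null_sets circle_measure"

definition null_subset :: "circle set \<Rightarrow> circle set \<Rightarrow> bool"  (infix "\<sqsubseteq>" 50)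
  where "A \<sqsubseteq> B \<longleftrightarrow> A - B \<in> null_sets circle_measure"

definition max_time :: "circle set \<Rightarrow> real"
  where "max_time E = - ln (measure circle_measure E)"

definition convolution :: "(circle \<Rightarrow> real) \<Rightarrow> (circle \<Rightarrow> real) \<Rightarrow> circle \<Rightarrow> real"
  where "convolution f g x = (\<integral>y. f (x - y) * g y \<partial>circle_measure)"

definition essential_sumset :: "circle set \<Rightarrow> circle set \<Rightarrow> circle set"  (infixl "+\<^sub>0" 65)
  where "A +\<^sub>0 B = {x. convolution (indicator A) (indicator B) x > 0}"

text \<open>An iterated integral is used because the integrand need not be measurable for the product
  \<open>\<sigma>\<close>-algebra of \<open>circle_measure\<close> with itself (which is not complete).\<close>

definition trilinear :: "circle set \<Rightarrow> circle set \<Rightarrow> circle set \<Rightarrow> real"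
  where "trilinear E1 E2 E3 =
    (\<integral>y. (\<integral>x. indicator E1 x * indicator E2 y * indicator E3 (- x - y) \<partial>circle_measure) \<partial>circle_measure)"

end

theory Submission
  imports Defs
begin

text \<open>Lift \<open>E\<close> to a periodic set \<open>S\<close> of reals, let \<open>\<Psi>'' = 1\<^sub>S\<close>, and let \<open>l = exp t\<close>. The set \<open>E(t)\<close> is
  the set where the convex hull of \<open>G(x) = x\<^sup>2/2 - l \<Psi>(x)\<close> lies strictly below \<open>G\<close>. On each component
  \<open>(a, b)\<close> of this open set the tangents of \<open>G\<close> at \<open>a\<close> and \<open>b\<close> coincide, so that \<open>(a, b)\<close> has \<open>l\<close> times the
  mass of \<open>S \<inter> (a, b)\<close> and the same centre of mass; almost every point of \<open>S\<close> lies in such a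
  component. This gives the measure of \<open>E(t)\<close>, and the semigroup property follows from one inclusion
  together with equality of measures. The contraction property is a consequence of monotonicity and
  of the measure formula.

  A finite union of arcs evolves by scaling the arcs about their centres until two of them touch and
  merge. For three arcs of radii \<open>l r\<^sub>i\<close> the trilinear form is \<open>l\<^sup>2\<close> times a sum of symmetric decreasing
  functions evaluated at points \<open>d / l\<close>, so that the monotonicity of the trilinear form holds between
  collisions, hence for finite unions of arcs, and in general by approximation. Applying it to
  \<open>E\<^sub>1\<close>, \<open>E\<^sub>2\<close> and \<open>- (E\<^sub>1 +\<^sub>0 E\<^sub>2)\<close> shows that \<open>E\<^sub>1(t) +\<^sub>0 E\<^sub>2(t)\<close> is contained in \<open>(E\<^sub>1 +\<^sub>0 E\<^sub>2)(t)\<close>.\<close>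

section \<open>Mass and first moments of sets of reals\<close>

text \<open>The obstacle is that a general measurable set has no arcs to enlarge, and that rules for
  merging arcs do not visibly respect inclusions or limits. The hull removes both difficulties: it
  describes \<open>E(t)\<close> for every \<open>t\<close> at once, and its defining inequality,
  stated through moments, is monotone in the set and in \<open>l\<close> and blind to null sets, so
  that inclusions are immediate. Geometry is needed for the measure. Over one period the slope of
  \<open>G\<close> gains \<open>1 - l |E|\<close>, which is nonnegative as long as
  \<open>t <= T_E\<close>; this makes \<open>G\<close> touch its hull, and contact points cut the
  line into pieces on which masses can be compared. The inclusion behind the semigroup property is
  again an inequality between moments: at a contact point the moments of the grown set are at least
  \<open>l\<close> times those of \<open>S\<close>. The contraction property has a second task. It
  keeps approximating unions of arcs close to the set throughout the evolution, so that an
  inequality known for arcs passes to the limit. The approximations are taken of measure at most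
  \<open>|E|\<close>, so that every time admissible for \<open>E\<close> is admissible for
  them.\<close>

definition mass :: "real set \<Rightarrow> real \<Rightarrow> real \<Rightarrow> real"
  where "mass S a b = measure lebesgue (S \<inter> {a..b})"

lemma lmeasurable_Int_Icc:
  "S \<in> sets lebesgue \<Longrightarrow> S \<inter> {a..b::real} \<in> lmeasurable"
  by (rule bounded_set_imp_lmeasurable) (auto simp: bounded_Int)

lemma mass_nonneg: "0 \<le> mass S a b"
  by (simp add: mass_def)

lemma mass_le:
  assumes "S \<in> sets lebesgue" "a \<le> b" shows "mass S a b \<le> b - a"
proof -
  have "mass S a b \<le> measure lebesgue {a..b}"
    unfolding mass_def by (rule measure_mono_fmeasurable) (use assms in auto)
  with assms show ?thesis by simp
qed

lemma mass_mono:
  assumes "S \<inter> {a..b} \<subseteq> S'" "S \<in> sets lebesgue" "S' \<in> sets lebesgue"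
  shows "mass S a b \<le> mass S' a b"
  unfolding mass_def
  by (rule measure_mono_fmeasurable) (use assms in \<open>auto intro: lmeasurable_Int_Icc\<close>)

lemma mass_integral:
  assumes "S \<in> sets lebesgue"
  shows "indicat_real S integrable_on {a..b}" "mass S a b = integral {a..b} (indicat_real S)"
  using lmeasurable_Int_Icc[OF assms, of a b]
  by (simp_all add: mass_def integral_indicator integrable_on_indicator)

lemma mass_add:
  assumes "S \<in> sets lebesgue" "a \<le> b" "b \<le> c"
  shows "mass S a c = mass S a b + mass S b c"
  using Henstock_Kurzweil_Integration.integral_combine[OF assms(2,3) mass_integral(1)[OF assms(1)]]
  by (simp add: mass_integral(2)[OF assms(1)])

lemma mass_uminus: "mass (uminus ` S) a b = mass S (- b) (- a)"
proof -
  have "uminus ` S \<inter> {a..b} = (\<lambda>x. 0 + (-1) *\<^sub>R x) ` (S \<inter> {-b..-a})"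
    by force
  then show ?thesis
    using measure_lebesgue_affine[of "-1" 0 "S \<inter> {-b..-a}"] by (simp add: mass_def)
qed

lemma mass_translate: "mass ((\<lambda>x. x + y) ` S) (a + y) (b + y) = mass S a b"
proof -
  have "(\<lambda>x. x + y) ` S \<inter> {a + y..b + y} = (\<lambda>x. y + 1 *\<^sub>R x) ` (S \<inter> {a..b})"
    by force
  then show ?thesis
    using measure_lebesgue_affine[of 1 y "S \<inter> {a..b}"]
    by (simp add: mass_def add.commute[of y] cong: image_cong_simp)
qed

text \<open>At most one of the two terms is nonzero, since \<open>{a..b}\<close> is empty for \<open>b < a\<close>.\<close>

definition cum :: "real set \<Rightarrow> real \<Rightarrow> real"
  where "cum S x = mass S 0 x - mass S x 0"

lemma cum_diff:
  assumes "S \<in> sets lebesgue" "x \<le> y" shows "cum S y - cum S x = mass S x y"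
proof -
  have z: "mass S a b = 0" if "b \<le> a" for a b
    using that mass_add[OF assms(1), of a a a] by (cases "b = a") (auto simp: mass_def)
  note a = mass_add[OF assms(1)]
  consider "0 \<le> x" | "x < 0" "0 \<le> y" | "y < 0" by linarith
  then show ?thesis
  proof cases
    case 1
    then show ?thesis
      unfolding cum_def using a[of 0 x y] assms(2) z[of 0 x] z[of 0 y] by linarith
  next
    case 2
    then show ?thesis
      unfolding cum_def using a[of x 0 y] z[of x 0] z[of 0 y] by linarith
  next
    case 3
    then show ?thesis
      unfolding cum_def using a[of x y 0] assms(2) z[of x 0] z[of y 0] by linarith
  qed
qed

lemma cum_Lipschitz:
  assumes "S \<in> sets lebesgue" shows "\<bar>cum S y - cum S x\<bar> \<le> \<bar>y - x\<bar>"
proof (cases "x \<le> y")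
  case True
  then show ?thesis using cum_diff[OF assms True] mass_le[OF assms True] mass_nonneg[of S x y] by simp
next
  case False
  then have "y \<le> x" by simp
  then show ?thesis using cum_diff[OF assms \<open>y \<le> x\<close>] mass_le[OF assms \<open>y \<le> x\<close>] mass_nonneg[of S y x] by simp
qed

lemma continuous_on_cum [continuous_intros]:
  assumes "S \<in> sets lebesgue" "continuous_on A f"
  shows "continuous_on A (\<lambda>x. cum S (f x))"
proof -
  have "1-lipschitz_on UNIV (cum S)"
    using cum_Lipschitz[OF assms(1)] by (intro lipschitz_onI) (auto simp: dist_real_def)
  then have "continuous_on UNIV (cum S)"
    by (rule lipschitz_on_continuous_on)
  with assms(2) show ?thesis
    by (auto intro: continuous_on_compose2)
qed

text \<open>The Taylor remainder \<open>\<Psi>(x + h) - \<Psi>(x) - h \<Psi>'(x)\<close> of the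
  second primitive of the indicator, i.e. the integral of the distance to \<open>x + h\<close> over
  the part of \<open>S\<close> in \<open>{x..x + h}\<close>. Writing it as an integral of
  \<open>mass\<close> avoids a choice of \<open>\<Psi>\<close>.\<close>

definition moment :: "real set \<Rightarrow> real \<Rightarrow> real \<Rightarrow> real"
  where "moment S x h = integral {0..h} (\<lambda>u. mass S x (x + u))"

lemma mass_integrable:
  assumes "S \<in> sets lebesgue" shows "(\<lambda>u. mass S x (x + u)) integrable_on {0..h}"
proof -
  have "(\<lambda>u. cum S (x + u) - cum S x) integrable_on {0..h}"
    by (intro integrable_continuous_real continuous_intros assms)
  then show ?thesis
    by (rule integrable_eq) (simp add: cum_diff[OF assms])
qed

lemma moment_mono:
  assumes "S \<subseteq> S'" "S \<in> sets lebesgue" "S' \<in> sets lebesgue"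
  shows "moment S x h \<le> moment S' x h"
  unfolding moment_def
  by (intro integral_le mass_integrable mass_mono assms) (use assms in auto)

lemma moment_le:
  assumes "S \<in> sets lebesgue" "0 \<le> h" shows "moment S x h \<le> h\<^sup>2 / 2"
proof -
  have "((\<lambda>u. u) has_integral (h\<^sup>2 / 2 - 0\<^sup>2 / 2)) {0..h}"
    using assms(2) by (intro fundamental_theorem_of_calculus)
      (auto intro!: derivative_eq_intros simp: has_real_derivative_iff_has_vector_derivative[symmetric])
  then have "integral {0..h} (\<lambda>u. u) = h\<^sup>2 / 2" "(\<lambda>u. u) integrable_on {0..h}"
    by (auto simp: integral_unique integrable_on_def)
  moreover have "moment S x h \<le> integral {0..h} (\<lambda>u. u)"
    unfolding moment_def
    by (intro integral_le mass_integrable calculation assms)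
       (use mass_le[OF assms(1), of x "x + _"] in auto)
  ultimately show ?thesis by simp
qed

lemma moment_cong:
  assumes "\<And>u. 0 \<le> u \<Longrightarrow> mass S x (x + u) = mass S' x' (x' + u)"
  shows "moment S x h = moment S' x' h"
  unfolding moment_def by (rule integral_cong) (use assms in auto)

text \<open>By Taylor's formula \<open>x \<in> grow l S\<close> means that the tangent of \<open>G(x) = x\<^sup>2/2 - l \<Psi>(x)\<close>, \<open>\<Psi>'' = 1\<^sub>S\<close>, at
  \<open>x\<close> lies above \<open>G\<close> at some \<open>x + h\<close> or \<open>x - h\<close>, i.e. that \<open>x\<close> is not a contact point of \<open>G\<close> and its
  convex hull.\<close>

definition grow :: "real \<Rightarrow> real set \<Rightarrow> real set"
  where "grow l S = {x. \<exists>h>0. h\<^sup>2 / 2 < l * moment S x h \<or> h\<^sup>2 / 2 < l * moment (uminus ` S) (- x) h}"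

lemma uminus_sets_lebesgue:
  "S \<in> sets lebesgue \<Longrightarrow> uminus ` S \<in> sets (lebesgue :: real measure)"
proof -
  assume "S \<in> sets lebesgue"
  moreover have "uminus ` S = (\<lambda>x. 0 + (-1) * x) -` S \<inter> space lebesgue"
    by force
  moreover have "(\<lambda>x::real. 0 + (-1) * x) \<in> lebesgue \<rightarrow>\<^sub>M lebesgue"
    using lebesgue_measurable_scaling[of "-1::real"] by (rule back_subst[of "\<lambda>f. f \<in> _"]) auto
  ultimately show ?thesis
    by (metis measurable_sets)
qed

lemma grow_mono:
  assumes "S \<subseteq> S'" "S \<in> sets lebesgue" "S' \<in> sets lebesgue" "0 \<le> l" "l \<le> l'"
  shows "grow l S \<subseteq> grow l' S'"
proof -
  have "l * moment S x h \<le> l' * moment S' x h" if "0 < h" "S \<subseteq> S'" "S \<in> sets lebesgue" "S' \<in> sets lebesgue" for S S' x h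
  proof -
    have "0 \<le> moment S x h"
      unfolding moment_def by (intro integral_nonneg mass_integrable that) (simp add: mass_nonneg)
    then show ?thesis
      using moment_mono[OF that(2-4), of x h] assms(4,5) by (intro mult_mono) auto
  qed
  note * = this[OF _ assms(1-3)] this[OF _ image_mono[OF assms(1)] uminus_sets_lebesgue uminus_sets_lebesgue, OF _ assms(2,3)]
  show ?thesis
  proof
    fix x assume "x \<in> grow l S"
    then obtain h where h: "0 < h" "h\<^sup>2 / 2 < l * moment S x h \<or> h\<^sup>2 / 2 < l * moment (uminus ` S) (- x) h"
      by (auto simp: grow_def)
    then have "h\<^sup>2 / 2 < l' * moment S' x h \<or> h\<^sup>2 / 2 < l' * moment (uminus ` S') (- x) h"
      using *[OF h(1)] by (meson order_less_le_trans)
    with h(1) show "x \<in> grow l' S'" by (auto simp: grow_def)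
  qed
qed

lemma grow_1: "S \<in> sets lebesgue \<Longrightarrow> grow 1 S = {}"
  using moment_le[of S] moment_le[OF uminus_sets_lebesgue, of S]
  by (force simp: grow_def not_less)

text \<open>Masses do not see the null set \<open>S - S'\<close>, so \<open>S\<close> and
  \<open>S \<inter> S'\<close> have the same \<open>grow\<close>, and monotonicity does the rest.
  The inclusion is a genuine one, without an exceptional null set.\<close>

lemma grow_cong_null:
  assumes "S \<in> sets lebesgue" "S' \<in> sets lebesgue" "S - S' \<in> null_sets lebesgue" "0 \<le> l"
  shows "grow l S \<subseteq> grow l S'"
proof -
  have eq: "moment (S \<inter> S') x h = moment S x h" if "S \<in> sets lebesgue" "S' \<in> sets lebesgue" "S - S' \<in> null_sets lebesgue" for S S' x h
  proof (rule moment_cong)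
    fix u :: real
    have "S \<inter> {x..x+u} = (S \<inter> S' \<inter> {x..x+u}) \<union> ((S - S') \<inter> {x..x+u})" by blast
    moreover have "(S - S') \<inter> {x..x+u} \<in> null_sets lebesgue"
      using that(3) by (rule null_set_Int2) simp
    ultimately show "mass (S \<inter> S') x (x + u) = mass S x (x + u)"
      unfolding mass_def using measure_Un_null_set[of "S \<inter> S' \<inter> {x..x+u}" lebesgue] that(1,2)
      by (metis lmeasurable_Int_Icc fmeasurableD sets.Int)
  qed
  have "(uminus ` S - uminus ` S') \<in> null_sets lebesgue"
  proof -
    have "uminus ` S - uminus ` S' = (\<lambda>x. 0 + (-1) *\<^sub>R x) ` (S - S')"
      by force
    moreover have "uminus ` S - uminus ` S' \<in> sets lebesgue"
      by (intro sets.Diff uminus_sets_lebesgue assms)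
    ultimately show ?thesis
      using assms(3) emeasure_lebesgue_affine[of "-1::real" 0 "S - S'"] by (simp add: null_sets_def)
  qed
  note eq2 = eq[OF uminus_sets_lebesgue uminus_sets_lebesgue this, OF assms(1,2)]
  have "uminus ` (S \<inter> S') = uminus ` S \<inter> uminus ` S'" by force
  then have "grow l (S \<inter> S') = grow l S"
    unfolding grow_def using eq[OF assms(1-3)] eq2 by simp
  moreover have "grow l (S \<inter> S') \<subseteq> grow l S'"
    by (rule grow_mono) (use assms in auto)
  ultimately show ?thesis by simp
qed

lemma grow_uminus: "grow l (uminus ` S) = uminus ` grow l S"
proof -
  have "uminus ` uminus ` S = S" by force
  then have "x \<in> grow l (uminus ` S) \<longleftrightarrow> - x \<in> grow l S" for x
    by (auto simp: grow_def)
  then show ?thesis by force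
qed

lemma grow_translate: "grow l ((\<lambda>x. x + y) ` S) = (\<lambda>x. x + y) ` grow l S"
proof -
  have 1: "moment ((\<lambda>x. x + y) ` S) (x + y) h = moment S x h" for x y h S
    by (rule moment_cong) (metis mass_translate add.assoc add.commute)
  have "uminus ` (\<lambda>x. x + y) ` S = (\<lambda>x. x + (- y)) ` uminus ` S" by force
  then have *: "x + y \<in> grow l ((\<lambda>x. x + y) ` S) \<longleftrightarrow> x \<in> grow l S" for x
    using 1[of y S x] 1[of "- y" "uminus ` S" "- x"] by (simp add: grow_def)
  show ?thesis
  proof (intro set_eqI)
    fix z
    have "z \<in> (\<lambda>x. x + y) ` grow l S \<longleftrightarrow> z - y \<in> grow l S"
      by (auto intro!: image_eqI[of z _ "z - y"])
    with *[of "z - y"] show "z \<in> grow l ((\<lambda>x. x + y) ` S) \<longleftrightarrow> z \<in> (\<lambda>x. x + y) ` grow l S"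
      by simp
  qed
qed

section \<open>The contact set of the convex hull\<close>

text \<open>\<open>cum S\<close> is a continuous choice of \<open>\<Psi>'\<close>, so this provides
  the function \<open>G\<close> of the overview up to a constant.\<close>

lemma primitive_exists:
  assumes "S \<in> sets lebesgue"
  obtains G where "\<And>x. (G has_real_derivative x - l * cum S x) (at x)"
proof -
  have "continuous_on UNIV (\<lambda>x. x - l * cum S x)"
    by (intro continuous_intros assms)
  then have "isCont (\<lambda>x. x - l * cum S x) x" for x
    by (simp add: continuous_on_eq_continuous_at)
  then obtain G where "\<And>x. (G has_vector_derivative x - l * cum S x) (at x)"
    using einterval_antiderivative[of "-\<infinity>" "\<infinity>" "\<lambda>x. x - l * cum S x"] by auto
  then show ?thesis
    by (intro that) (simp add: has_real_derivative_iff_has_vector_derivative)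
qed

text \<open>Both sides are the Taylor remainder of \<open>G\<close> at \<open>x\<close>, to the
  right in the first claim and to the left in the second: the integral over \<open>{0..h}\<close> of
  the increment of the derivative of \<open>G\<close>.\<close>

lemma moment_primitive:
  assumes S: "S \<in> sets lebesgue"
    and G: "\<And>x. (G has_real_derivative x - l * cum S x) (at x)" and h: "0 \<le> h"
  shows "h\<^sup>2 / 2 - l * moment S x h = G (x + h) - G x - (x - l * cum S x) * h"
    and "h\<^sup>2 / 2 - l * moment (uminus ` S) (- x) h = G (x - h) - G x + (x - l * cum S x) * h"
proof -
  have sq: "((\<lambda>u. u) has_integral (h\<^sup>2 / 2 - 0\<^sup>2 / 2)) {0..h}"
    using h by (intro fundamental_theorem_of_calculus)
      (auto intro!: derivative_eq_intros simp: has_real_derivative_iff_has_vector_derivative[symmetric])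
  have d1: "((\<lambda>u. G (x + u)) has_real_derivative x + u - l * cum S (x + u)) (at u within T)" for u T
    using DERIV_chain2[OF G DERIV_add[OF DERIV_const DERIV_ident], of x u T] by simp
  have d2: "((\<lambda>u. G (x - u)) has_real_derivative - (x - u - l * cum S (x - u))) (at u within T)" for u T
    using DERIV_chain2[OF G DERIV_diff[OF DERIV_const DERIV_ident], of x u T] by simp
  have lin: "((\<lambda>u. c * u) has_real_derivative c) (at u within T)" for c u :: real and T
    by (auto intro!: derivative_eq_intros)
  have "((\<lambda>u. ((x + u) - l * cum S (x + u)) - (x - l * cum S x)) has_integral
    ((G (x + h) - (x - l * cum S x) * h) - (G (x + 0) - (x - l * cum S x) * 0))) {0..h}"
    using h by (intro fundamental_theorem_of_calculus)
      (auto intro!: DERIV_cong[OF DERIV_diff[OF d1 lin]]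
        simp: has_real_derivative_iff_has_vector_derivative[symmetric])
  moreover have "((\<lambda>u. u - l * mass S x (x + u)) has_integral (h\<^sup>2 / 2 - 0\<^sup>2 / 2 - l * moment S x h)) {0..h}"
    unfolding moment_def
    by (intro has_integral_diff sq has_integral_mult_right integrable_integral mass_integrable S)
  then have "((\<lambda>u. ((x + u) - l * cum S (x + u)) - (x - l * cum S x)) has_integral (h\<^sup>2 / 2 - 0\<^sup>2 / 2 - l * moment S x h)) {0..h}"
    by (rule has_integral_eq[rotated]) (simp add: cum_diff[OF S, symmetric] algebra_simps)
  ultimately show "h\<^sup>2 / 2 - l * moment S x h = G (x + h) - G x - (x - l * cum S x) * h"
    by (auto dest: has_integral_unique)
  have "((\<lambda>u. - ((x - u) - l * cum S (x - u)) + (x - l * cum S x)) has_integral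
    ((G (x - h) + (x - l * cum S x) * h) - (G (x - 0) + (x - l * cum S x) * 0))) {0..h}"
    using h by (intro fundamental_theorem_of_calculus)
      (auto intro!: DERIV_cong[OF DERIV_add[OF d2 lin]]
        simp: has_real_derivative_iff_has_vector_derivative[symmetric])
  moreover have "((\<lambda>u. u - l * mass (uminus ` S) (- x) (- x + u)) has_integral
      (h\<^sup>2 / 2 - 0\<^sup>2 / 2 - l * moment (uminus ` S) (- x) h)) {0..h}"
    unfolding moment_def
    by (intro has_integral_diff sq has_integral_mult_right integrable_integral mass_integrable
        uminus_sets_lebesgue S)
  then have "((\<lambda>u. - ((x - u) - l * cum S (x - u)) + (x - l * cum S x)) has_integral
      (h\<^sup>2 / 2 - 0\<^sup>2 / 2 - l * moment (uminus ` S) (- x) h)) {0..h}"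
    by (rule has_integral_eq[rotated]) (simp add: mass_uminus cum_diff[OF S, symmetric] algebra_simps)
  ultimately show "h\<^sup>2 / 2 - l * moment (uminus ` S) (- x) h = G (x - h) - G x + (x - l * cum S x) * h"
    by (auto dest: has_integral_unique)
qed

lemma not_grow_iff:
  assumes S: "S \<in> sets lebesgue" and G: "\<And>x. (G has_real_derivative x - l * cum S x) (at x)"
  shows "x \<notin> grow l S \<longleftrightarrow> (\<forall>y. G x + (x - l * cum S x) * (y - x) \<le> G y)"
proof
  assume x: "x \<notin> grow l S"
  then have nx: "l * moment S x h \<le> h\<^sup>2 / 2" "l * moment (uminus ` S) (- x) h \<le> h\<^sup>2 / 2"
    if "0 < h" for h
    using that by (simp add: grow_def not_less, metis not_less)+
  show "\<forall>y. G x + (x - l * cum S x) * (y - x) \<le> G y"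
  proof
    fix y
    consider "y = x" | "x < y" | "y < x" by linarith
    then show "G x + (x - l * cum S x) * (y - x) \<le> G y"
    proof cases
      case 2
      with nx(1)[of "y - x"] have "l * moment S x (y - x) \<le> (y - x)\<^sup>2 / 2" by simp
      then show ?thesis using moment_primitive(1)[OF S G, of "y - x" x] 2 by simp
    next
      case 3
      with nx(2)[of "x - y"] have "l * moment (uminus ` S) (- x) (x - y) \<le> (x - y)\<^sup>2 / 2" by simp
      then show ?thesis using moment_primitive(2)[OF S G, of "x - y" x] 3
        by (simp add: algebra_simps)
    qed simp
  qed
next
  assume *: "\<forall>y. G x + (x - l * cum S x) * (y - x) \<le> G y"
  have "l * moment S x h \<le> h\<^sup>2 / 2 \<and> l * moment (uminus ` S) (- x) h \<le> h\<^sup>2 / 2" if "0 < h" for h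
    using *[rule_format, of "x + h"] *[rule_format, of "x - h"] that
      moment_primitive[OF S G, of h x] by auto
  then show "x \<notin> grow l S"
    by (auto simp: grow_def not_less)
qed

lemma open_grow:
  assumes S: "S \<in> sets lebesgue" shows "open (grow l S)"
proof -
  obtain G where G: "\<And>x. (G has_real_derivative x - l * cum S x) (at x)"
    using primitive_exists[OF S, of l] by blast
  then have cG: "continuous_on UNIV G"
    by (meson DERIV_isCont continuous_at_imp_continuous_on)
  have "- grow l S = (\<Inter>y. {x. G x + (x - l * cum S x) * (y - x) \<le> G y})"
    using not_grow_iff[OF S G] by auto
  moreover have "closed {x. G x + (x - l * cum S x) * (y - x) \<le> G y}" for y
    by (intro closed_Collect_le continuous_intros cG S)
  ultimately show ?thesis
    by (metis (no_types, lifting) closed_INT open_closed)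
qed

lemma grow_sets_lebesgue: "S \<in> sets lebesgue \<Longrightarrow> grow l S \<in> sets lebesgue"
  using open_grow[of S l] by (metis borel_open sets_completionI_sets sets_lborel)

text \<open>Between two points of the contact set with different slopes, the minimum of \<open>G\<close> minus a line of
  intermediate slope is another contact point.\<close>

lemma contact_gap:
  fixes G k :: "real \<Rightarrow> real"
  assumes G: "\<And>x. (G has_real_derivative k x) (at x)"
    and ab: "a < b" and a: "\<And>y. G a + k a * (y - a) \<le> G y" and b: "\<And>y. G b + k b * (y - b) \<le> G y"
    and gap: "\<And>x. a < x \<Longrightarrow> x < b \<Longrightarrow> \<exists>y. G y < G x + k x * (y - x)"
  shows "k a = k b" "G b = G a + k a * (b - a)"
proof -
  have "0 \<le> (k b - k a) * (b - a)"
    using a[of b] b[of a] by (simp add: algebra_simps)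
  then have le: "k a \<le> k b" using ab by (simp add: zero_le_mult_iff)
  show eq: "k a = k b"
  proof (rule ccontr)
    assume "k a \<noteq> k b"
    define m where "m = (k a + k b) / 2"
    have m: "k a < m" "m < k b" using le \<open>k a \<noteq> k b\<close> by (auto simp: m_def)
    have D: "((\<lambda>x. G x - m * x) has_real_derivative k x - m) (at x)" for x
      by (auto intro!: derivative_eq_intros G)
    have "continuous_on {a..b} (\<lambda>x. G x - m * x)"
      using D by (meson DERIV_isCont continuous_at_imp_continuous_on)
    then obtain z where z: "z \<in> {a..b}" "\<And>y. y \<in> {a..b} \<Longrightarrow> G z - m * z \<le> G y - m * y"
      using continuous_attains_inf[of "{a..b}" "\<lambda>x. G x - m * x"] ab by auto
    have "z \<noteq> a"
    proof
      assume "z = a"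
      have "k a - m < 0" using m by simp
      from DERIV_neg_dec_right[OF D this] obtain d where "0 < d"
        "\<And>h. 0 < h \<Longrightarrow> h < d \<Longrightarrow> G (a + h) - m * (a + h) < G a - m * a" by blast
      moreover define e where "e = min (d/2) (b - a)"
      ultimately have "0 < e" "e < d" "e \<le> b - a" "G (a + e) - m * (a + e) < G a - m * a"
        using ab by auto
      with z(2)[of "a + e"] \<open>z = a\<close> show False by auto
    qed
    moreover have "z \<noteq> b"
    proof
      assume "z = b"
      have "0 < k b - m" using m by simp
      from DERIV_pos_inc_left[OF D this] obtain d where "0 < d"
        "\<And>h. 0 < h \<Longrightarrow> h < d \<Longrightarrow> G (b - h) - m * (b - h) < G b - m * b" by blast
      moreover define e where "e = min (d/2) (b - a)"
      ultimately have "0 < e" "e < d" "e \<le> b - a" "G (b - e) - m * (b - e) < G b - m * b"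
        using ab by auto
      with z(2)[of "b - e"] \<open>z = b\<close> show False by auto
    qed
    ultimately have zab: "a < z" "z < b" using z(1) by auto
    have "k z - m = 0"
      by (rule DERIV_local_min[OF D, of "min (z - a) (b - z)"])
        (use zab z(2) in \<open>auto simp: abs_real_def split: if_splits\<close>)
    \<comment> \<open>Left of \<open>a\<close> the tangent at \<open>a\<close> lies above the line
      of slope \<open>m\<close> because \<open>k a < m\<close>, and likewise right of
      \<open>b\<close>; so the minimum over \<open>{a..b}\<close> is global.\<close>
    have "G z + m * (y - z) \<le> G y" for y
    proof -
      consider "y < a" | "y \<in> {a..b}" | "b < y" by fastforce
      then show ?thesis
      proof cases
        case 1
        have "0 \<le> (m - k a) * (a - y)" using 1 m by simp
        then show ?thesis using a[of y] z(2)[of a] ab by (simp add: algebra_simps)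
      next
        case 2
        then show ?thesis using z(2)[of y] by (simp add: algebra_simps)
      next
        case 3
        have "0 \<le> (k b - m) * (y - b)" using 3 m by simp
        then show ?thesis using b[of y] z(2)[of b] ab by (simp add: algebra_simps)
      qed
    qed
    with gap[OF zab] \<open>k z - m = 0\<close> show False
      by (metis eq_iff_diff_eq_0 linorder_not_less)
  qed
  show "G b = G a + k a * (b - a)"
    using a[of b] b[of a] eq by (simp add: algebra_simps)
qed

text \<open>Over one period \<open>G\<close> gains an affine function of slope
  \<open>mu = 1 - l * p\<close>. As \<open>mu\<close> is not negative, \<open>G\<close> minus a
  suitable linear function attains a global minimum, and a minimum point has a supporting
  line.\<close>

lemma contact_exists:
  assumes S: "S \<in> sets lebesgue" and p: "\<And>x. mass S x (x + 1) = p" and "l * p \<le> 1"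
  obtains x where "x \<notin> grow l S"
proof -
  obtain G where G: "\<And>x. (G has_real_derivative x - l * cum S x) (at x)"
    using primitive_exists[OF S, of l] by blast
  \<comment> \<open>With this slope \<open>G - m x\<close> has equal values at \<open>0\<close> and
    \<open>1\<close>, so its increment from \<open>x\<close> to \<open>x + 1\<close> is exactly
    \<open>mu * x\<close>: integer steps away from \<open>{0..1}\<close> in either direction never
    decrease it.\<close>
  define m where "m = G 1 - G 0"
  define mu where "mu = 1 - l * p"
  have per: "G (x + 1) - G x - mu * x = G (0 + 1) - G 0 - mu * 0" for x
  proof (rule DERIV_isconst_all[of "\<lambda>x. G (x + 1) - G x - mu * x" x 0], intro allI)
    fix x
    have "((\<lambda>x. G (x + 1) - G x - mu * x) has_real_derivative
      (x + 1 - l * cum S (x + 1)) * 1 - (x - l * cum S x) - mu) (at x)"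
      by (auto intro!: derivative_eq_intros DERIV_chain2[OF G] G)
    moreover have "(x + 1 - l * cum S (x + 1)) * 1 - (x - l * cum S x) - mu = 0"
      using cum_diff[OF S, of x "x + 1"] p[of x] by (simp add: mu_def algebra_simps)
    ultimately show "((\<lambda>x. G (x + 1) - G x - mu * x) has_real_derivative 0) (at x)" by simp
  qed
  have step: "G (x + 1) - m * (x + 1) = G x - m * x + mu * x" for x
    using per[of x] by (simp add: m_def algebra_simps)
  have mu: "0 \<le> mu" using assms(3) by (simp add: mu_def)
  have "continuous_on {0..1} (\<lambda>x. G x - m * x)"
    using G by (intro continuous_intros) (meson DERIV_isCont continuous_at_imp_continuous_on)
  then obtain z where z: "z \<in> {0..1}" "\<And>y. y \<in> {0..1} \<Longrightarrow> G z - m * z \<le> G y - m * y"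
    using continuous_attains_inf[of "{0..1}" "\<lambda>x. G x - m * x"] by auto
  have up: "G z - m * z \<le> G (y + real n) - m * (y + real n)" if "y \<in> {0..1}" for y n
  proof (induction n)
    case (Suc n)
    have "0 \<le> mu * (y + real n)" using mu that by simp
    with Suc step[of "y + real n"] show ?case by (simp add: algebra_simps)
  qed (use z(2)[OF that] in simp)
  have down: "G z - m * z \<le> G (y - real n) - m * (y - real n)" if "y \<in> {0..1}" for y n
  proof (induction n)
    case (Suc n)
    have "mu * (y - real (Suc n)) \<le> 0" using mu that by (simp add: mult_nonneg_nonpos)
    with Suc step[of "y - real (Suc n)"] show ?case by (simp add: algebra_simps)
  qed (use z(2)[OF that] in simp)
  have min: "G z - m * z \<le> G y - m * y" for y
  proof (cases "0 \<le> y")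
    case True
    then have "y = frac y + real (nat \<lfloor>y\<rfloor>)" by (simp add: frac_def)
    with up[of "frac y" "nat \<lfloor>y\<rfloor>"] show ?thesis by (simp add: frac_lt_1 less_imp_le)
  next
    case False
    then have "y = frac y - real (nat (- \<lfloor>y\<rfloor>))" by (simp add: frac_def)
    with down[of "frac y" "nat (- \<lfloor>y\<rfloor>)"] show ?thesis by (simp add: frac_lt_1 less_imp_le)
  qed
  have "((\<lambda>x. G x - m * x) has_real_derivative z - l * cum S z - m) (at z)"
    by (auto intro!: derivative_eq_intros G)
  then have "z - l * cum S z - m = 0"
    using min by (intro DERIV_local_min[of "\<lambda>x. G x - m * x" _ z 1]) auto
  then have "z \<notin> grow l S"
    unfolding not_grow_iff[OF S G]
  proof (intro allI)
    fix y
    have "z - l * cum S z = m" using \<open>z - l * cum S z - m = 0\<close> by simp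
    then show "G z + (z - l * cum S z) * (y - z) \<le> G y"
      using min[of y] by (simp only:) (simp add: algebra_simps)
  qed
  then show ?thesis using that by blast
qed


section \<open>Components of open sets, integration over them, and density\<close>

lemma real_component_interval:
  fixes V :: "real set"
  assumes "open V" "bounded V" "c \<in> components V"
  obtains a b where "a < b" "c = {a<..<b}" "a \<notin> V" "b \<notin> V"
proof -
  have c: "c \<noteq> {}" "connected c" "open c" "c \<subseteq> V"
    using assms in_components_nonempty in_components_connected open_components
      in_components_subset by blast+
  have bc: "bdd_below c" "bdd_above c"
    using bounded_subset[OF assms(2) c(4)] by (auto simp: bounded_imp_bdd_below bounded_imp_bdd_above)
  define a where "a = Inf c"
  define b where "b = Sup c"
  have a: "a < x" if "x \<in> c" for x
  proof -
    obtain e where e: "0 < e" "ball x e \<subseteq> c" by (rule openE[OF c(3) \<open>x \<in> c\<close>])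
    have "x - e/2 \<in> ball x e" using e(1) by (simp add: dist_real_def)
    with e have "x - e/2 \<in> c" "0 < e" by blast+
    then show ?thesis using cInf_lower[of "x - e/2" c] bc(1) by (simp add: a_def)
  qed
  have b: "x < b" if "x \<in> c" for x
  proof -
    obtain e where e: "0 < e" "ball x e \<subseteq> c" by (rule openE[OF c(3) \<open>x \<in> c\<close>])
    have "x + e/2 \<in> ball x e" using e(1) by (simp add: dist_real_def)
    with e have "x + e/2 \<in> c" "0 < e" by blast+
    then show ?thesis using cSup_upper[of "x + e/2" c] bc(2) by (simp add: b_def)
  qed
  have sub: "x \<in> c" if ax: "a < x" "x < b" for x
  proof -
    obtain y where "y \<in> c" "y < x" using cInf_lessD[OF c(1), of x] ax(1) by (auto simp: a_def)
    moreover obtain z where "z \<in> c" "x < z" using less_cSupD[OF c(1), of x] ax(2) by (auto simp: b_def)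
    ultimately show ?thesis using c(2) unfolding connected_iff_interval by fastforce
  qed
  have eq: "c = {a<..<b}" using a b sub by auto
  then have ab: "a < b" using c(1) by auto
  have max: "T \<subseteq> c" if "connected T" "T \<subseteq> V" "T \<inter> c \<noteq> {}" for T
    using components_maximal[OF assms(3) that(1,2)] that(3) by auto
  have w: "(a + b) / 2 \<in> {a<..<b}" using ab by auto
  have "a \<notin> V"
  proof
    assume "a \<in> V"
    have "{a..<b} \<subseteq> c"
    proof (rule max)
      have "{a..<b} = insert a c" using ab by (auto simp: eq)
      then show "{a..<b} \<subseteq> V" using c(4) \<open>a \<in> V\<close> by simp
      have "(a + b) / 2 \<in> {a..<b} \<inter> c" using w by (simp add: eq)
      then show "{a..<b} \<inter> c \<noteq> {}" by blast
    qed simp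
    then have "a \<in> c" using ab by auto
    then show False using a by blast
  qed
  moreover have "b \<notin> V"
  proof
    assume "b \<in> V"
    have "{a<..b} \<subseteq> c"
    proof (rule max)
      have "{a<..b} = insert b c" using ab by (auto simp: eq)
      then show "{a<..b} \<subseteq> V" using c(4) \<open>b \<in> V\<close> by simp
      have "(a + b) / 2 \<in> {a<..b} \<inter> c" using w by (simp add: eq)
      then show "{a<..b} \<inter> c \<noteq> {}" by blast
    qed simp
    then have "b \<in> c" using ab by auto
    then show False using b by blast
  qed
  ultimately show ?thesis using that ab eq by blast
qed

text \<open>The components are countably many and disjoint, so the integral over \<open>V\<close> is
  a limit of finite sums of integrals over components.\<close>

lemma set_integral_components_nonneg:
  fixes f :: "real \<Rightarrow> real"
  assumes V: "open V" and f: "set_integrable lebesgue V f"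
    and c: "\<And>c. c \<in> components V \<Longrightarrow> 0 \<le> (LINT x:c|lebesgue. f x)"
  shows "0 \<le> (LINT x:V|lebesgue. f x)"
proof -
  have oc: "open c" if "c \<in> components V" for c
    using open_components[OF V that] .
  have cc: "countable (components V)"
    using oc components_nonoverlap[of _ V]
    by (intro countable_disjoint_open_subsets) (auto simp: pairwise_def disjnt_def)
  \<comment> \<open>\<open>A n\<close> is the component with index \<open>n\<close>, or empty if
    there is none; finitely and infinitely many components are thus treated alike.\<close>
  define A where "A n = \<Union>{c \<in> components V. to_nat_on (components V) c = n}" for n
  have A: "A n = {} \<or> A n \<in> components V" for n
  proof (cases "\<exists>c \<in> components V. to_nat_on (components V) c = n")
    case True
    then obtain c where "c \<in> components V" "to_nat_on (components V) c = n" by blast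
    then have "{c \<in> components V. to_nat_on (components V) c = n} = {c}"
      using inj_on_to_nat_on[OF cc] by (auto dest: inj_onD)
    then show ?thesis using \<open>c \<in> components V\<close> by (simp add: A_def)
  qed (auto simp: A_def)
  have disj: "A i \<inter> A j = {}" if "i \<noteq> j" for i j
  proof -
    have "c \<inter> c' = {}" if "c \<in> components V" "c' \<in> components V"
      "to_nat_on (components V) c = i" "to_nat_on (components V) c' = j" for c c'
      using that \<open>i \<noteq> j\<close> components_nonoverlap[of c V c'] by auto
    then show ?thesis unfolding A_def by blast
  qed
  have UA: "(\<Union>n. A n) = V"
    using Union_components[of V] unfolding A_def by blast
  have mA: "A n \<in> sets lebesgue" for n
    using A[of n] oc by (metis borel_open sets_completionI_sets sets_lborel sets.empty_sets)
  have U: "(\<Union>n. \<Union>i<n. A i) = V"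
    using UA by blast
  have "(\<lambda>n. LINT x:(\<Union>i<n. A i)|lebesgue. f x) \<longlonglongrightarrow> (LINT x:(\<Union>n. \<Union>i<n. A i)|lebesgue. f x)"
    by (rule set_integral_cont_up) (use mA f U in \<open>auto simp: incseq_def intro: less_le_trans\<close>)
  moreover have "0 \<le> (LINT x:(\<Union>i<n. A i)|lebesgue. f x)" for n
  proof -
    have "(LINT x:(\<Union>i<n. A i)|lebesgue. f x) = (\<Sum>i<n. LINT x:A i|lebesgue. f x)"
      using disj mA UA by (intro set_integral_finite_Union)
        (auto simp: disjoint_family_on_def intro!: set_integrable_subset[OF f])
    moreover have "0 \<le> (LINT x:A i|lebesgue. f x)" for i
      using A[of i] c[of "A i"] by (auto simp: set_lebesgue_integral_def)
    ultimately show ?thesis by (simp add: sum_nonneg)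
  qed
  ultimately show ?thesis
    unfolding U using LIMSEQ_le_const by blast
qed

lemma set_integral_components_zero:
  fixes f :: "real \<Rightarrow> real"
  assumes V: "open V" and f: "set_integrable lebesgue V f"
    and c: "\<And>c. c \<in> components V \<Longrightarrow> (LINT x:c|lebesgue. f x) = 0"
  shows "(LINT x:V|lebesgue. f x) = 0"
proof -
  have m: "(LINT x:c|lebesgue. - f x) = - (LINT x:c|lebesgue. f x)" for c
    by (simp add: set_lebesgue_integral_def)
  have "set_integrable lebesgue V (\<lambda>x. - f x)"
    using f by (simp add: set_integrable_def)
  from set_integral_components_nonneg[OF V this] set_integral_components_nonneg[OF V f] c m
  show ?thesis by simp
qed

lemma indicator_integral:
  fixes A S :: "real set"
  assumes A: "A \<in> lmeasurable" and S: "S \<in> sets lebesgue"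
  shows "set_integrable lebesgue A (\<lambda>x. u + v * indicat_real S x)"
    and "(LINT x:A|lebesgue. u + v * indicat_real S x) = u * measure lebesgue A + v * measure lebesgue (A \<inter> S)"
proof -
  have eq: "indicat_real A x *\<^sub>R (u + v * indicat_real S x) = u * indicator A x + v * indicator (A \<inter> S) x" for x
    by (auto simp: indicator_def)
  have AS: "A \<inter> S \<in> lmeasurable" using A S by (simp add: fmeasurable_Int_fmeasurable)
  have [simp]: "integrable lebesgue (indicat_real A)" "integrable lebesgue (indicat_real (A \<inter> S))"
    using A AS by (auto simp: integrable_indicator_iff fmeasurable_def top.not_eq_extremum)
  show "set_integrable lebesgue A (\<lambda>x. u + v * indicat_real S x)"
    unfolding set_integrable_def eq by simp
  show "(LINT x:A|lebesgue. u + v * indicat_real S x) = u * measure lebesgue A + v * measure lebesgue (A \<inter> S)"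
    unfolding set_lebesgue_integral_def eq by simp
qed

lemma mass_open:
  assumes S: "S \<in> sets lebesgue" shows "measure lebesgue ({a<..<b} \<inter> S) = mass S a b"
proof -
  have "S \<inter> {a<..<b} \<in> lmeasurable"
    using S by (intro bounded_set_imp_lmeasurable) (auto simp: bounded_Int)
  then have "integral {a<..<b} (indicat_real S) = measure lebesgue (S \<inter> {a<..<b})"
    by (rule integral_indicator)
  then show ?thesis
    by (simp add: integral_open_interval_real mass_integral[OF S] Int_commute)
qed

lemma indicator_integral_mass:
  assumes S: "S \<in> sets lebesgue" and ab: "a \<le> b"
  shows "(LINT x:{a<..<b}|lebesgue. u + v * indicat_real S x) = u * (b - a) + v * mass S a b"
proof -
  have "{a<..<b} \<in> lmeasurable" "measure lebesgue {a<..<b} = b - a" using ab by simp_all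
  then show ?thesis
    using indicator_integral(2)[OF _ S, of "{a<..<b}" u v] by (simp only: mass_open[OF S])
qed

text \<open>A weak form of the Lebesgue density theorem. If all intervals had density at most
  \<open>1 - e\<close>, summing over the components of a tight open neighbourhood of a bounded part
  of \<open>D\<close> would make that part smaller than it is.\<close>

lemma high_density_interval:
  fixes D :: "real set"
  assumes D: "D \<in> sets lebesgue" "D \<notin> null_sets lebesgue" and e: "0 < e" "e < 1"
  obtains a b where "a < b" "(1 - e) * (b - a) < mass D a b"
proof -
  have "\<exists>n. D \<inter> {- real n<..<real n} \<notin> null_sets lebesgue"
  proof (rule ccontr)
    assume "\<not> ?thesis"
    then have "(\<Union>n. D \<inter> {- real n<..<real n}) \<in> null_sets lebesgue"
      by (intro null_sets_UN) simp
    moreover have "(\<Union>n. D \<inter> {- real n<..<real n}) = D"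
    proof (intro equalityI subsetI)
      fix x assume "x \<in> D"
      moreover obtain n where "\<bar>x\<bar> < real n" using reals_Archimedean2 by blast
      ultimately show "x \<in> (\<Union>n. D \<inter> {- real n<..<real n})" by (intro UN_I[of n]) (auto simp: abs_less_iff)
    qed auto
    ultimately show False using D by simp
  qed
  then obtain n where n: "D \<inter> {- real n<..<real n} \<notin> null_sets lebesgue" by blast
  define B where "B = D \<inter> {- real n<..<real n}"
  have B: "B \<in> lmeasurable"
    unfolding B_def using D by (intro bounded_set_imp_lmeasurable) (auto simp: bounded_Int)
  have mB: "0 < measure lebesgue B"
    using n B unfolding B_def
    by (metis fmeasurableD measure_nonneg negligible_iff_measure0 negligible_iff_null_sets less_le)
  \<comment> \<open>With this \<open>d\<close> the final bound
    \<open>(1 - e) * (measure lebesgue B + d)\<close> equals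
    \<open>measure lebesgue B - d - e * d\<close>, which is too small.\<close>
  define d where "d = e * measure lebesgue B / 2"
  have "0 < d" using e mB by (simp add: d_def)
  obtain W where W: "open W" "B \<subseteq> W" "W - B \<in> lmeasurable" "emeasure lebesgue (W - B) < ennreal d"
    using sets_lebesgue_outer_open[OF fmeasurableD[OF B] \<open>0 < d\<close>] .
  define V where "V = W \<inter> {- real n<..<real n}"
  have V: "open V" "bounded V" "B \<subseteq> V" "V \<subseteq> W"
    using W by (auto simp: V_def B_def bounded_Int)
  have mV: "V \<in> lmeasurable"
    using V lmeasurable_open by blast
  have "measure lebesgue (V - B) \<le> measure lebesgue (W - B)"
    by (rule measure_mono_fmeasurable) (use V W B mV in auto)
  also have "\<dots> < d"
    using W(3,4) \<open>0 < d\<close> by (simp add: emeasure_eq_measure2 ennreal_less_iff)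
  finally have "measure lebesgue V < measure lebesgue B + d"
    using measurable_measure_Diff[OF mV fmeasurableD[OF B] V(3)] by simp
  show ?thesis
  proof (rule ccontr)
    assume "\<not> thesis"
    with that have le: "mass D a b \<le> (1 - e) * (b - a)" if "a < b" for a b
      using that by (meson not_le)
    note int = indicator_integral[OF mV fmeasurableD[OF B], of "1 - e" "-1"]
    have "0 \<le> (LINT x:V|lebesgue. (1 - e) + (-1) * indicat_real B x)"
    proof (rule set_integral_components_nonneg[OF V(1) int(1)])
      fix c assume "c \<in> components V"
      then obtain a b where ab: "a < b" "c = {a<..<b}"
        using real_component_interval[OF V(1,2)] by metis
      have "mass B a b \<le> mass D a b"
        by (rule mass_mono) (use D B in \<open>auto simp: B_def\<close>)
      then show "0 \<le> (LINT x:c|lebesgue. (1 - e) + (-1) * indicat_real B x)"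
        using le[OF ab(1)] indicator_integral_mass[OF fmeasurableD[OF B], of a b "1 - e" "-1"] ab
        by simp
    qed
    also have "\<dots> = (1 - e) * measure lebesgue V - measure lebesgue B"
      using int(2) V(3) by (simp add: Int_absorb1)
    finally have "measure lebesgue B \<le> (1 - e) * measure lebesgue V" by simp
    also have "\<dots> \<le> (1 - e) * (measure lebesgue B + d)"
      using \<open>measure lebesgue V < _\<close> e by (intro mult_left_mono) auto
    also have "(1 - e) * (measure lebesgue B + d) = measure lebesgue B + d - e * measure lebesgue B - e * d"
      by (simp add: algebra_simps)
    also have "e * measure lebesgue B = 2 * d" by (simp add: d_def)
    finally show False using \<open>0 < d\<close> mult_pos_pos[OF e(1) \<open>0 < d\<close>] by simp
  qed
qed

text \<open>Starting from a contact point near the left end of an interval in which \<open>S\<close> is dense, the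
  contact inequality at the right end fails.\<close>

lemma contact_null:
  assumes S: "S \<in> sets lebesgue" and l: "1 < l"
  shows "S - grow l S \<in> null_sets lebesgue"
proof (rule ccontr)
  define D where "D = S - grow l S"
  have D: "D \<in> sets lebesgue" using S grow_sets_lebesgue[OF S] by (auto simp: D_def)
  \<comment> \<open>Chosen so that \<open>2 * l * e = (l - 1) / 2\<close>: the contact inequality
    then forces \<open>h <= L / 2\<close>, whereas
    \<open>h >= (1 - e) * L > 3/4 * L\<close>.\<close>
  define e where "e = (l - 1) / (4 * l)"
  have e: "0 < e" "e < 1/4" using l by (auto simp: e_def field_simps)
  assume "S - grow l S \<notin> null_sets lebesgue"
  then obtain a b where ab: "a < b" "(1 - e) * (b - a) < mass D a b"
    using high_density_interval[OF D _ e(1)] e(2) unfolding D_def by auto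
  define L where "L = b - a"
  have L: "0 < L" "b = a + L" "(1 - e) * L < mass D a b" using ab by (auto simp: L_def)
  have eL: "0 < e * L" "e * L < L" using e L by auto
  obtain x where x: "x \<in> D" "a \<le> x" "x \<le> a + e * L"
  proof (rule ccontr)
    assume "\<not> thesis"
    with that have "D \<inter> {a..a + e * L} = {}" by fastforce
    then have "mass D a (a + e * L) = 0" by (simp add: mass_def)
    moreover have "mass D a b = mass D a (a + e * L) + mass D (a + e * L) b"
      by (rule mass_add[OF D]) (use eL L in auto)
    moreover have "mass D (a + e * L) b \<le> b - (a + e * L)"
      by (rule mass_le[OF D]) (use eL L in auto)
    ultimately show False using L by (simp add: algebra_simps)
  qed
  define h where "h = b - x"
  have h: "(1 - e) * L \<le> h" "h \<le> L" "0 < h"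
    using x(2,3) eL L(1,2) unfolding h_def left_diff_distrib by linarith+
  \<comment> \<open>In all of \<open>{a..b}\<close> less than \<open>e * L\<close> is missing from
    \<open>D\<close>, hence no more than that in \<open>{x..x + u}\<close>.\<close>
  have low: "u - e * L \<le> mass S x (x + u)" if "u \<in> {0..h}" for u
  proof -
    have "mass D a b = mass D a x + (mass D x (x + u) + mass D (x + u) b)"
      using mass_add[OF D, of a x b] mass_add[OF D, of x "x + u" b] that x h by (auto simp: h_def)
    moreover have "mass D a x \<le> x - a" "mass D (x + u) b \<le> b - (x + u)"
      using that x h by (auto intro!: mass_le[OF D] simp: h_def)
    moreover have "mass D x (x + u) \<le> mass S x (x + u)"
      by (rule mass_mono) (use S D in \<open>auto simp: D_def\<close>)
    ultimately show ?thesis using L by (simp add: algebra_simps)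
  qed
  have "((\<lambda>u. u - e * L) has_integral ((h\<^sup>2 / 2 - e * L * h) - (0\<^sup>2 / 2 - e * L * 0))) {0..h}"
    using h by (intro fundamental_theorem_of_calculus)
      (auto intro!: derivative_eq_intros simp: has_real_derivative_iff_has_vector_derivative[symmetric])
  then have "h\<^sup>2 / 2 - e * L * h \<le> moment S x h"
    unfolding moment_def using low
    by (intro has_integral_le[OF _ integrable_integral[OF mass_integrable[OF S]]]) auto
  then have "l * (h\<^sup>2 / 2 - e * L * h) \<le> l * moment S x h"
    using l by simp
  also have "\<dots> \<le> h\<^sup>2 / 2"
    using x(1) h(3) unfolding D_def grow_def by (simp add: not_less, metis not_less)
  finally have "h * (l * (h / 2 - e * L)) \<le> h * (h / 2)"
    by (simp add: algebra_simps power2_eq_square)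
  then have "l * (h / 2 - e * L) \<le> h / 2"
    using h(3) mult_le_cancel_left_pos by blast
  then have "(l - 1) * h \<le> 2 * (l * e) * L" by (simp add: algebra_simps)
  also have "2 * (l * e) = (l - 1) / 2" using l by (simp add: e_def)
  finally have "(l - 1) * h \<le> (l - 1) * (L / 2)" by simp
  then have "h \<le> L / 2" using l by (metis diff_gt_0_iff_gt mult_le_cancel_left_pos)
  moreover have "(1 - e) * L > (3/4) * L" using e L by simp
  ultimately show False using h L by linarith
qed


section \<open>Mass and moments of the grown set\<close>

text \<open>A window between two contact points makes the open set bounded without creating
  artificial endpoints: an endpoint of a component is interior to the window, hence not in
  \<open>grow l S\<close>, or it is \<open>x\<close> or \<open>y\<close>. Then
  \<open>contact_gap\<close> applies: equal slopes give \<open>l * mass S a b = b - a\<close>, and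
  equal tangents encode the centre of mass.\<close>

lemma grow_component:
  assumes S: "S \<in> sets lebesgue" and G: "\<And>x. (G has_real_derivative x - l * cum S x) (at x)"
    and xy: "x \<notin> grow l S" "y \<notin> grow l S" and c: "c \<in> components (grow l S \<inter> {x<..<y})"
  obtains a b where "a < b" "c = {a<..<b}" "x \<le> a" "b \<le> y" "a \<notin> grow l S" "b \<notin> grow l S"
    "l * mass S a b = b - a" "G b = G a + (a - l * cum S a) * (b - a)"
proof -
  let ?V = "grow l S \<inter> {x<..<y}"
  have "open ?V" "bounded ?V" using open_grow[OF S] by (auto simp: bounded_Int)
  then obtain a b where ab: "a < b" "c = {a<..<b}" "a \<notin> ?V" "b \<notin> ?V"
    using real_component_interval[OF _ _ c] by metis
  have sub: "{a<..<b} \<subseteq> ?V" using in_components_subset[OF c] ab(2) by simp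
  moreover have "(a + b) / 2 \<in> {a<..<b}" using ab(1) by auto
  ultimately have "(a + b) / 2 \<in> ?V" by blast
  have xa: "x \<le> a"
  proof (rule ccontr)
    assume "\<not> x \<le> a"
    moreover have "x \<le> (a + b) / 2" using \<open>(a + b) / 2 \<in> ?V\<close> by auto
    ultimately have "x \<in> {a<..<b}" using ab(1) by auto
    with sub show False by auto
  qed
  have yb: "b \<le> y"
  proof (rule ccontr)
    assume "\<not> b \<le> y"
    moreover have "(a + b) / 2 \<le> y" using \<open>(a + b) / 2 \<in> ?V\<close> by auto
    ultimately have "y \<in> {a<..<b}" using ab(1) by auto
    with sub show False by auto
  qed
  have na: "a \<notin> grow l S" using xa yb ab xy by (cases "a = x") auto
  have nb: "b \<notin> grow l S" using xa yb ab xy by (cases "b = y") auto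
  have gap: "\<exists>y. G y < G z + (z - l * cum S z) * (y - z)" if "a < z" "z < b" for z
    using sub that not_grow_iff[OF S G, of z] by (force simp: not_le)
  have ca: "G a + (a - l * cum S a) * (z - a) \<le> G z" and cb: "G b + (b - l * cum S b) * (z - b) \<le> G z" for z
    using na nb not_grow_iff[OF S G] by blast+
  note cg = contact_gap[where k = "\<lambda>x. x - l * cum S x", OF G ab(1) ca cb gap]
  have "cum S b - cum S a = mass S a b" using cum_diff[OF S] ab(1) by simp
  then have "l * mass S a b = l * cum S b - l * cum S a"
    by (metis right_diff_distrib)
  then have "l * mass S a b = b - a" using cg(1) by simp
  with that ab xa yb na nb cg(2) show ?thesis by blast
qed

text \<open>\<open>1 - l * indicat_real S\<close> has integral zero over each component of
  \<open>grow l S\<close> in the window, and the part of \<open>S\<close> outside the components is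
  null.\<close>

lemma grow_mass:
  assumes S: "S \<in> sets lebesgue" and l: "1 < l" and xy: "x \<le> y" "x \<notin> grow l S" "y \<notin> grow l S"
  shows "mass (grow l S) x y = l * mass S x y"
proof -
  obtain G where G: "\<And>x. (G has_real_derivative x - l * cum S x) (at x)"
    using primitive_exists[OF S, of l] by blast
  let ?U = "grow l S"
  let ?V = "{x<..<y} \<inter> ?U"
  have U: "?U \<in> sets lebesgue" by (rule grow_sets_lebesgue[OF S])
  have V: "open ?V" "?V \<in> lmeasurable"
    using open_grow[OF S] by (auto simp: bounded_Int intro!: lmeasurable_open)
  have "(LINT x:?V|lebesgue. 1 + (-l) * indicat_real S x) = 0"
  proof (rule set_integral_components_zero[OF V(1) indicator_integral(1)[OF V(2) S]])
    fix c assume "c \<in> components ?V"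
    then obtain a b where "a < b" "c = {a<..<b}" "l * mass S a b = b - a"
      using grow_component[OF S G xy(2,3)] by (metis Int_commute)
    then show "(LINT x:c|lebesgue. 1 + (-l) * indicat_real S x) = 0"
      using indicator_integral_mass[OF S, of a b 1 "-l"] by simp
  qed
  then have "measure lebesgue ?V = l * measure lebesgue (?V \<inter> S)"
    using indicator_integral(2)[OF V(2) S, of 1 "-l"] by simp
  moreover have "measure lebesgue ?V = mass ?U x y" by (rule mass_open[OF U])
  moreover have "measure lebesgue (?V \<inter> S) = mass S x y"
  proof -
    have "measure lebesgue (?V \<inter> S) = measure lebesgue ({x<..<y} \<inter> S)"
    proof (rule measure_eq_AE)
      show "AE z in lebesgue. (z \<in> ?V \<inter> S) = (z \<in> {x<..<y} \<inter> S)"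
        using AE_not_in[OF contact_null[OF S l]] by eventually_elim auto
    qed (use S U in \<open>auto intro!: sets.Int\<close>)
    then show ?thesis using mass_open[OF S] by (rule trans)
  qed
  ultimately show ?thesis by metis
qed

text \<open>The difference of both sides is the integral of
  \<open>J s = mass U x s - l * mass S x s\<close> over \<open>{x..x + h}\<close>. Contact points
  have \<open>J = 0\<close>, and a whole component contributes nothing because its two tangents
  coincide. What is left comes from at most one component cut off at \<open>x + h\<close>; it equals
  the height of \<open>G\<close> over the tangent at the left end, which is a contact point.\<close>

lemma moment_grow_le:
  assumes S: "S \<in> sets lebesgue" and l: "1 < l" and x: "x \<notin> grow l S" and h: "0 \<le> h"
  shows "l * moment S x h \<le> moment (grow l S) x h"
proof -
  define U where "U = grow l S"
  have U: "U \<in> sets lebesgue" unfolding U_def by (rule grow_sets_lebesgue[OF S])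
  obtain G where G: "\<And>x. (G has_real_derivative x - l * cum S x) (at x)"
    using primitive_exists[OF S, of l] by blast
  obtain H where H: "\<And>x. (H has_real_derivative x - 1 * cum U x) (at x)"
    using primitive_exists[OF U, of 1] by blast
  \<comment> \<open>\<open>k\<close> is the derivative of \<open>G\<close>, and \<open>W\<close> is
    a primitive of \<open>J\<close> built from \<open>G\<close> and \<open>H\<close>, so that
    integrals of \<open>J\<close> become increments of \<open>W\<close>.\<close>
  define k where "k s = s - l * cum S s" for s
  define J where "J s = (cum U s - cum U x) - l * (cum S s - cum S x)" for s
  define W where "W s = G s - k x * s - H s + (x - cum U x) * s" for s
  have J: "J s = k s - k x - (s - 1 * cum U s) + (x - cum U x)" for s
    by (simp add: J_def k_def algebra_simps)
  have W: "(W has_real_derivative J s) (at s within T)" for s T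
    unfolding J W_def k_def
    by (rule has_field_derivative_at_within) (auto intro!: derivative_eq_intros G H)
  have IJ: "(J has_integral (W b - W a)) {a..b}" if "a \<le> b" for a b
    using that W by (intro fundamental_theorem_of_calculus)
      (auto simp: has_real_derivative_iff_has_vector_derivative[symmetric])
  have J0: "J p = 0" if "x \<le> p" "p \<notin> U" for p
    using grow_mass[OF S l that(1) x] that cum_diff[OF S that(1)] cum_diff[OF U that(1)]
    by (simp add: J_def U_def)
  \<comment> \<open>Within a stretch of \<open>U\<close> starting at a contact point
    \<open>p\<close>, the mass of \<open>U\<close> is the length, so \<open>J s\<close> reduces to
    \<open>k s - k p\<close>.\<close>
  have gap: "W q - W p = G q - G p - k p * (q - p)"
    if p: "x \<le> p" "p \<notin> U" "p \<le> q" "{p<..<q} \<subseteq> U" for p q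
  proof -
    have "J s = k s - k p" if "s \<in> {p..q}" for s
    proof -
      have "{p<..<s} \<inter> U = {p<..<s}" using that p by auto
      then have "mass U p s = s - p" using mass_open[OF U, of p s] that by simp
      then have "cum U s = cum U p + (s - p)" using cum_diff[OF U, of p s] that by simp
      then show ?thesis using J0[OF p(1,2)] by (simp add: J)
    qed
    then have "((\<lambda>s. k s - k p) has_integral (W q - W p)) {p..q}"
      by (rule has_integral_eq[OF _ IJ[OF p(3)]])
    moreover have "((\<lambda>s. k s - k p) has_integral ((G q - k p * q) - (G p - k p * p))) {p..q}"
      using p(3) by (intro fundamental_theorem_of_calculus)
        (auto simp: has_real_derivative_iff_has_vector_derivative[symmetric] k_def
          intro!: derivative_eq_intros has_field_derivative_at_within[OF G])
    ultimately have "W q - W p = (G q - k p * q) - (G p - k p * p)"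
      by (rule has_integral_unique)
    then show ?thesis by (simp add: algebra_simps)
  qed
  define y where "y = x + h"
  \<comment> \<open>The last contact point \<open>a\<close> up to \<open>y\<close> splits the
    integral: before it there are only whole components, and beyond it \<open>{a<..<y}\<close> lies
    in \<open>U\<close>.\<close>
  let ?T = "{x..y} \<inter> - U"
  have "compact ?T"
    using open_grow[OF S, of l] by (intro compact_Int_closed) (auto simp: U_def)
  moreover have "x \<in> ?T" using x h by (simp add: U_def y_def)
  ultimately obtain a where a: "a \<in> ?T" "\<And>z. z \<in> ?T \<Longrightarrow> z \<le> a"
    using compact_attains_sup[of ?T] by blast
  have "W a - W x = 0"
  proof -
    let ?V = "{x<..<a} \<inter> U"
    have V: "open ?V" using open_grow[OF S] by (auto simp: U_def)
    have "continuous_on {p..q} J" for p q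
      unfolding J_def by (intro continuous_intros S U)
    then have cJ: "J absolutely_integrable_on {p..q}" for p q
      by (rule absolutely_integrable_continuous_real)
    have LJ: "(LINT s:{p<..<q}|lebesgue. J s) = W q - W p" if "p \<le> q" for p q
    proof -
      have "(LINT s:{p<..<q}|lebesgue. J s) = integral {p<..<q} J"
        by (rule set_lebesgue_integral_eq_integral(2), rule set_integrable_subset[OF cJ[of p q]]) auto
      also have "\<dots> = integral {p..q} J" using integral_open_interval[of p q J] by simp
      also have "\<dots> = W q - W p" using IJ[OF that] by (rule integral_unique)
      finally show ?thesis .
    qed
    have "(LINT s:?V|lebesgue. J s) = 0"
    proof (rule set_integral_components_zero[OF V])
      show "set_integrable lebesgue ?V J"
        by (rule set_integrable_subset[OF cJ[of x a]]) (use U in auto)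
      fix c assume "c \<in> components ?V"
      then obtain p q where pq: "p < q" "c = {p<..<q}" "x \<le> p" "p \<notin> U" "G q = G p + k p * (q - p)"
        using grow_component[OF S G x, of a] a(1) unfolding U_def k_def by (metis ComplD IntD2 Int_commute)
      moreover have "c \<subseteq> U" using in_components_subset[OF \<open>c \<in> components ?V\<close>] by auto
      ultimately show "(LINT s:c|lebesgue. J s) = 0"
        using LJ[of p q] gap[of p q] by simp
    qed
    moreover have "(LINT s:?V|lebesgue. J s) = (LINT s:{x<..<a}|lebesgue. J s)"
      unfolding set_lebesgue_integral_def
      by (rule Bochner_Integration.integral_cong) (use J0 in \<open>auto simp: indicator_def\<close>)
    ultimately show ?thesis using LJ[of x a] a(1) by simp
  qed
  moreover have "W y - W a = G y - G a - k a * (y - a)"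
  proof (rule gap)
    show "{a<..<y} \<subseteq> U"
    proof (rule ccontr)
      assume "\<not> {a<..<y} \<subseteq> U"
      then obtain z where "z \<in> {a<..<y}" "z \<notin> U" by blast
      with a(1) a(2)[of z] show False by auto
    qed
  qed (use a in auto)
  moreover have "G a + k a * (y - a) \<le> G y"
    using a(1) not_grow_iff[OF S G, of a] by (simp add: U_def k_def)
  ultimately have "0 \<le> W y - W x" by simp
  also have "W y - W x = moment U x h - l * moment S x h"
    using moment_primitive(1)[OF S G h, of x] moment_primitive(1)[OF U H h, of x]
    by (simp add: W_def k_def y_def algebra_simps)
  finally show ?thesis by (simp add: U_def)
qed


section \<open>Growth of intervals and of periodic sets\<close>

text \<open>It suffices to test the moment inequality at the far end \<open>c + l * r\<close>. The
  interval has mass \<open>2 * r\<close> and its centre of mass \<open>c\<close> is at distance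
  \<open>l * r\<close> from there, so the moment is at least \<open>2 * l * r\<^sup>2\<close>, while
  \<open>h < 2 * l * r\<close> gives \<open>h\<^sup>2 / 2 < l * (2 * l * r\<^sup>2)\<close>.\<close>

lemma interval_grow_left:
  assumes S: "S \<in> sets lebesgue" and I: "{c - r<..<c + r} \<subseteq> S" and r: "0 < r" and l: "1 < l"
    and x: "c - l * r < x" "x \<le> c - r"
  shows "x \<in> grow l S"
proof -
  \<comment> \<open>The integral is split at distances \<open>d\<close> and \<open>d + 2 * r\<close>
    from \<open>x\<close>, where the interval begins and ends: the mass up to \<open>x + u\<close>
    is at least \<open>0\<close>, then \<open>u - d\<close>, then \<open>2 * r\<close>.\<close>
  define d where "d = c - r - x"
  define h where "h = c + l * r - x"
  define f where "f u = mass S x (x + u)" for u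
  have lr: "r < l * r" using r l by simp
  have d: "0 \<le> d" "d + 2 * r \<le> h" "0 < h" using x r lr by (auto simp: d_def h_def)
  have int: "f integrable_on {a..b}" if "0 \<le> a" "b \<le> h" for a b
    by (rule integrable_subinterval_real[of f 0 h]) (use mass_integrable[OF S, of x h] that in \<open>auto simp: f_def[abs_def]\<close>)
  have "mass {c - r<..<c + r} x (x + u) = u - d" if "u \<in> {d..d + 2 * r}" for u
  proof -
    have "measure lebesgue ({x<..<x + u} \<inter> {c - r<..<c + r}) = measure lebesgue {c - r<..<x + u}"
      using that x r by (intro arg_cong[of _ _ "measure lebesgue"]) (auto simp: d_def)
    then have "mass {c - r<..<c + r} x (x + u) = measure lebesgue {c - r<..<x + u}"
      using mass_open[of "{c - r<..<c + r}" x "x + u"] by (metis lmeasurable_interval(2) fmeasurableD box_real(1))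
    then show ?thesis using that by (simp add: d_def)
  qed
  then have f1: "u - d \<le> f u" if "u \<in> {d..d + 2 * r}" for u
    using mass_mono[of "{c - r<..<c + r}" x "x + u" S] I S that by (force simp: f_def)
  have f2: "2 * r \<le> f u" if "u \<in> {d + 2 * r..h}" for u
  proof -
    have "f u = f (d + 2 * r) + mass S (x + (d + 2 * r)) (x + u)"
      unfolding f_def by (rule mass_add[OF S]) (use that d r in auto)
    then show ?thesis using f1[of "d + 2 * r"] r mass_nonneg[of S "x + (d + 2 * r)" "x + u"] by simp
  qed
  have "0 \<le> integral {0..d} f"
    using int d r by (intro integral_nonneg) (auto simp: f_def mass_nonneg)
  moreover have "2 * r\<^sup>2 \<le> integral {d..d + 2 * r} f"
  proof -
    have "((\<lambda>u. u - d) has_integral ((d + 2 * r - d)\<^sup>2 / 2 - (d - d)\<^sup>2 / 2)) {d..d + 2 * r}"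
      using r by (intro fundamental_theorem_of_calculus)
        (auto intro!: derivative_eq_intros simp: has_real_derivative_iff_has_vector_derivative[symmetric])
    moreover have "(d + 2 * r - d)\<^sup>2 / 2 - (d - d)\<^sup>2 / 2 = 2 * r\<^sup>2" by (simp add: power2_eq_square)
    ultimately have "((\<lambda>u. u - d) has_integral (2 * r\<^sup>2)) {d..d + 2 * r}" by simp
    then show ?thesis
      using f1 int[of d "d + 2 * r"] d by (intro has_integral_le[OF _ integrable_integral]) auto
  qed
  moreover have "2 * r * (h - (d + 2 * r)) \<le> integral {d + 2 * r..h} f"
  proof -
    have "((\<lambda>u. 2 * r) has_integral ((h - (d + 2 * r)) *\<^sub>R (2 * r))) {d + 2 * r..h}"
      using d has_integral_const_real[of "2 * r" "d + 2 * r" h] by simp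
    then show ?thesis
      using has_integral_le[OF _ integrable_integral[OF int[of "d + 2 * r" h]], of "\<lambda>u. 2 * r"] f2 d r
      by (simp add: mult.commute)
  qed
  moreover have "moment S x h = integral {0..d} f + integral {d..d + 2 * r} f + integral {d + 2 * r..h} f"
  proof -
    have "integral {0..d} f + integral {d..h} f = integral {0..h} f"
      by (rule Henstock_Kurzweil_Integration.integral_combine) (use d r int in auto)
    moreover have "integral {d..d + 2 * r} f + integral {d + 2 * r..h} f = integral {d..h} f"
      by (rule Henstock_Kurzweil_Integration.integral_combine) (use d r int in auto)
    ultimately show ?thesis by (simp add: moment_def f_def[abs_def])
  qed
  ultimately have "2 * r\<^sup>2 + 2 * r * (h - (d + 2 * r)) \<le> moment S x h" by simp
  also have "2 * r\<^sup>2 + 2 * r * (h - (d + 2 * r)) = 2 * l * r\<^sup>2"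
    by (simp add: d_def h_def power2_eq_square algebra_simps)
  finally have "l * (2 * l * r\<^sup>2) \<le> l * moment S x h" using l by simp
  moreover have "h\<^sup>2 < (2 * (l * r))\<^sup>2"
    using x d(3) by (intro power_strict_mono) (auto simp: h_def)
  then have "h\<^sup>2 / 2 < l * (2 * l * r\<^sup>2)" by (simp add: power2_eq_square algebra_simps)
  ultimately show ?thesis using d(3) by (auto simp: grow_def)
qed

lemma interval_grow:
  assumes S: "S \<in> sets lebesgue" and I: "{c - r<..<c + r} \<subseteq> S" and r: "0 < r" and l: "1 \<le> l"
  shows "{c - l * r<..<c + l * r} \<subseteq> S \<union> grow l S"
proof (cases "l = 1")
  case False
  with l have l: "1 < l" by simp
  show ?thesis
  proof
    fix x assume x: "x \<in> {c - l * r<..<c + l * r}"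
    consider "x \<le> c - r" | "x \<in> {c - r<..<c + r}" | "c + r \<le> x" by fastforce
    then show "x \<in> S \<union> grow l S"
    proof cases
      case 1
      then show ?thesis using interval_grow_left[OF S I r l, of x] x by simp
    next
      case 3
      have "{- c - r<..<- c + r} \<subseteq> uminus ` S"
      proof
        fix y assume "y \<in> {- c - r<..<- c + r}"
        then have "- y \<in> S" using I by (auto simp: subset_iff)
        then show "y \<in> uminus ` S" by force
      qed
      from interval_grow_left[OF uminus_sets_lebesgue[OF S] this r l, of "- x"] 3 x
      have "- x \<in> uminus ` grow l S" by (simp add: grow_uminus)
      then show ?thesis by force
    qed (use I in auto)
  qed
qed (use I in auto)

definition periodic :: "real set \<Rightarrow> bool"
  where "periodic S \<longleftrightarrow> (\<forall>x. x + 1 \<in> S \<longleftrightarrow> x \<in> S)"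

lemma periodic_image: "periodic S \<Longrightarrow> (\<lambda>x. x + 1) ` S = S"
proof -
  assume "periodic S"
  then have "x \<in> (\<lambda>x. x + 1) ` S \<longleftrightarrow> x \<in> S" for x
    unfolding periodic_def by (metis (no_types, lifting) diff_add_cancel image_iff)
  then show ?thesis by blast
qed

lemma periodic_grow: "periodic S \<Longrightarrow> periodic (grow l S)"
  using grow_translate[of l 1 S] periodic_image[of S] unfolding periodic_def
  by (metis (no_types, lifting) add_right_cancel image_iff)

lemma periodic_mass:
  assumes S: "S \<in> sets lebesgue" "periodic S"
  shows "mass S x (x + 1) = mass S 0 1"
proof -
  have le: "mass S x (x + 1) = mass S y (y + 1)" if "x \<le> y" for x y
  proof -
    have "mass S x y = mass S (x + 1) (y + 1)"
      using mass_translate[of 1 S x y] periodic_image[OF S(2)] by simp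
    then show ?thesis
      using cum_diff[OF S(1), of x y] cum_diff[OF S(1), of "x + 1" "y + 1"] cum_diff[OF S(1), of x "x + 1"]
        cum_diff[OF S(1), of y "y + 1"] that by simp
  qed
  show ?thesis using le[of x 0] le[of 0 x] by (cases "x \<le> 0") auto
qed

text \<open>The bound on \<open>l * mass S 0 1\<close> supplies a contact point \<open>x\<close>;
  then \<open>x\<close> and \<open>x + 1\<close> frame a full period, to which
  \<open>grow_mass\<close> applies.\<close>

lemma grow_period_mass:
  assumes S: "S \<in> sets lebesgue" "periodic S" and l: "1 < l" "l * mass S 0 1 \<le> 1"
  shows "mass (grow l S) 0 1 = l * mass S 0 1"
proof -
  obtain x where x: "x \<notin> grow l S"
    using contact_exists[OF S(1) periodic_mass[OF S] l(2)] by blast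
  then have "x + 1 \<notin> grow l S"
    using periodic_grow[OF S(2)] by (simp add: periodic_def)
  with grow_mass[OF S(1) l(1) _ x this] show ?thesis
    using periodic_mass[OF S, of x] periodic_mass[OF grow_sets_lebesgue[OF S(1), of l] periodic_grow[OF S(2), of l], of x]
    by simp
qed

text \<open>A point outside \<open>S \<union> grow l S\<close> is a contact point at level
  \<open>l\<close>, so there the moments of \<open>grow l S\<close> dominate \<open>l\<close> times
  those of \<open>S\<close>: a contact inequality violated for \<open>m * l\<close> and
  \<open>S\<close> is violated for \<open>m\<close> and the enlarged set. Equality is recovered only
  modulo null sets, in \<open>flow_flow\<close>.\<close>

lemma grow_grow:
  assumes S: "S \<in> sets lebesgue" and l: "1 \<le> l" "1 \<le> m"
  shows "S \<union> grow (m * l) S \<subseteq> (S \<union> grow l S) \<union> grow m (S \<union> grow l S)"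
proof (cases "l = 1")
  case True
  then show ?thesis using grow_1[OF S] by simp
next
  case False
  with l have l1: "1 < l" by simp
  define U where "U = grow l S"
  have U: "U \<in> sets lebesgue" unfolding U_def by (rule grow_sets_lebesgue[OF S])
  have step: "h\<^sup>2 / 2 < m * moment (T \<union> grow l T) x h"
    if T: "T \<in> sets lebesgue" and h: "0 < h" "h\<^sup>2 / 2 < m * l * moment T x h" and x: "x \<notin> grow l T" for T x h
  proof -
    have "l * moment T x h \<le> moment (grow l T) x h"
      using moment_grow_le[OF T l1 x] h by simp
    also have "\<dots> \<le> moment (T \<union> grow l T) x h"
      by (rule moment_mono) (use T grow_sets_lebesgue[OF T] in auto)
    finally have "m * (l * moment T x h) \<le> m * moment (T \<union> grow l T) x h"
      using l(2) by (simp add: mult_left_mono)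
    with h(2) show ?thesis by (simp add: mult.assoc)
  qed
  show ?thesis
  proof
    fix x assume x: "x \<in> S \<union> grow (m * l) S"
    show "x \<in> (S \<union> grow l S) \<union> grow m (S \<union> grow l S)"
    proof (cases "x \<in> S \<union> grow l S")
      case False
      with x obtain h where h: "0 < h" "h\<^sup>2 / 2 < m * l * moment S x h \<or> h\<^sup>2 / 2 < m * l * moment (uminus ` S) (- x) h"
        by (auto simp: grow_def)
      have "- x \<notin> grow l (uminus ` S)" using False by (auto simp: grow_uminus)
      moreover have "uminus ` S \<union> grow l (uminus ` S) = uminus ` (S \<union> grow l S)"
        by (simp add: grow_uminus image_Un)
      ultimately have "h\<^sup>2 / 2 < m * moment (S \<union> grow l S) x h \<or> h\<^sup>2 / 2 < m * moment (uminus ` (S \<union> grow l S)) (- x) h"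
        using h step[OF S h(1), of x] step[OF uminus_sets_lebesgue[OF S] h(1), of "- x"] False by auto
      then have "x \<in> grow m (S \<union> grow l S)"
        using h(1) unfolding grow_def by blast
      then show ?thesis by blast
    qed blast
  qed
qed

section \<open>The flow on the circle\<close>

lemma to_circle_eq_iff: "to_circle x = to_circle y \<longleftrightarrow> x - y \<in> \<int>"
  by (simp add: circle.abs_eq_iff)

lemma to_circle_cases: obtains x where "z = to_circle x"
  by (induct z rule: circle.abs_induct) blast

lemma to_circle_add: "to_circle (x + y) = to_circle x + to_circle y"
  by (simp add: plus_circle.abs_eq)

lemma to_circle_diff: "to_circle (x - y) = to_circle x - to_circle y"
  by (simp add: minus_circle.abs_eq)

lemma to_circle_minus: "to_circle (- x) = - to_circle x"
  by (simp add: uminus_circle.abs_eq)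

lemma to_circle_Ints: "x \<in> \<int> \<Longrightarrow> to_circle x = 0"
  by (simp add: zero_circle_def circle.abs_eq_iff)

lemma periodic_vimage: "periodic (to_circle -` E)"
  by (simp add: periodic_def to_circle_add to_circle_Ints)

lemma periodic_add_int:
  assumes "periodic S" shows "x + of_int k \<in> S \<longleftrightarrow> x \<in> S"
proof -
  have up: "x + real n \<in> S \<longleftrightarrow> x \<in> S" for n x
  proof (induction n)
    case (Suc n)
    have "x + real (Suc n) = (x + real n) + 1" by simp
    then show ?case using Suc assms by (simp only: periodic_def)
  qed simp
  show ?thesis
  proof (cases "0 \<le> k")
    case True
    then show ?thesis using up[of x "nat k"] by simp
  next
    case False
    then show ?thesis using up[of "x + of_int k" "nat (- k)"] by simp
  qed
qed

lemma vimage_to_circle_image: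
  assumes "periodic S" shows "to_circle -` to_circle ` S = S"
proof (intro equalityI subsetI)
  fix x assume "x \<in> to_circle -` to_circle ` S"
  then obtain y where "y \<in> S" "x - y \<in> \<int>" by (auto simp: to_circle_eq_iff)
  then obtain k where "y \<in> S" "x = y + of_int k" by (auto elim!: Ints_cases simp: algebra_simps)
  then show "x \<in> S" using periodic_add_int[OF assms] by simp
qed auto

lemma Union_int_translates:
  fixes S :: "real set" shows "(\<Union>k::int. S \<inter> {of_int k..of_int k + 1}) = S"
proof (intro equalityI subsetI)
  fix x assume "x \<in> S"
  then have "x \<in> S \<inter> {of_int \<lfloor>x\<rfloor>..of_int \<lfloor>x\<rfloor> + 1}" by simp
  then show "x \<in> (\<Union>k::int. S \<inter> {of_int k..of_int k + 1})" by blast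
qed auto

text \<open>A lift is periodic, hence the countable union of the integer translates of its part in
  \<open>{0..<1}\<close>.\<close>

lemma circle_sets_iff: "E \<in> sets circle_measure \<longleftrightarrow> to_circle -` E \<in> sets lebesgue"
proof
  let ?S = "to_circle -` E"
  assume "E \<in> sets circle_measure"
  then have E: "?S \<inter> {0..<1} \<in> sets lebesgue" by (simp add: sets_circle_measure)
  have "?S = (\<Union>k::int. (\<lambda>x. of_int k + x) ` (?S \<inter> {0..<1}))"
  proof (intro equalityI subsetI)
    fix x assume "x \<in> ?S"
    then have "frac x \<in> ?S"
      using periodic_add_int[OF periodic_vimage, of "frac x" "\<lfloor>x\<rfloor>" E] by (simp add: frac_def)
    then have "of_int \<lfloor>x\<rfloor> + frac x \<in> (\<lambda>y. of_int \<lfloor>x\<rfloor> + y) ` (?S \<inter> {0..<1})"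
      by (intro imageI) (simp add: frac_lt_1)
    then show "x \<in> (\<Union>k::int. (\<lambda>x. of_int k + x) ` (?S \<inter> {0..<1}))"
      by (auto simp: frac_def)
  qed (auto simp: to_circle_add to_circle_Ints)
  also have "\<dots> \<in> sets lebesgue"
    using lebesgue_sets_translation[OF E] by (intro sets.countable_UN') auto
  finally show "?S \<in> sets lebesgue" .
qed (auto simp: sets_circle_measure intro: sets.Int)

lemma emeasure_circle:
  assumes "E \<in> sets circle_measure"
  shows "emeasure circle_measure E = emeasure lebesgue (to_circle -` E \<inter> {0..1})"
proof -
  have S: "to_circle -` E \<in> sets lebesgue" using assms by (simp add: circle_sets_iff)
  have "{1::real} \<in> null_sets lebesgue" by simp
  from AE_not_in[OF this] have "AE x in lebesgue. x \<noteq> (1::real)" by simp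
  then have "AE x in lebesgue. (x \<in> to_circle -` E \<inter> {0..<1}) = (x \<in> to_circle -` E \<inter> {0..1})"
    by eventually_elim auto
  then have "emeasure lebesgue (to_circle -` E \<inter> {0..<1}) = emeasure lebesgue (to_circle -` E \<inter> {0..1})"
    by (rule emeasure_eq_AE) (use S in auto)
  then show ?thesis by (simp add: emeasure_circle_measure[OF assms])
qed

lemma measure_circle:
  "E \<in> sets circle_measure \<Longrightarrow> measure circle_measure E = mass (to_circle -` E) 0 1"
  by (simp add: measure_def mass_def emeasure_circle)

interpretation circle: finite_measure circle_measure
  by (rule finite_measureI) (simp add: emeasure_circle_measure_UNIV)

lemma measure_circle_UNIV [simp]: "measure circle_measure UNIV = 1"
  by (simp add: measure_def emeasure_circle_measure_UNIV)

lemma measure_circle_le_1: "measure circle_measure E \<le> 1"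
  using circle.finite_measure_mono[of E UNIV] sets.top[of circle_measure]
  by (cases "E \<in> sets circle_measure") (auto simp: measure_notin_sets)

lemma circle_null_iff: "N \<in> null_sets circle_measure \<longleftrightarrow> to_circle -` N \<in> null_sets lebesgue"
proof
  let ?S = "to_circle -` N"
  assume N: "N \<in> null_sets circle_measure"
  then have S: "?S \<in> sets lebesgue" by (simp add: null_setsD2 circle_sets_iff[symmetric])
  have "mass ?S 0 1 = 0"
    using N measure_circle[of N] by (simp add: null_sets_def measure_def)
  then have "mass ?S (of_int k) (of_int k + 1) = 0" for k
    using periodic_mass[OF S periodic_vimage] by simp
  then have "?S \<inter> {of_int k..of_int k + 1} \<in> null_sets lebesgue" for k :: int
    using lmeasurable_Int_Icc[OF S, of "of_int k" "of_int k + 1"]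
    unfolding mass_def negligible_iff_null_sets[symmetric] by (simp add: negligible_iff_measure)
  then have "(\<Union>k::int. ?S \<inter> {of_int k..of_int k + 1}) \<in> null_sets lebesgue"
    by (intro null_sets_UN') auto
  then show "?S \<in> null_sets lebesgue" by (simp only: Union_int_translates)
next
  assume N: "to_circle -` N \<in> null_sets lebesgue"
  then have "N \<in> sets circle_measure" by (simp add: circle_sets_iff null_setsD2)
  moreover have "to_circle -` N \<inter> {0..1} \<in> null_sets lebesgue"
    by (rule null_set_Int2[OF N]) simp
  ultimately show "N \<in> null_sets circle_measure"
    by (simp add: null_sets_def emeasure_circle)
qed

section \<open>Inclusion and equality modulo null sets\<close>

text \<open>The measure is complete because it comes from \<open>lebesgue\<close>; subsets of null
  sets thus need no separate measurability argument.\<close>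

lemma circle_null_subset:
  assumes "N \<in> null_sets circle_measure" "A \<subseteq> N" shows "A \<in> null_sets circle_measure"
proof -
  have "to_circle -` A \<subseteq> to_circle -` N" using assms by auto
  with assms(1) show ?thesis
    unfolding circle_null_iff by (metis negligible_iff_null_sets negligible_subset)
qed

lemma null_eq_iff: "A \<doteq> B \<longleftrightarrow> A \<sqsubseteq> B \<and> B \<sqsubseteq> A"
  unfolding null_eq_def null_subset_def
  by (meson Un_upper1 Un_upper2 circle_null_subset null_sets.Un)

lemma subset_null_subset: "A \<subseteq> B \<Longrightarrow> A \<sqsubseteq> B"
  by (simp add: null_subset_def Diff_eq_empty_iff[THEN iffD2])

lemma null_eq_refl [simp]: "A \<doteq> A"
  by (simp add: null_eq_def)

lemma null_eq_sym: "A \<doteq> B \<Longrightarrow> B \<doteq> A"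
  by (auto simp: null_eq_iff)

lemma null_subset_trans: "A \<sqsubseteq> B \<Longrightarrow> B \<sqsubseteq> C \<Longrightarrow> A \<sqsubseteq> C"
  unfolding null_subset_def
  by (rule circle_null_subset[OF null_sets.Un[of "A - B" _ "B - C"]]) auto

lemma null_eq_trans: "A \<doteq> B \<Longrightarrow> B \<doteq> C \<Longrightarrow> A \<doteq> C"
  by (auto simp: null_eq_iff intro: null_subset_trans)

lemma null_eq_sets:
  assumes "A \<doteq> B" "A \<in> sets circle_measure" shows "B \<in> sets circle_measure"
proof -
  have "B = (A - (A - B)) \<union> (B - A)" by auto
  moreover have "A - B \<in> sets circle_measure" "B - A \<in> sets circle_measure"
    using assms(1) by (auto simp: null_eq_iff null_subset_def)
  ultimately show ?thesis using assms(2) by (metis sets.Diff sets.Un)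
qed

lemma null_subset_measure:
  assumes "A \<sqsubseteq> B" "A \<in> sets circle_measure" "B \<in> sets circle_measure"
  shows "measure circle_measure A \<le> measure circle_measure B"
proof -
  have "measure circle_measure A \<le> measure circle_measure (B \<union> (A - B))"
    using assms by (intro circle.finite_measure_mono) auto
  also have "\<dots> = measure circle_measure B"
    using assms by (intro measure_Un_null_set) (auto simp: null_subset_def)
  finally show ?thesis .
qed

lemma null_eq_measure:
  assumes "A \<doteq> B" "A \<in> sets circle_measure"
  shows "measure circle_measure A = measure circle_measure B"
  using assms null_eq_sets[OF assms] null_subset_measure[of A B] null_subset_measure[of B A]
  by (auto simp: null_eq_iff)

text \<open>In a finite measure space, an inclusion and a comparison of measures in the opposite
  direction give equality of classes. The explicit descriptions of the flow and its semigroup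
  property rest on this.\<close>

lemma null_eqI:
  assumes "A \<sqsubseteq> B" "A \<in> sets circle_measure" "B \<in> sets circle_measure"
    "measure circle_measure B \<le> measure circle_measure A"
  shows "A \<doteq> B"
proof -
  have "measure circle_measure (B - A) = 0"
  proof -
    have "measure circle_measure (B - A) + measure circle_measure A = measure circle_measure (B \<union> (A - B))"
      using assms circle.finite_measure_Union[of "B - A" A]
      by (metis Diff_disjoint Int_commute Un_Diff_cancel Un_Diff_cancel2 Un_commute sets.Diff)
    also have "\<dots> = measure circle_measure B"
      using assms by (intro measure_Un_null_set) (auto simp: null_subset_def)
    finally show ?thesis using assms(4) measure_nonneg[of circle_measure "B - A"] by linarith
  qed
  then have "B \<sqsubseteq> A"
    using assms(2,3) by (simp add: null_subset_def null_sets_def circle.emeasure_eq_measure)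
  with assms(1) show ?thesis by (simp add: null_eq_iff)
qed

lemma max_time_nonneg: "E \<in> L_sets \<Longrightarrow> 0 \<le> max_time E"
  using measure_circle_le_1[of E] by (simp add: L_sets_def max_time_def)

lemma le_max_time_iff:
  "E \<in> L_sets \<Longrightarrow> t \<le> max_time E \<longleftrightarrow> exp t * measure circle_measure E \<le> 1"
proof -
  assume "E \<in> L_sets"
  then have m: "0 < measure circle_measure E" by (simp add: L_sets_def)
  have "t \<le> max_time E \<longleftrightarrow> exp t \<le> exp (- ln (measure circle_measure E))"
    by (simp add: max_time_def)
  also have "exp (- ln (measure circle_measure E)) = 1 / measure circle_measure E"
    using m by (simp add: exp_minus inverse_eq_divide)
  finally show ?thesis using m by (simp add: field_simps)
qed

text \<open>The term \<open>E\<close> is needed for \<open>t = 0\<close>, where \<open>grow\<close> is empty; for \<open>t > 0\<close> it only contributes a null set.\<close>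

definition flow :: "real \<Rightarrow> circle set \<Rightarrow> circle set"
  where "flow t E = E \<union> to_circle ` grow (exp t) (to_circle -` E)"

lemma vimage_flow: "to_circle -` flow t E = to_circle -` E \<union> grow (exp t) (to_circle -` E)"
  by (simp add: flow_def vimage_to_circle_image periodic_grow periodic_vimage)

lemma to_circle_vimage_subset: "to_circle -` A \<subseteq> to_circle -` B \<longleftrightarrow> A \<subseteq> B"
  by (auto simp: subset_iff) (metis to_circle_cases)

lemma flow_sets: "E \<in> sets circle_measure \<Longrightarrow> flow t E \<in> sets circle_measure"
  unfolding circle_sets_iff vimage_flow by (intro sets.Un grow_sets_lebesgue)

lemma flow_0: "E \<in> sets circle_measure \<Longrightarrow> flow 0 E = E"
  by (simp add: flow_def grow_1 circle_sets_iff)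

lemma flow_mono_time: "E \<in> sets circle_measure \<Longrightarrow> s \<le> t \<Longrightarrow> flow s E \<subseteq> flow t E"
  using grow_mono[of "to_circle -` E" "to_circle -` E" "exp s" "exp t"]
  by (auto simp: flow_def circle_sets_iff)

text \<open>The growth parts are nested outright, so whatever part of \<open>flow t A\<close> lies
  outside \<open>flow t B\<close> already lies in \<open>A - B\<close>.\<close>

lemma flow_null_mono:
  assumes "A \<sqsubseteq> B" "A \<in> sets circle_measure" "B \<in> sets circle_measure"
  shows "flow t A \<sqsubseteq> flow t B"
proof -
  have "grow (exp t) (to_circle -` A) \<subseteq> grow (exp t) (to_circle -` B)"
    using assms by (intro grow_cong_null)
      (simp_all add: circle_sets_iff null_subset_def circle_null_iff vimage_Diff)
  then have "flow t A - flow t B \<subseteq> A - B" by (auto simp: flow_def)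
  with assms(1) show ?thesis unfolding null_subset_def by (rule circle_null_subset)
qed

lemma flow_null_cong:
  assumes "A \<doteq> B" "A \<in> sets circle_measure" shows "flow t A \<doteq> flow t B"
  using assms null_eq_sets[OF assms] by (auto simp: null_eq_iff intro: flow_null_mono)

lemma flow_measure:
  assumes E: "E \<in> L_sets" and t: "0 \<le> t" "t \<le> max_time E"
  shows "measure circle_measure (flow t E) = exp t * measure circle_measure E"
proof (cases "t = 0")
  case True
  then show ?thesis using E by (simp add: flow_0 L_sets_def)
next
  case False
  have Es: "E \<in> sets circle_measure" using E by (simp add: L_sets_def)
  define S where "S = to_circle -` E"
  have S: "S \<in> sets lebesgue" "periodic S"
    using Es by (simp_all add: S_def circle_sets_iff periodic_vimage)
  have "mass (S \<union> grow (exp t) S) 0 1 = mass (grow (exp t) S) 0 1"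
  proof -
    have "(S - grow (exp t) S) \<inter> {0..1} \<in> null_sets lebesgue"
      by (rule null_set_Int2[OF contact_null[OF S(1)]]) (use t False in auto)
    moreover have "(S \<union> grow (exp t) S) \<inter> {0..1} = grow (exp t) S \<inter> {0..1} \<union> (S - grow (exp t) S) \<inter> {0..1}"
      by auto
    ultimately show ?thesis
      unfolding mass_def
      using measure_Un_null_set[of "grow (exp t) S \<inter> {0..1}" lebesgue] grow_sets_lebesgue[OF S(1), of "exp t"]
      by (metis lmeasurable_Int_Icc fmeasurableD)
  qed
  also have "\<dots> = exp t * mass S 0 1"
  proof (rule grow_period_mass[OF S])
    show "1 < exp t" using t False by simp
    show "exp t * mass S 0 1 \<le> 1"
      using t(2) le_max_time_iff[OF E] measure_circle[OF Es] by (simp add: S_def)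
  qed
  finally show ?thesis
    using measure_circle[OF Es] measure_circle[OF flow_sets[OF Es]] by (simp add: vimage_flow S_def)
qed

lemma flow_L_sets: "E \<in> L_sets \<Longrightarrow> 0 \<le> t \<Longrightarrow> t \<le> max_time E \<Longrightarrow> flow t E \<in> L_sets"
  using flow_measure[of E t] by (simp add: L_sets_def flow_sets)

lemma max_time_flow:
  assumes "E \<in> L_sets" "0 \<le> s" "s \<le> max_time E" shows "max_time (flow s E) = max_time E - s"
  using flow_measure[OF assms] assms(1) by (simp add: max_time_def L_sets_def ln_mult)

lemma flow_flow:
  assumes E: "E \<in> L_sets" and st: "0 \<le> s" "s \<le> t" "t \<le> max_time E"
  shows "flow t E \<doteq> flow (t - s) (flow s E)"
proof (rule null_eqI)
  have Es: "E \<in> sets circle_measure" using E by (simp add: L_sets_def)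
  then have "to_circle -` flow t E \<subseteq> to_circle -` flow (t - s) (flow s E)"
    unfolding vimage_flow using grow_grow[of "to_circle -` E" "exp s" "exp (t - s)"] st
    by (simp add: circle_sets_iff exp_add[symmetric])
  then show "flow t E \<sqsubseteq> flow (t - s) (flow s E)"
    by (intro subset_null_subset) (simp only: to_circle_vimage_subset)
  show "flow t E \<in> sets circle_measure" "flow (t - s) (flow s E) \<in> sets circle_measure"
    by (intro flow_sets Es)+
  show "measure circle_measure (flow (t - s) (flow s E)) \<le> measure circle_measure (flow t E)"
    using flow_measure[OF flow_L_sets[OF E st(1)], of "t - s"] max_time_flow[OF E st(1)]
      flow_measure[OF E, of s] flow_measure[OF E, of t] st by (simp add: exp_diff)
qed

lemma vimage_translate: "to_circle -` (\<lambda>x. x + to_circle a) ` E = (\<lambda>x. x + a) ` (to_circle -` E)"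
proof (intro set_eqI)
  fix x
  have "x \<in> to_circle -` (\<lambda>x. x + to_circle a) ` E \<longleftrightarrow> to_circle x - to_circle a \<in> E"
    by (auto simp: image_iff algebra_simps intro!: bexI[of _ "to_circle x - to_circle a"])
  also have "\<dots> \<longleftrightarrow> x - a \<in> to_circle -` E" by (simp add: to_circle_diff)
  also have "\<dots> \<longleftrightarrow> x \<in> (\<lambda>x. x + a) ` (to_circle -` E)"
    by (auto intro!: image_eqI[of _ _ "x - a"])
  finally show "x \<in> to_circle -` (\<lambda>x. x + to_circle a) ` E \<longleftrightarrow> x \<in> (\<lambda>x. x + a) ` (to_circle -` E)" .
qed

lemma vimage_uminus: "to_circle -` uminus ` E = uminus ` (to_circle -` E)"
proof (intro set_eqI)
  fix x
  have "x \<in> to_circle -` uminus ` E \<longleftrightarrow> - to_circle x \<in> E"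
    by (auto simp: image_iff intro!: bexI[of _ "- to_circle x"])
  also have "\<dots> \<longleftrightarrow> - x \<in> to_circle -` E" by (simp add: to_circle_minus)
  also have "\<dots> \<longleftrightarrow> x \<in> uminus ` (to_circle -` E)"
    by (auto intro!: image_eqI[of _ _ "- x"])
  finally show "x \<in> to_circle -` uminus ` E \<longleftrightarrow> x \<in> uminus ` (to_circle -` E)" .
qed

lemma to_circle_vimage_eq: "to_circle -` A = to_circle -` B \<longleftrightarrow> A = B"
  using to_circle_vimage_subset by (metis set_eq_subset)

lemma flow_translate: "flow t ((\<lambda>x. x + y) ` E) = (\<lambda>x. x + y) ` flow t E"
proof -
  obtain a where y: "y = to_circle a" by (rule to_circle_cases)
  have "to_circle -` flow t ((\<lambda>x. x + y) ` E) = to_circle -` (\<lambda>x. x + y) ` flow t E"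
    by (simp add: vimage_flow vimage_translate y grow_translate image_Un)
  then show ?thesis by (simp only: to_circle_vimage_eq)
qed

lemma flow_uminus: "flow t (uminus ` E) = uminus ` flow t E"
proof -
  have "to_circle -` flow t (uminus ` E) = to_circle -` uminus ` flow t E"
    by (simp add: vimage_flow vimage_uminus grow_uminus image_Un)
  then show ?thesis by (simp only: to_circle_vimage_eq)
qed

text \<open>The set \<open>flow t (E1 \<inter> E2)\<close> lies in both flows, so by the measure
  formula the difference has measure at most \<open>exp t\<close> times
  \<open>|E1| - |E1 \<inter> E2|\<close>.\<close>

lemma flow_Diff_measure:
  assumes E: "E1 \<in> L_sets" "E2 \<in> L_sets" and t: "0 \<le> t" "t \<le> max_time E1" "t \<le> max_time E2"
  shows "measure circle_measure (flow t E1 - flow t E2) \<le> exp t * measure circle_measure (E1 - E2)"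
proof -
  have s: "E1 \<in> sets circle_measure" "E2 \<in> sets circle_measure" using E by (auto simp: L_sets_def)
  have d: "measure circle_measure (E1 - E2) = measure circle_measure E1 - measure circle_measure (E1 \<inter> E2)"
    using circle.finite_measure_Diff'[OF s] .
  show ?thesis
  proof (cases "measure circle_measure (E1 \<inter> E2) = 0")
    case True
    have "measure circle_measure (flow t E1 - flow t E2) \<le> measure circle_measure (flow t E1)"
      using s by (intro circle.finite_measure_mono flow_sets) auto
    then show ?thesis using flow_measure[OF E(1) t(1,2)] d True by simp
  next
    case False
    let ?I = "E1 \<inter> E2"
    have I: "?I \<in> L_sets" using False s by (auto simp: L_sets_def zero_less_measure_iff)
    have "measure circle_measure ?I \<le> measure circle_measure E1"
      using s by (intro circle.finite_measure_mono) auto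
    then have "exp t * measure circle_measure ?I \<le> exp t * measure circle_measure E1" by simp
    also have "\<dots> \<le> 1" using t(2) le_max_time_iff[OF E(1)] by simp
    finally have tI: "t \<le> max_time ?I" using le_max_time_iff[OF I] by simp
    have fI: "flow t ?I \<subseteq> flow t E1 \<inter> flow t E2"
      using s grow_mono[of "to_circle -` ?I" "to_circle -` E1" "exp t" "exp t"]
        grow_mono[of "to_circle -` ?I" "to_circle -` E2" "exp t" "exp t"]
      by (auto simp: flow_def circle_sets_iff vimage_Int)
    have "measure circle_measure (flow t E1 - flow t E2) \<le> measure circle_measure (flow t E1 - flow t ?I)"
      using s fI by (intro circle.finite_measure_mono sets.Diff flow_sets sets.Int) auto
    also have "\<dots> = measure circle_measure (flow t E1) - measure circle_measure (flow t ?I)"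
      using s fI by (intro circle.finite_measure_Diff flow_sets sets.Int) auto
    also have "\<dots> = exp t * measure circle_measure (E1 - E2)"
      by (simp only: flow_measure[OF E(1) t(1,2)] flow_measure[OF I t(1) tI] d right_diff_distrib)
    finally show ?thesis .
  qed
qed

lemma measure_sym_diff:
  assumes "A \<in> sets circle_measure" "B \<in> sets circle_measure"
  shows "measure circle_measure (sym_diff A B) = measure circle_measure (A - B) + measure circle_measure (B - A)"
  using assms by (intro circle.finite_measure_Union) auto

lemma flow_contraction:
  assumes E: "E1 \<in> L_sets" "E2 \<in> L_sets" and t: "0 \<le> t" "t \<le> max_time E1" "t \<le> max_time E2"
  shows "measure circle_measure (sym_diff (flow t E1) (flow t E2)) \<le> exp t * measure circle_measure (sym_diff E1 E2)"
proof -
  have s: "E1 \<in> sets circle_measure" "E2 \<in> sets circle_measure" using E by (auto simp: L_sets_def)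
  show ?thesis
    using flow_Diff_measure[OF E t] flow_Diff_measure[OF E(2,1) t(1,3,2)]
    by (simp add: measure_sym_diff flow_sets s distrib_left)
qed

section \<open>Finite unions of arcs\<close>

definition circle_arc :: "real \<Rightarrow> real \<Rightarrow> circle set"
  where "circle_arc c r = to_circle ` {c - r<..<c + r}"

lemma vimage_arc: "to_circle x \<in> circle_arc c r \<longleftrightarrow> (\<exists>k::int. \<bar>x - c - of_int k\<bar> < r)"
proof
  assume "to_circle x \<in> circle_arc c r"
  then obtain y where y: "y \<in> {c - r<..<c + r}" "x - y \<in> \<int>" by (auto simp: circle_arc_def to_circle_eq_iff)
  then obtain k where "x - y = of_int k" by (auto elim: Ints_cases)
  with y(1) show "\<exists>k::int. \<bar>x - c - of_int k\<bar> < r" by (intro exI[of _ k]) (auto simp: abs_less_iff)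
next
  assume "\<exists>k::int. \<bar>x - c - of_int k\<bar> < r"
  then obtain k :: int where "\<bar>x - c - of_int k\<bar> < r" by blast
  then have "x - of_int k \<in> {c - r<..<c + r}" "to_circle (x - of_int k) = to_circle x"
    by (auto simp: abs_less_iff to_circle_eq_iff)
  then show "to_circle x \<in> circle_arc c r" unfolding circle_arc_def by (metis imageI)
qed

lemma arc_sets: "circle_arc c r \<in> sets circle_measure"
proof -
  have "to_circle -` circle_arc c r = (\<Union>k::int. {x. \<bar>x - c - of_int k\<bar> < r})"
    by (auto simp: vimage_arc)
  moreover have "open (\<Union>k::int. {x. \<bar>x - c - of_int k\<bar> < r})"
    by (intro open_UN ballI open_Collect_less continuous_intros)
  ultimately show ?thesis
    unfolding circle_sets_iff by (metis borel_open sets_completionI_sets sets_lborel)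
qed

lemma arc_period:
  assumes "r \<le> 1/2" shows "{c - 1/2<..<c + 1/2} \<inter> to_circle -` circle_arc c r = {c - r<..<c + r}"
proof (intro equalityI subsetI)
  fix x assume x: "x \<in> {c - 1/2<..<c + 1/2} \<inter> to_circle -` circle_arc c r"
  then obtain k :: int where k: "\<bar>x - c - of_int k\<bar> < r" by (auto simp: vimage_arc)
  with x assms have "\<bar>of_int k :: real\<bar> < 1" by auto
  then have "k = 0" by linarith
  with k show "x \<in> {c - r<..<c + r}" by (auto simp: abs_less_iff)
next
  fix x assume "x \<in> {c - r<..<c + r}"
  with assms show "x \<in> {c - 1/2<..<c + 1/2} \<inter> to_circle -` circle_arc c r"
    by (auto simp: circle_arc_def)
qed

lemma measure_arc:
  assumes "0 \<le> r" "r \<le> 1/2" shows "measure circle_measure (circle_arc c r) = 2 * r"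
proof -
  have S: "to_circle -` circle_arc c r \<in> sets lebesgue" using arc_sets by (simp add: circle_sets_iff)
  have "measure circle_measure (circle_arc c r) = mass (to_circle -` circle_arc c r) (c - 1/2) (c - 1/2 + 1)"
    unfolding measure_circle[OF arc_sets] by (rule periodic_mass[OF S periodic_vimage, symmetric])
  also have "c - 1/2 + 1 = c + 1/2" by simp
  also have "mass (to_circle -` circle_arc c r) (c - 1/2) (c + 1/2) = measure lebesgue {c - r<..<c + r}"
    using mass_open[OF S, of "c - 1/2" "c + 1/2"] by (simp only: arc_period[OF assms(2)])
  finally show ?thesis using assms(1) by simp
qed

lemma arc_flow:
  assumes E: "E \<in> sets circle_measure" and "circle_arc c r \<subseteq> E" "0 < r" "0 \<le> t"
  shows "circle_arc c (exp t * r) \<subseteq> flow t E"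
proof -
  have "{c - r<..<c + r} \<subseteq> to_circle -` E" using assms(2) by (auto simp: circle_arc_def)
  from interval_grow[OF _ this assms(3), of "exp t"] E assms(4)
  have "{c - exp t * r<..<c + exp t * r} \<subseteq> to_circle -` flow t E"
    by (simp add: circle_sets_iff vimage_flow)
  then show ?thesis by (auto simp: circle_arc_def)
qed

lemma le_circle_norm_iff:
  "R \<le> circle_norm (to_circle x) \<longleftrightarrow> (\<forall>k::int. R \<le> \<bar>x - of_int k\<bar>)"
  unfolding circle_norm.abs_eq using round_diff_minimal[of x] by (meson order_trans)

lemma arc_disjoint:
  assumes "r + r' \<le> circle_norm (to_circle (c - c'))" shows "circle_arc c r \<inter> circle_arc c' r' = {}"
proof (rule ccontr)
  assume "circle_arc c r \<inter> circle_arc c' r' \<noteq> {}"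
  then obtain z where "z \<in> circle_arc c r" "z \<in> circle_arc c' r'" by blast
  moreover obtain x where "z = to_circle x" by (rule to_circle_cases)
  ultimately obtain k k' :: int where "\<bar>x - c - of_int k\<bar> < r" "\<bar>x - c' - of_int k'\<bar> < r'"
    by (auto simp: vimage_arc)
  moreover have "r + r' \<le> \<bar>c - c' - of_int (k' - k)\<bar>" using assms by (simp only: le_circle_norm_iff)
  ultimately show False by simp
qed

definition arcs :: "real \<Rightarrow> (real \<times> real) set \<Rightarrow> circle set"
  where "arcs l A = (\<Union>p\<in>A. circle_arc (fst p) (l * snd p))"

text \<open>Centres and radii of finitely many arcs; they stay disjoint when the radii are multiplied by
  \<open>l\<close> iff \<open>separated l A\<close>.\<close>

definition config :: "(real \<times> real) set \<Rightarrow> bool"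
  where "config A \<longleftrightarrow> finite A \<and> (\<forall>p\<in>A. 0 < snd p \<and> snd p \<le> 1/2)"

definition separated :: "real \<Rightarrow> (real \<times> real) set \<Rightarrow> bool"
  where "separated l A \<longleftrightarrow>
    (\<forall>p\<in>A. \<forall>q\<in>A. p \<noteq> q \<longrightarrow> l * (snd p + snd q) \<le> circle_norm (to_circle (fst p - fst q)))"

lemma arcs_sets: "finite A \<Longrightarrow> arcs l A \<in> sets circle_measure"
  unfolding arcs_def by (intro sets.finite_UN arc_sets)

lemma separated_disjoint:
  "separated l A \<Longrightarrow> disjoint_family_on (\<lambda>p. circle_arc (fst p) (l * snd p)) A"
  unfolding disjoint_family_on_def separated_def
  by (auto intro!: arc_disjoint simp: distrib_left)

lemma measure_arcs:
  assumes "config A" "separated l A" "0 \<le> l" "\<And>p. p \<in> A \<Longrightarrow> l * snd p \<le> 1/2"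
  shows "measure circle_measure (arcs l A) = l * (\<Sum>p\<in>A. 2 * snd p)"
proof -
  have "measure circle_measure (arcs l A) = (\<Sum>p\<in>A. measure circle_measure (circle_arc (fst p) (l * snd p)))"
    unfolding arcs_def using assms(1) separated_disjoint[OF assms(2)]
    by (intro circle.finite_measure_finite_Union) (auto simp: config_def arc_sets)
  also have "\<dots> = (\<Sum>p\<in>A. l * (2 * snd p))"
    using assms by (intro sum.cong) (auto simp: measure_arc config_def less_imp_le)
  finally show ?thesis by (simp add: sum_distrib_left)
qed

lemma separated_mono:
  assumes "separated l' A" "config A" "l \<le> l'" shows "separated l A"
  unfolding separated_def
proof (intro ballI impI)
  fix p q assume pq: "p \<in> A" "q \<in> A" "p \<noteq> q"
  have "l * (snd p + snd q) \<le> l' * (snd p + snd q)"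
    using assms(2,3) pq by (intro mult_right_mono) (auto simp: config_def intro: add_nonneg_nonneg less_imp_le)
  with assms(1) pq show "l * (snd p + snd q) \<le> circle_norm (to_circle (fst p - fst q))"
    by (fastforce simp: separated_def)
qed

text \<open>The evolved arcs have total length at most one, hence radii at most \<open>1/2\<close>:
  the range in which \<open>measure_arc\<close> gives an arc the length
  \<open>2 * r\<close>.\<close>

lemma radius_bound:
  assumes A: "config A" "separated 1 A" and E: "E \<doteq> arcs 1 A" "E \<in> L_sets" and t: "t \<le> max_time E"
  shows "exp t * (\<Sum>p\<in>A. 2 * snd p) \<le> 1" "p \<in> A \<Longrightarrow> exp t * snd p \<le> 1/2"
proof -
  have "measure circle_measure E = (\<Sum>p\<in>A. 2 * snd p)"
    using measure_arcs[OF A] A null_eq_measure[OF E(1)] E(2) by (auto simp: config_def L_sets_def)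
  with le_max_time_iff[OF E(2)] t show *: "exp t * (\<Sum>p\<in>A. 2 * snd p) \<le> 1" by simp
  assume "p \<in> A"
  then have "2 * snd p \<le> (\<Sum>p\<in>A. 2 * snd p)"
    using A(1) by (intro member_le_sum) (auto simp: config_def)
  then have "exp t * (2 * snd p) \<le> exp t * (\<Sum>p\<in>A. 2 * snd p)" by simp
  also note *
  finally show "exp t * snd p \<le> 1/2" by simp
qed

text \<open>Each scaled arc lies in the flow by \<open>arc_flow\<close>. Being disjoint, the scaled
  arcs together have measure \<open>exp t\<close> times that of \<open>E\<close>, which leaves no
  room for anything else.\<close>

lemma flow_arcs:
  assumes A: "config A" "separated 1 A" and E: "E \<doteq> arcs 1 A" "E \<in> L_sets"
    and t: "0 \<le> t" "t \<le> max_time E" and sep: "separated (exp t) A"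
  shows "flow t E \<doteq> arcs (exp t) A"
proof -
  have fA: "finite A" using A by (simp add: config_def)
  have Es: "E \<in> sets circle_measure" using E(2) by (simp add: L_sets_def)
  have mE: "measure circle_measure E = (\<Sum>p\<in>A. 2 * snd p)"
    using measure_arcs[OF A] A null_eq_measure[OF E(1) Es] by (auto simp: config_def)
  have "arcs (exp t) A \<subseteq> flow t (arcs 1 A)"
    unfolding arcs_def[of "exp t"]
  proof (rule UN_least)
    fix p assume p: "p \<in> A"
    then show "circle_arc (fst p) (exp t * snd p) \<subseteq> flow t (arcs 1 A)"
      using A(1) t(1) by (intro arc_flow arcs_sets[OF fA]) (auto simp: arcs_def config_def)
  qed
  then have "arcs (exp t) A \<sqsubseteq> flow t E"
    using flow_null_cong[OF E(1) Es, of t] subset_null_subset null_subset_trans by (meson null_eq_iff)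
  then have "arcs (exp t) A \<doteq> flow t E"
  proof (rule null_eqI)
    show "arcs (exp t) A \<in> sets circle_measure" by (rule arcs_sets[OF fA])
    show "flow t E \<in> sets circle_measure" by (rule flow_sets[OF Es])
    show "measure circle_measure (flow t E) \<le> measure circle_measure (arcs (exp t) A)"
      using measure_arcs[OF A(1) sep] radius_bound(2)[OF A E t(2)] flow_measure[OF E(2) t] mE by simp
  qed
  then show ?thesis by (rule null_eq_sym)
qed

text \<open>Two touching arcs of radii \<open>P\<close> and \<open>Q\<close> fill, up to their
  common endpoint, one arc of radius \<open>P + Q\<close>. The new configuration absorbs the factor
  \<open>l\<close> into its radii, so that it starts afresh at scale \<open>1\<close>.\<close>

lemma merge_arcs:
  assumes A: "config A" "separated l A" and l: "0 < l" "l * (\<Sum>p\<in>A. 2 * snd p) \<le> 1"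
    and pq: "p \<in> A" "q \<in> A" "p \<noteq> q" "l * (snd p + snd q) = circle_norm (to_circle (fst p - fst q))"
  obtains A' where "config A'" "separated 1 A'" "card A' < card A" "arcs l A \<doteq> arcs 1 A'"
proof -
  have fA: "finite A" and pos: "\<And>s. s \<in> A \<Longrightarrow> 0 < snd s" using A by (auto simp: config_def)
  define P where "P = l * snd p"
  define Q where "Q = l * snd q"
  have PQ: "0 < P" "0 < Q" using l(1) pos pq by (auto simp: P_def Q_def)
  have rad: "l * snd s \<le> 1/2" if "s \<in> A" for s
  proof -
    have "2 * snd s \<le> (\<Sum>p\<in>A. 2 * snd p)"
      using fA pos that by (intro member_le_sum) (auto intro: less_imp_le)
    then have "l * (2 * snd s) \<le> l * (\<Sum>p\<in>A. 2 * snd p)" using l(1) by simp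
    with l(2) show ?thesis by simp
  qed
  have "(\<Sum>s\<in>{p, q}. 2 * snd s) \<le> (\<Sum>s\<in>A. 2 * snd s)"
    by (rule sum_mono2) (use fA pq pos in \<open>auto intro: less_imp_le\<close>)
  then have "l * (2 * snd p + 2 * snd q) \<le> l * (\<Sum>s\<in>A. 2 * snd s)" using pq(3) l(1) by simp
  with l(2) have R: "P + Q \<le> 1/2" by (simp add: P_def Q_def algebra_simps)
  \<comment> \<open>\<open>fst q + of_int k\<close> is the lift of the second centre nearest to the
    first one, at distance \<open>P + Q\<close>, and \<open>d\<close> is the side on which it
    lies.\<close>
  define k where "k = round (fst p - fst q)"
  define d where "d = sgn (fst q + of_int k - fst p)"
  have cn: "\<bar>fst p - fst q - of_int k\<bar> = P + Q"
    using pq(4) by (simp add: circle_norm.abs_eq k_def P_def Q_def algebra_simps)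
  have d: "d = 1 \<or> d = -1" "fst q = fst p + d * (P + Q) - of_int k"
    using cn PQ by (auto simp: d_def sgn_real_def abs_real_def split: if_splits)
  \<comment> \<open>For \<open>d = 1\<close> the arcs fill the stretch from \<open>fst p - P\<close>
    to \<open>fst p + P + 2 * Q\<close>, whose midpoint is \<open>fst p + Q\<close>;
    \<open>d = -1\<close> is the mirror image.\<close>
  define m where "m = fst p + d * Q"
  define A' where "A' = insert (m, P + Q) ((\<lambda>s. (fst s, l * snd s)) ` (A - {p, q}))"
  show ?thesis
  proof (rule that)
    show "config A'"
      using fA pos rad R PQ l(1) by (auto simp: config_def A'_def)
    have "card A' \<le> Suc (card (A - {p, q}))"
      unfolding A'_def by (rule order_trans[OF card_insert_le_m1]) (use fA in \<open>auto intro: card_image_le\<close>)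
    also have "card (A - {p, q}) = card A - 2"
      using fA pq by (simp add: card_Diff_subset)
    also have "2 \<le> card A"
      using card_mono[OF fA, of "{p, q}"] pq by simp
    then have "Suc (card A - 2) < card A" by simp
    finally show "card A' < card A" .
    \<comment> \<open>A third centre keeps distance \<open>l * snd s + P\<close> from the first and
      \<open>l * snd s + Q\<close> from the second centre. These are only \<open>P + Q\<close>
      apart, so it cannot lie between them, and beyond either of them its distance from
      \<open>m\<close> is large enough.\<close>
    have far: "l * snd s + (P + Q) \<le> circle_norm (to_circle (fst s - m))"
      "l * snd s + (P + Q) \<le> circle_norm (to_circle (m - fst s))" if s: "s \<in> A" "s \<noteq> p" "s \<noteq> q" for s
    proof -
      have S: "0 < l * snd s" using pos[OF s(1)] l(1) by simp
      have "l * snd s + P \<le> circle_norm (to_circle (fst s - fst p))"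
        "l * snd s + Q \<le> circle_norm (to_circle (fst s - fst q))"
        using A(2) s pq(1,2) by (auto simp: separated_def P_def Q_def distrib_left)
      then have sp: "l * snd s + P \<le> \<bar>fst s - fst p - of_int j\<bar>" and sq: "l * snd s + Q \<le> \<bar>fst s - fst q - of_int j\<bar>" for j :: int
        by (simp_all add: le_circle_norm_iff)
      have *: "l * snd s + (P + Q) \<le> \<bar>fst s - m - of_int j\<bar>" for j :: int
        using sp[of j] sq[of "j + k"] S PQ d by (auto simp: m_def abs_real_def split: if_splits)
      then show "l * snd s + (P + Q) \<le> circle_norm (to_circle (fst s - m))"
        by (simp add: le_circle_norm_iff)
      have "\<bar>m - fst s - of_int j\<bar> = \<bar>fst s - m - of_int (- j)\<bar>" for j :: int by simp
      with * show "l * snd s + (P + Q) \<le> circle_norm (to_circle (m - fst s))"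
        by (simp only: le_circle_norm_iff) blast
    qed
    show "separated 1 A'"
      unfolding separated_def
    proof (intro ballI impI)
      fix u v assume uv: "u \<in> A'" "v \<in> A'" "u \<noteq> v"
      consider "u = (m, P + Q)" "v = (m, P + Q)"
        | s where "u = (m, P + Q)" "s \<in> A - {p, q}" "v = (fst s, l * snd s)"
        | s where "v = (m, P + Q)" "s \<in> A - {p, q}" "u = (fst s, l * snd s)"
        | s s' where "s \<in> A - {p, q}" "s' \<in> A - {p, q}" "u = (fst s, l * snd s)" "v = (fst s', l * snd s')"
        using uv(1,2) unfolding A'_def by blast
      then show "1 * (snd u + snd v) \<le> circle_norm (to_circle (fst u - fst v))"
      proof cases
        case 1 then show ?thesis using uv(3) by simp
      next
        case 2 then show ?thesis using far(2)[of s] by (simp add: add.commute)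
      next
        case 3 then show ?thesis using far(1)[of s] by simp
      next
        case 4
        then have "s \<noteq> s'" using uv(3) by auto
        with 4 A(2) show ?thesis by (auto simp: separated_def distrib_left)
      qed
    qed
    have qk: "to_circle x \<in> circle_arc (fst q) Q \<longleftrightarrow> (\<exists>j::int. \<bar>x - fst p - d * (P + Q) - of_int j\<bar> < Q)" for x
    proof -
      have e: "\<bar>x - fst q - of_int j\<bar> < Q \<longleftrightarrow> \<bar>x - fst p - d * (P + Q) - of_int (j - k)\<bar> < Q" for j
        by (simp add: d(2) algebra_simps)
      show ?thesis
        unfolding vimage_arc
      proof
        assume "\<exists>j::int. \<bar>x - fst q - of_int j\<bar> < Q"
        then show "\<exists>j::int. \<bar>x - fst p - d * (P + Q) - of_int j\<bar> < Q" using e by blast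
      next
        assume "\<exists>j::int. \<bar>x - fst p - d * (P + Q) - of_int j\<bar> < Q"
        then obtain j :: int where "\<bar>x - fst p - d * (P + Q) - of_int ((j + k) - k)\<bar> < Q" by auto
        then show "\<exists>j::int. \<bar>x - fst q - of_int j\<bar> < Q" using e[of "j + k"] by blast
      qed
    qed
    have sub: "circle_arc (fst p) P \<union> circle_arc (fst q) Q \<subseteq> circle_arc m (P + Q)"
    proof -
      have "to_circle x \<in> circle_arc m (P + Q)" if "to_circle x \<in> circle_arc (fst p) P \<or> to_circle x \<in> circle_arc (fst q) Q" for x
      proof -
        from that obtain j :: int where "\<bar>x - fst p - of_int j\<bar> < P \<or> \<bar>x - fst p - d * (P + Q) - of_int j\<bar> < Q"
          unfolding qk by (auto simp: vimage_arc)
        then have "\<bar>x - m - of_int j\<bar> < P + Q"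
          using d(1) PQ by (auto simp: m_def abs_less_iff)
        then show ?thesis unfolding vimage_arc by blast
      qed
      then show ?thesis
        by (auto intro: to_circle_cases) (metis to_circle_cases)+
    qed
    have pt: "circle_arc m (P + Q) - (circle_arc (fst p) P \<union> circle_arc (fst q) Q) \<subseteq> {to_circle (fst p + d * P)}"
    proof
      fix z assume z: "z \<in> circle_arc m (P + Q) - (circle_arc (fst p) P \<union> circle_arc (fst q) Q)"
      obtain x where x: "z = to_circle x" by (rule to_circle_cases)
      then obtain j :: int where j: "\<bar>x - m - of_int j\<bar> < P + Q" using z by (auto simp: vimage_arc)
      have "\<not> \<bar>x - fst p - of_int j\<bar> < P" "\<not> \<bar>x - fst p - d * (P + Q) - of_int j\<bar> < Q"
        using z x qk by (auto simp: vimage_arc)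
      with j have "x - (fst p + d * P) = of_int j"
        using d(1) PQ by (auto simp: m_def abs_less_iff not_less)
      then show "z \<in> {to_circle (fst p + d * P)}" using x by (simp add: to_circle_eq_iff)
    qed
    have "{to_circle y} \<in> null_sets circle_measure" for y
    proof -
      have "to_circle -` {to_circle y} \<subseteq> (\<lambda>k::int. y + of_int k) ` UNIV"
        by (auto simp: to_circle_eq_iff elim!: Ints_cases simp: image_iff algebra_simps)
      then have "countable (to_circle -` {to_circle y})"
        by (rule countable_subset) simp
      then show ?thesis
        unfolding circle_null_iff by (simp add: countable_imp_null_set_lborel null_sets_completionI)
    qed
    then have null: "circle_arc m (P + Q) - (circle_arc (fst p) P \<union> circle_arc (fst q) Q) \<in> null_sets circle_measure"
      using pt by (rule circle_null_subset)
    have "arcs 1 A' = circle_arc m (P + Q) \<union> (\<Union>s\<in>A - {p, q}. circle_arc (fst s) (l * snd s))"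
      by (simp add: arcs_def A'_def)
    moreover have "arcs l A = (circle_arc (fst p) P \<union> circle_arc (fst q) Q) \<union> (\<Union>s\<in>A - {p, q}. circle_arc (fst s) (l * snd s))"
      using pq by (auto simp: arcs_def P_def Q_def)
    ultimately have "sym_diff (arcs l A) (arcs 1 A') \<subseteq> circle_arc m (P + Q) - (circle_arc (fst p) P \<union> circle_arc (fst q) Q)"
      using sub by blast
    with null show "arcs l A \<doteq> arcs 1 A'"
      unfolding null_eq_def by (rule circle_null_subset)
  qed
qed

section \<open>Correlations of sets\<close>

lemma circle_measurableI:
  assumes "(\<lambda>s. f (to_circle s)) \<in> borel_measurable lebesgue"
  shows "f \<in> borel_measurable circle_measure"
proof (rule measurableI)
  fix T :: "'a set" assume "T \<in> sets borel"
  with assms have "(\<lambda>s. f (to_circle s)) -` T \<inter> space lebesgue \<in> sets lebesgue"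
    by (rule measurable_sets)
  then show "f -` T \<inter> space circle_measure \<in> sets circle_measure"
    by (simp add: circle_sets_iff vimage_comp comp_def)
qed simp

lemma measurable_to_circle: "to_circle \<in> lebesgue \<rightarrow>\<^sub>M circle_measure"
  by (rule measurableI) (simp_all add: circle_sets_iff)

lemma circle_measure_eq: "circle_measure = distr (lebesgue_on {0..<1}) circle_measure to_circle"
proof (rule measure_eqI)
  fix E assume E: "E \<in> sets circle_measure"
  have m: "to_circle \<in> lebesgue_on {0..<1} \<rightarrow>\<^sub>M circle_measure"
    by (rule measurable_restrict_space1[OF measurable_to_circle])
  have "emeasure (distr (lebesgue_on {0..<1}) circle_measure to_circle) E
      = emeasure (lebesgue_on {0..<1}) (to_circle -` E \<inter> {0..<1})"
    by (subst emeasure_distr[OF m E]) simp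
  also have "\<dots> = emeasure lebesgue (to_circle -` E \<inter> {0..<1})"
    by (rule emeasure_restrict_space) auto
  finally show "emeasure circle_measure E = emeasure (distr (lebesgue_on {0..<1}) circle_measure to_circle) E"
    by (simp add: emeasure_circle_measure[OF E])
qed simp

lemma nn_integral_circle:
  assumes "f \<in> borel_measurable circle_measure"
  shows "(\<integral>\<^sup>+y. f y \<partial>circle_measure) = (\<integral>\<^sup>+s. f (to_circle s) * indicator {0..<1} s \<partial>lebesgue)"
proof -
  have m: "to_circle \<in> lebesgue_on {0..<1} \<rightarrow>\<^sub>M circle_measure"
    by (rule measurable_restrict_space1[OF measurable_to_circle])
  show ?thesis
    by (subst circle_measure_eq) (simp add: nn_integral_distr[OF m] assms nn_integral_restrict_space)
qed

lemma integral_circle: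
  fixes f :: "circle \<Rightarrow> real"
  assumes "f \<in> borel_measurable circle_measure"
  shows "(\<integral>y. f y \<partial>circle_measure) = (LINT s:{0..<1}|lebesgue. f (to_circle s))"
proof -
  have m: "to_circle \<in> lebesgue_on {0..<1} \<rightarrow>\<^sub>M circle_measure"
    by (rule measurable_restrict_space1[OF measurable_to_circle])
  show ?thesis
    by (subst circle_measure_eq) (simp add: integral_distr[OF m] assms integral_restrict_space set_lebesgue_integral_def)
qed

lemma circle_translate_sets: "E \<in> sets circle_measure \<Longrightarrow> (\<lambda>x. x + y) ` E \<in> sets circle_measure"
proof -
  assume E: "E \<in> sets circle_measure"
  obtain a where y: "y = to_circle a" by (rule to_circle_cases)
  show ?thesis
    unfolding circle_sets_iff y vimage_translate
    using lebesgue_sets_translation[of "to_circle -` E" a] E by (simp add: circle_sets_iff add.commute[of a])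
qed

lemma circle_translate_measure:
  assumes E: "E \<in> sets circle_measure"
  shows "measure circle_measure ((\<lambda>x. x + y) ` E) = measure circle_measure E"
proof -
  obtain a where y: "y = to_circle a" by (rule to_circle_cases)
  let ?T = "to_circle -` (\<lambda>x. x + y) ` E"
  have T: "?T \<in> sets lebesgue" using circle_translate_sets[OF E, of y] by (simp add: circle_sets_iff)
  have "measure circle_measure ((\<lambda>x. x + y) ` E) = mass ?T 0 1"
    by (rule measure_circle[OF circle_translate_sets[OF E]])
  also have "\<dots> = mass ?T (0 + a) (1 + a)"
    using periodic_mass[OF T periodic_vimage, of a] by (simp add: add.commute)
  also have "\<dots> = mass (to_circle -` E) 0 1"
    unfolding y vimage_translate by (rule mass_translate)
  finally show ?thesis by (simp add: measure_circle[OF E])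
qed

lemma circle_uminus_sets: "E \<in> sets circle_measure \<Longrightarrow> uminus ` E \<in> sets circle_measure"
  by (simp add: circle_sets_iff vimage_uminus uminus_sets_lebesgue)

lemma circle_uminus_measure:
  assumes E: "E \<in> sets circle_measure"
  shows "measure circle_measure (uminus ` E) = measure circle_measure E"
proof -
  have S: "to_circle -` E \<in> sets lebesgue" using E by (simp add: circle_sets_iff)
  show ?thesis
    using periodic_mass[OF S periodic_vimage, of "-1"]
    by (simp add: measure_circle[OF E] measure_circle[OF circle_uminus_sets[OF E]] vimage_uminus mass_uminus)
qed

lemma circle_translate_vimage: "(\<lambda>x. x + y) -` E = (\<lambda>x. x + - y) ` (E :: circle set)"
  by (auto simp: image_iff intro!: bexI[of _ "_ + y"])

lemma circle_distr_translate: "distr circle_measure circle_measure (\<lambda>x. x + y) = circle_measure"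
    and measurable_circle_translate: "(\<lambda>x. x + y) \<in> circle_measure \<rightarrow>\<^sub>M circle_measure"
proof -
  show m: "(\<lambda>x. x + y) \<in> circle_measure \<rightarrow>\<^sub>M circle_measure"
    by (rule measurableI) (simp_all add: circle_translate_vimage circle_translate_sets del: add_uminus_conv_diff)
  show "distr circle_measure circle_measure (\<lambda>x. x + y) = circle_measure"
  proof (rule measure_eqI)
    fix E assume "E \<in> sets (distr circle_measure circle_measure (\<lambda>x. x + y))"
    then have E: "E \<in> sets circle_measure" by simp
    show "emeasure (distr circle_measure circle_measure (\<lambda>x. x + y)) E = emeasure circle_measure E"
      using circle_translate_measure[OF E, of "- y"]
      by (simp add: emeasure_distr[OF m E] circle_translate_vimage circle.emeasure_eq_measure del: add_uminus_conv_diff)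
  qed simp
qed

lemma integral_circle_translate:
  fixes f :: "circle \<Rightarrow> real"
  assumes "f \<in> borel_measurable circle_measure"
  shows "(\<integral>x. f (x + y) \<partial>circle_measure) = (\<integral>x. f x \<partial>circle_measure)"
  using integral_distr[OF measurable_circle_translate assms, of y] by (simp add: circle_distr_translate)

text \<open>Joint measurability of the kernel in \<open>borel_measurable_kernel\<close> rests on
  Borel lifts, so Fubini arguments first pass to Borel representatives of the classes.\<close>

lemma circle_borel_representative:
  assumes "A \<in> sets circle_measure"
  obtains A' where "A \<doteq> A'" "to_circle -` A' \<in> sets borel"
proof -
  have "to_circle -` A \<in> sets (completion lborel)" using assms by (simp add: circle_sets_iff)
  then obtain B N N' where B: "to_circle -` A = B \<union> N" "N \<subseteq> N'" "N' \<in> null_sets lborel" "B \<in> sets lborel"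
    by (rule sets_completionE)
  \<comment> \<open>The Borel set \<open>B\<close> need not be periodic; \<open>C\<close> continues
    its part in \<open>{0..<1}\<close> periodically.\<close>
  define C where "C = {x. frac x \<in> B}"
  have "(\<lambda>x::real. frac x) \<in> borel_measurable borel"
    unfolding frac_def by measurable
  then have C: "C \<in> sets borel"
    using measurable_sets[of frac borel borel B] B(4) by (simp add: C_def vimage_def)
  have pC: "periodic C" by (simp add: periodic_def C_def frac_1_eq)
  define A' where "A' = to_circle ` C"
  have vA': "to_circle -` A' = C" by (simp add: A'_def vimage_to_circle_image[OF pC])
  have A': "A' \<in> sets circle_measure"
    using C unfolding circle_sets_iff vA' by (metis sets_completionI_sets sets_lborel)
  have "sym_diff A A' \<in> sets circle_measure" using assms A' by blast
  moreover have "emeasure circle_measure (sym_diff A A') = 0"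
  proof -
    have fr: "frac x = x" if "x \<in> {0..<1}" for x :: real
      using that by (simp add: frac_eq)
    have "to_circle -` sym_diff A A' \<inter> {0..<1} \<subseteq> N'"
    proof
      fix x assume "x \<in> to_circle -` sym_diff A A' \<inter> {0..<1}"
      moreover have "to_circle x \<in> A \<longleftrightarrow> x \<in> B \<union> N" "to_circle x \<in> A' \<longleftrightarrow> x \<in> C"
        using B(1) vA' by blast+
      ultimately show "x \<in> N'" using B(2) fr by (auto simp: C_def)
    qed
    moreover have "N' \<in> null_sets lebesgue" using B(3) by (rule null_sets_completionI)
    ultimately have "to_circle -` sym_diff A A' \<inter> {0..<1} \<in> null_sets lebesgue"
      by (metis negligible_iff_null_sets negligible_subset)
    then show ?thesis
      using emeasure_circle_measure[OF \<open>sym_diff A A' \<in> sets circle_measure\<close>] by (simp add: null_sets_def)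
  qed
  ultimately have "A \<doteq> A'" by (simp add: null_eq_def null_sets_def)
  with that C vA' show ?thesis by simp
qed

text \<open>The cross-correlation of two indicators. With the reflected set as first argument it
  becomes the convolution that defines the essential sumset, and its integrals over sets are the
  values of the trilinear form.\<close>

definition corr :: "circle set \<Rightarrow> circle set \<Rightarrow> circle \<Rightarrow> real"
  where "corr A C y = measure circle_measure (C \<inter> {z. z - y \<in> A})"

lemma translate_eq: "{z. z - y \<in> A} = (\<lambda>x. x + y) ` (A :: circle set)"
  by (auto simp: image_iff intro!: bexI[of _ "_ - y"])

lemma mem_uminus_image: "x \<in> uminus ` A \<longleftrightarrow> - x \<in> (A :: circle set)"
  by (auto simp: image_iff intro!: bexI[of _ "- x"])

lemma reflect_eq: "{y. z - y \<in> A} = (\<lambda>x. x + z) ` uminus ` (A :: circle set)"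
  by (simp add: translate_eq[symmetric] mem_uminus_image)

lemma translate_sets: "A \<in> sets circle_measure \<Longrightarrow> {z. z - y \<in> A} \<in> sets circle_measure"
  by (simp add: translate_eq circle_translate_sets)

lemma reflect_sets: "A \<in> sets circle_measure \<Longrightarrow> {y. z - y \<in> A} \<in> sets circle_measure"
  by (simp add: reflect_eq circle_translate_sets circle_uminus_sets)

lemma corr_bounds: "0 \<le> corr A C y" "corr A C y \<le> 1"
  by (simp_all add: corr_def measure_circle_le_1)

lemma measure_diff_le:
  assumes "A \<in> sets circle_measure" "B \<in> sets circle_measure"
  shows "\<bar>measure circle_measure A - measure circle_measure B\<bar> \<le> measure circle_measure (sym_diff A B)"
proof -
  have "measure circle_measure A \<le> measure circle_measure (B \<union> sym_diff A B)"
    "measure circle_measure B \<le> measure circle_measure (A \<union> sym_diff A B)"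
    using assms by (auto intro!: circle.finite_measure_mono)
  moreover have "measure circle_measure (B \<union> sym_diff A B) \<le> measure circle_measure B + measure circle_measure (sym_diff A B)"
    "measure circle_measure (A \<union> sym_diff A B) \<le> measure circle_measure A + measure circle_measure (sym_diff A B)"
    using assms by (auto intro!: measure_Un_le)
  ultimately show ?thesis by linarith
qed

lemma corr_Lipschitz:
  assumes "A \<in> sets circle_measure" "A' \<in> sets circle_measure" "C \<in> sets circle_measure" "C' \<in> sets circle_measure"
  shows "\<bar>corr A C y - corr A' C' y\<bar> \<le> measure circle_measure (sym_diff A A') + measure circle_measure (sym_diff C C')"
proof -
  let ?T = "\<lambda>A. {z. z - y \<in> A}"
  have "\<bar>corr A C y - corr A' C' y\<bar> \<le> measure circle_measure (sym_diff (C \<inter> ?T A) (C' \<inter> ?T A'))"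
    unfolding corr_def by (intro measure_diff_le sets.Int translate_sets assms)
  also have "\<dots> \<le> measure circle_measure (?T (sym_diff A A') \<union> sym_diff C C')"
    by (intro circle.finite_measure_mono sets.Un sets.Diff translate_sets assms) auto
  also have "\<dots> \<le> measure circle_measure (?T (sym_diff A A')) + measure circle_measure (sym_diff C C')"
    by (intro measure_Un_le sets.Un sets.Diff translate_sets assms)
  also have "measure circle_measure (?T (sym_diff A A')) = measure circle_measure (sym_diff A A')"
    unfolding translate_eq by (intro circle_translate_measure sets.Un sets.Diff assms)
  finally show ?thesis .
qed

lemma null_eq_measure_0: "A \<doteq> B \<Longrightarrow> measure circle_measure (sym_diff A B) = 0"
  by (simp add: null_eq_def null_sets_def measure_def)

lemma corr_cong:
  assumes "A \<doteq> A'" "C \<doteq> C'" "A \<in> sets circle_measure" "C \<in> sets circle_measure"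
  shows "corr A C y = corr A' C' y"
  using corr_Lipschitz[OF assms(3) null_eq_sets[OF assms(1,3)] assms(4) null_eq_sets[OF assms(2,4)], of y]
    null_eq_measure_0[OF assms(1)] null_eq_measure_0[OF assms(2)] by simp

lemma uminus_null_eq:
  assumes "A \<doteq> B" "A \<in> sets circle_measure" shows "uminus ` A \<doteq> uminus ` B"
proof -
  have s: "sym_diff A B \<in> sets circle_measure" using assms null_eq_sets[OF assms] by blast
  have "sym_diff (uminus ` A) (uminus ` B) = uminus ` sym_diff A B"
    by (simp add: image_set_diff image_Un)
  with s circle_uminus_measure[OF s] circle_uminus_sets[OF s] null_eq_measure_0[OF assms(1)] show ?thesis
    by (simp add: null_eq_def null_sets_def circle.emeasure_eq_measure)
qed

lemma corr_reflect: "corr (uminus ` A) B z = measure circle_measure (B \<inter> {y. z - y \<in> A})"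
  by (simp add: corr_def mem_uminus_image)

lemma corr_nn_integral:
  assumes A: "to_circle -` A \<in> sets borel" and C: "to_circle -` C \<in> sets borel"
  shows "(\<integral>\<^sup>+z. indicator (to_circle -` C \<inter> {0..<1}) z * indicator (to_circle -` A) (z - s) \<partial>lborel)
    = ennreal (corr A C (to_circle s))"
proof -
  have CA: "C \<inter> {z. z - to_circle s \<in> A} \<in> sets circle_measure"
    using A C by (intro sets.Int translate_sets) (simp_all add: circle_sets_iff)
  have "(\<lambda>z. z - s) -` (to_circle -` A) \<inter> space borel \<in> sets borel"
    by (rule measurable_sets[OF _ A]) simp
  then have *: "to_circle -` C \<inter> {0..<1} \<inter> (\<lambda>z. z - s) -` (to_circle -` A) \<in> sets borel"
    using C by (intro sets.Int) auto
  have "(\<integral>\<^sup>+z. indicator (to_circle -` C \<inter> {0..<1}) z * indicator (to_circle -` A) (z - s) \<partial>lborel)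
      = (\<integral>\<^sup>+z. indicator (to_circle -` C \<inter> {0..<1} \<inter> (\<lambda>z. z - s) -` (to_circle -` A)) z \<partial>lborel)"
    by (intro nn_integral_cong) (auto simp: indicator_def)
  also have "\<dots> = emeasure lebesgue (to_circle -` C \<inter> {0..<1} \<inter> (\<lambda>z. z - s) -` (to_circle -` A))"
    using * by simp
  also have "to_circle -` C \<inter> {0..<1} \<inter> (\<lambda>z. z - s) -` (to_circle -` A)
      = to_circle -` (C \<inter> {z. z - to_circle s \<in> A}) \<inter> {0..<1}"
    by (auto simp: to_circle_diff)
  finally show ?thesis
    by (simp add: corr_def circle.emeasure_eq_measure[symmetric] emeasure_circle_measure[OF CA])
qed

lemma borel_measurable_kernel:
  assumes A: "to_circle -` A \<in> sets borel" and C: "to_circle -` C \<in> sets borel"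
  shows "(\<lambda>(s, z). indicator (to_circle -` C \<inter> {0..<1}) z * indicator (to_circle -` A) (z - s) :: ennreal)
    \<in> borel_measurable (lborel \<Otimes>\<^sub>M lborel)"
proof -
  have [measurable]: "to_circle -` A \<in> sets borel" "to_circle -` C \<inter> {0..<1} \<in> sets borel"
    using A C by auto
  show ?thesis by measurable
qed

lemma corr_measurable:
  assumes "A \<in> sets circle_measure" "C \<in> sets circle_measure"
  shows "corr A C \<in> borel_measurable circle_measure"
proof -
  obtain A' where A': "A \<doteq> A'" "to_circle -` A' \<in> sets borel" using circle_borel_representative[OF assms(1)] .
  obtain C' where C': "C \<doteq> C'" "to_circle -` C' \<in> sets borel" using circle_borel_representative[OF assms(2)] .
  have "(\<lambda>s. ennreal (corr A' C' (to_circle s))) \<in> borel_measurable lborel"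
    using lborel.borel_measurable_nn_integral[OF borel_measurable_kernel[OF A'(2) C'(2)]]
    by (simp add: corr_nn_integral[OF A'(2) C'(2)])
  then have "(\<lambda>s. enn2real (ennreal (corr A' C' (to_circle s)))) \<in> borel_measurable lborel"
    by measurable
  then have "(\<lambda>s. corr A' C' (to_circle s)) \<in> borel_measurable lebesgue"
    by (simp add: corr_bounds measurable_completion)
  then have "corr A' C' \<in> borel_measurable circle_measure" by (rule circle_measurableI)
  moreover have "corr A C = corr A' C'"
    by (rule ext) (rule corr_cong[OF A'(1) C'(1) assms])
  ultimately show ?thesis by simp
qed

lemma corr_integrable:
  assumes "A \<in> sets circle_measure" "B \<in> sets circle_measure" "C \<in> sets circle_measure"
  shows "integrable circle_measure (\<lambda>y. indicator B y * corr A C y)"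
proof (rule circle.integrable_const_bound[where B = 1])
  show "AE y in circle_measure. norm (indicator B y * corr A C y) \<le> 1"
    using corr_bounds[of A C] by (auto simp: indicator_def)
  show "(\<lambda>y. indicator B y * corr A C y) \<in> borel_measurable circle_measure"
    using corr_measurable[OF assms(1,3)] assms(2) by measurable
qed

text \<open>Both sides are the measure of the pairs \<open>(y, z)\<close> with
  \<open>y \<in> B\<close>, \<open>z \<in> C\<close> and \<open>z - y \<in> A\<close>, integrated in
  either order. Borel representatives justify the exchange and are removed again at the end.\<close>

lemma corr_Fubini:
  assumes A: "A \<in> sets circle_measure" and B: "B \<in> sets circle_measure" and C: "C \<in> sets circle_measure"
  shows "(\<integral>y. indicator B y * corr A C y \<partial>circle_measure) = (\<integral>z. indicator C z * corr (uminus ` A) B z \<partial>circle_measure)"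
proof -
  obtain A' where A': "A \<doteq> A'" "to_circle -` A' \<in> sets borel" using circle_borel_representative[OF A] .
  obtain B' where B': "B \<doteq> B'" "to_circle -` B' \<in> sets borel" using circle_borel_representative[OF B] .
  obtain C' where C': "C \<doteq> C'" "to_circle -` C' \<in> sets borel" using circle_borel_representative[OF C] .
  note s' = null_eq_sets[OF A'(1) A] null_eq_sets[OF B'(1) B] null_eq_sets[OF C'(1) C]
  have ind: "(\<integral>y. indicator X y * f y \<partial>circle_measure) = (\<integral>y. indicator X' y * f y \<partial>circle_measure)"
    if "X \<doteq> X'" "X \<in> sets circle_measure" "f \<in> borel_measurable circle_measure" for X X' and f :: "circle \<Rightarrow> real"
  proof (rule integral_cong_AE)
    have "AE y in circle_measure. y \<notin> sym_diff X X'"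
      using that(1) unfolding null_eq_def by (rule AE_not_in)
    then show "AE y in circle_measure. indicator X y * f y = indicator X' y * f y"
      by eventually_elim (auto simp: indicator_def)
  qed (use that null_eq_sets[OF that(1,2)] in measurable)
  have uA: "uminus ` A' \<in> sets circle_measure" by (rule circle_uminus_sets[OF s'(1)])
  have vuA: "to_circle -` uminus ` A' \<in> sets borel"
  proof -
    have "uminus -` (to_circle -` A') \<inter> space borel \<in> sets borel"
      by (rule measurable_sets[OF _ A'(2)]) simp
    moreover have "uminus -` (to_circle -` A') = to_circle -` uminus ` A'"
      unfolding vimage_uminus by (auto simp: image_iff intro!: bexI[of _ "- _"])
    ultimately show ?thesis by simp
  qed
  have nn: "(\<integral>\<^sup>+y. ennreal (indicator Y y * corr X Z y) \<partial>circle_measure)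
     = (\<integral>\<^sup>+s. indicator (to_circle -` Y \<inter> {0..<1}) s *
        (\<integral>\<^sup>+z. indicator (to_circle -` Z \<inter> {0..<1}) z * indicator (to_circle -` X) (z - s) \<partial>lborel) \<partial>lborel)"
    if "to_circle -` X \<in> sets borel" "to_circle -` Y \<in> sets borel" "to_circle -` Z \<in> sets borel" for X Y Z
  proof -
    have XYZ: "X \<in> sets circle_measure" "Y \<in> sets circle_measure" "Z \<in> sets circle_measure"
      using that by (simp_all add: circle_sets_iff)
    have "(\<lambda>y. ennreal (indicator Y y * corr X Z y)) \<in> borel_measurable circle_measure"
      using corr_measurable[OF XYZ(1,3)] XYZ(2) by measurable
    then have "(\<integral>\<^sup>+y. ennreal (indicator Y y * corr X Z y) \<partial>circle_measure)
      = (\<integral>\<^sup>+s. ennreal (indicator Y (to_circle s) * corr X Z (to_circle s)) * indicator {0..<1} s \<partial>lebesgue)"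
      by (rule nn_integral_circle)
    also have "\<dots> = (\<integral>\<^sup>+s. indicator (to_circle -` Y \<inter> {0..<1}) s * ennreal (corr X Z (to_circle s)) \<partial>lborel)"
      unfolding nn_integral_completion by (intro nn_integral_cong) (auto simp: indicator_def)
    finally show ?thesis by (simp only: corr_nn_integral[OF that(1,3)])
  qed
  let ?k = "\<lambda>s z. indicator (to_circle -` B' \<inter> {0..<1}) s * (indicator (to_circle -` C' \<inter> {0..<1}) z * indicator (to_circle -` A') (z - s)) :: ennreal"
  have [measurable]: "to_circle -` A' \<in> sets borel" "to_circle -` B' \<inter> {0..<1} \<in> sets borel" "to_circle -` C' \<inter> {0..<1} \<in> sets borel"
    using A' B' C' by auto
  have "(\<integral>\<^sup>+y. ennreal (indicator B' y * corr A' C' y) \<partial>circle_measure) = (\<integral>\<^sup>+s. \<integral>\<^sup>+z. ?k s z \<partial>lborel \<partial>lborel)"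
    by (subst nn[OF A'(2) B'(2) C'(2)]) (intro nn_integral_cong nn_integral_cmult[symmetric], measurable)
  also have "\<dots> = (\<integral>\<^sup>+z. \<integral>\<^sup>+s. ?k s z \<partial>lborel \<partial>lborel)"
    by (rule lborel_pair.Fubini') measurable
  also have "\<dots> = (\<integral>\<^sup>+z. indicator (to_circle -` C' \<inter> {0..<1}) z *
        (\<integral>\<^sup>+s. indicator (to_circle -` B' \<inter> {0..<1}) s * indicator (to_circle -` uminus ` A') (s - z) \<partial>lborel) \<partial>lborel)"
  proof (intro nn_integral_cong)
    fix z
    have "?k s z = indicator (to_circle -` C' \<inter> {0..<1}) z *
      (indicator (to_circle -` B' \<inter> {0..<1}) s * indicator (to_circle -` uminus ` A') (s - z))" for s
    proof -
      have "to_circle (s - z) \<in> uminus ` A' \<longleftrightarrow> to_circle (z - s) \<in> A'"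
        using to_circle_minus[of "z - s"] by (auto simp: image_iff intro!: bexI[of _ "to_circle (z - s)"])
      then show ?thesis by (simp add: indicator_def)
    qed
    then show "(\<integral>\<^sup>+s. ?k s z \<partial>lborel) = indicator (to_circle -` C' \<inter> {0..<1}) z *
        (\<integral>\<^sup>+s. indicator (to_circle -` B' \<inter> {0..<1}) s * indicator (to_circle -` uminus ` A') (s - z) \<partial>lborel)"
      using vuA by (subst nn_integral_cmult[symmetric]) (auto intro!: nn_integral_cong)
  qed
  also have "\<dots> = (\<integral>\<^sup>+z. ennreal (indicator C' z * corr (uminus ` A') B' z) \<partial>circle_measure)"
    by (rule nn[OF vuA C'(2) B'(2), symmetric])
  finally have eq: "(\<integral>\<^sup>+y. ennreal (indicator B' y * corr A' C' y) \<partial>circle_measure)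
    = (\<integral>\<^sup>+z. ennreal (indicator C' z * corr (uminus ` A') B' z) \<partial>circle_measure)" .
  have "(\<integral>y. indicator B' y * corr A' C' y \<partial>circle_measure) = (\<integral>z. indicator C' z * corr (uminus ` A') B' z \<partial>circle_measure)"
    using eq corr_integrable[OF s'(1,2,3)] corr_integrable[OF uA s'(3,2)]
    by (simp add: integral_eq_nn_integral corr_bounds)
  moreover have "corr A C = corr A' C'" "corr (uminus ` A) B = corr (uminus ` A') B'"
    by (intro ext corr_cong A' B' C' A B C circle_uminus_sets uminus_null_eq)+
  ultimately show ?thesis
    using ind[OF B'(1) B corr_measurable[OF s'(1,3)]] ind[OF C'(1) C corr_measurable[OF uA s'(2)]] by simp
qed

section \<open>The trilinear form\<close>

text \<open>Substitute \<open>z = x + y\<close> in the inner integral: the three conditions become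
  \<open>z - y \<in> E1\<close>, \<open>y \<in> E2\<close> and \<open>- z \<in> E3\<close>.\<close>

lemma trilinear_eq:
  assumes E: "E1 \<in> sets circle_measure" "E2 \<in> sets circle_measure" "E3 \<in> sets circle_measure"
  shows "trilinear E1 E2 E3 = (\<integral>y. indicator E2 y * corr E1 (uminus ` E3) y \<partial>circle_measure)"
  unfolding trilinear_def
proof (rule Bochner_Integration.integral_cong)
  fix y
  let ?X = "E1 \<inter> {x. - y - x \<in> E3}"
  have X: "?X \<in> sets circle_measure" by (intro sets.Int reflect_sets E)
  have eq: "indicator E1 x * indicator E2 y * indicator E3 (- x - y) = (indicator E2 y :: real) * indicator ?X x" for x
  proof -
    have "- x - y = - y - x" by (simp add: algebra_simps)
    then have "(indicator E3 (- x - y) :: real) = indicator E3 (- y - x)" by (rule arg_cong)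
    then show ?thesis by (simp only:) (auto simp: indicator_def)
  qed
  have "(\<integral>x. indicator E1 x * indicator E2 y * indicator E3 (- x - y) \<partial>circle_measure)
    = indicator E2 y * measure circle_measure ?X"
    unfolding eq using X by simp
  also have "measure circle_measure ?X = measure circle_measure ((\<lambda>x. x + y) ` ?X)"
    by (rule circle_translate_measure[OF X, symmetric])
  also have "(\<lambda>x. x + y) ` ?X = uminus ` E3 \<inter> {z. z - y \<in> E1}"
    by (auto simp: translate_eq[symmetric] mem_uminus_image algebra_simps)
  finally show "(\<integral>x. indicator E1 x * indicator E2 y * indicator E3 (- x - y) \<partial>circle_measure)
    = indicator E2 y * corr E1 (uminus ` E3) y"
    by (simp add: corr_def)
qed simp

lemma uminus_sym_diff_measure:
  assumes "A \<in> sets circle_measure" "B \<in> sets circle_measure"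
  shows "measure circle_measure (sym_diff (uminus ` A) (uminus ` B)) = measure circle_measure (sym_diff A B)"
proof -
  have "sym_diff (uminus ` A) (uminus ` B) = uminus ` sym_diff A B"
    by (simp add: image_set_diff image_Un)
  then show ?thesis using assms by (simp only:) (intro circle_uminus_measure sets.Un sets.Diff)
qed

text \<open>The inner correlation lies between \<open>0\<close> and \<open>1\<close>, so replacing
  one of the sets costs at most the measure of the symmetric difference.\<close>

lemma trilinear_Lipschitz:
  assumes E: "E1 \<in> sets circle_measure" "E2 \<in> sets circle_measure" "E3 \<in> sets circle_measure"
    and F: "F1 \<in> sets circle_measure" "F2 \<in> sets circle_measure" "F3 \<in> sets circle_measure"
  shows "\<bar>trilinear E1 E2 E3 - trilinear F1 F2 F3\<bar> \<le> measure circle_measure (sym_diff E1 F1)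
    + measure circle_measure (sym_diff E2 F2) + measure circle_measure (sym_diff E3 F3)"
proof -
  let ?d = "\<lambda>A B. measure circle_measure (sym_diff A B)"
  let ?e = "\<lambda>y. indicator E2 y * corr E1 (uminus ` E3) y"
  let ?f = "\<lambda>y. indicator F2 y * corr F1 (uminus ` F3) y"
  have ie: "integrable circle_measure ?e" and "if": "integrable circle_measure ?f"
    by (intro corr_integrable E F circle_uminus_sets)+
  have "\<bar>trilinear E1 E2 E3 - trilinear F1 F2 F3\<bar> = \<bar>\<integral>y. ?e y - ?f y \<partial>circle_measure\<bar>"
    using ie "if" by (simp add: trilinear_eq E F)
  also have "\<dots> \<le> (\<integral>y. \<bar>?e y - ?f y\<bar> \<partial>circle_measure)"
    using integral_norm_bound[of circle_measure "\<lambda>y. ?e y - ?f y"] by simp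
  also have "\<dots> \<le> (\<integral>y. indicator (sym_diff E2 F2) y + (?d E1 F1 + ?d E3 F3) \<partial>circle_measure)"
  proof (rule integral_mono)
    fix y
    have "\<bar>corr E1 (uminus ` E3) y - corr F1 (uminus ` F3) y\<bar> \<le> ?d E1 F1 + ?d E3 F3"
      using corr_Lipschitz[OF E(1) F(1) circle_uminus_sets[OF E(3)] circle_uminus_sets[OF F(3)], of y]
        uminus_sym_diff_measure[OF E(3) F(3)] by simp
    then show "\<bar>?e y - ?f y\<bar> \<le> indicator (sym_diff E2 F2) y + (?d E1 F1 + ?d E3 F3)"
      using corr_bounds[of E1 "uminus ` E3" y] corr_bounds[of F1 "uminus ` F3" y]
        measure_nonneg[of circle_measure "sym_diff E1 F1"] measure_nonneg[of circle_measure "sym_diff E3 F3"]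
      by (cases "y \<in> E2"; cases "y \<in> F2") auto
  qed (use ie "if" E F in \<open>auto intro!: Bochner_Integration.integrable_add integrable_real_indicator simp: circle.emeasure_eq_measure\<close>)
  also have "\<dots> = ?d E2 F2 + (?d E1 F1 + ?d E3 F3)"
    using E F by (subst Bochner_Integration.integral_add) (auto simp: circle.emeasure_eq_measure)
  finally show ?thesis by simp
qed

lemma trilinear_cong:
  assumes E: "E1 \<in> sets circle_measure" "E2 \<in> sets circle_measure" "E3 \<in> sets circle_measure"
    and "E1 \<doteq> F1" "E2 \<doteq> F2" "E3 \<doteq> F3"
  shows "trilinear E1 E2 E3 = trilinear F1 F2 F3"
  using trilinear_Lipschitz[OF E null_eq_sets[OF assms(4) E(1)] null_eq_sets[OF assms(5) E(2)] null_eq_sets[OF assms(6) E(3)]]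
    null_eq_measure_0[OF assms(4)] null_eq_measure_0[OF assms(5)] null_eq_measure_0[OF assms(6)] by simp

lemma corr_UN_left:
  assumes "finite I" "disjoint_family_on F I" "\<And>i. i \<in> I \<Longrightarrow> F i \<in> sets circle_measure" "C \<in> sets circle_measure"
  shows "corr (\<Union>i\<in>I. F i) C y = (\<Sum>i\<in>I. corr (F i) C y)"
proof -
  have "C \<inter> {z. z - y \<in> (\<Union>i\<in>I. F i)} = (\<Union>i\<in>I. C \<inter> {z. z - y \<in> F i})" by auto
  then show ?thesis
    unfolding corr_def using assms
    by (simp only:) (intro circle.finite_measure_finite_Union,
      auto simp: disjoint_family_on_def intro!: sets.Int translate_sets)
qed

lemma corr_UN_right:
  assumes "finite I" "disjoint_family_on F I" "\<And>i. i \<in> I \<Longrightarrow> F i \<in> sets circle_measure" "A \<in> sets circle_measure"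
  shows "corr A (\<Union>i\<in>I. F i) y = (\<Sum>i\<in>I. corr A (F i) y)"
proof -
  have "(\<Union>i\<in>I. F i) \<inter> {z. z - y \<in> A} = (\<Union>i\<in>I. F i \<inter> {z. z - y \<in> A})" by auto
  then show ?thesis
    unfolding corr_def using assms
    by (simp only:) (intro circle.finite_measure_finite_Union,
      auto simp: disjoint_family_on_def intro!: sets.Int translate_sets)
qed

lemma trilinear_UN:
  assumes fin: "finite I" "finite J" "finite K"
    and disj: "disjoint_family_on F I" "disjoint_family_on G J" "disjoint_family_on H K"
    and s: "\<And>i. i \<in> I \<Longrightarrow> F i \<in> sets circle_measure" "\<And>j. j \<in> J \<Longrightarrow> G j \<in> sets circle_measure"
      "\<And>k. k \<in> K \<Longrightarrow> H k \<in> sets circle_measure"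
  shows "trilinear (\<Union>i\<in>I. F i) (\<Union>j\<in>J. G j) (\<Union>k\<in>K. H k) = (\<Sum>i\<in>I. \<Sum>j\<in>J. \<Sum>k\<in>K. trilinear (F i) (G j) (H k))"
proof -
  have sU: "(\<Union>i\<in>I. F i) \<in> sets circle_measure" "(\<Union>j\<in>J. G j) \<in> sets circle_measure"
    "(\<Union>k\<in>K. H k) \<in> sets circle_measure"
    using fin s by (auto intro!: sets.finite_UN)
  have dH: "disjoint_family_on (\<lambda>k. uminus ` H k) K"
    using disj(3) unfolding disjoint_family_on_def disjoint_iff mem_uminus_image by blast
  have sH: "uminus ` H k \<in> sets circle_measure" if "k \<in> K" for k using circle_uminus_sets[OF s(3)[OF that]] .
  have "trilinear (\<Union>i\<in>I. F i) (\<Union>j\<in>J. G j) (\<Union>k\<in>K. H k) =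
    (\<integral>y. indicator (\<Union>j\<in>J. G j) y * corr (\<Union>i\<in>I. F i) (\<Union>k\<in>K. uminus ` H k) y \<partial>circle_measure)"
    by (simp add: trilinear_eq[OF sU] image_UN)
  also have "\<dots> = (\<integral>y. (\<Sum>i\<in>I. \<Sum>j\<in>J. \<Sum>k\<in>K. indicator (G j) y * corr (F i) (uminus ` H k) y) \<partial>circle_measure)"
  proof (rule Bochner_Integration.integral_cong)
    fix y
    have "corr (\<Union>i\<in>I. F i) (\<Union>k\<in>K. uminus ` H k) y = (\<Sum>i\<in>I. \<Sum>k\<in>K. corr (F i) (uminus ` H k) y)"
      using fin s sH by (subst corr_UN_left[OF fin(1) disj(1)])
        (auto intro!: sum.cong corr_UN_right[OF fin(3) dH])
    moreover have "indicator (\<Union>j\<in>J. G j) y = (\<Sum>j\<in>J. indicator (G j) y :: real)"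
      by (rule indicator_UN_disjoint[OF fin(2) disj(2)])
    ultimately show "indicator (\<Union>j\<in>J. G j) y * corr (\<Union>i\<in>I. F i) (\<Union>k\<in>K. uminus ` H k) y
      = (\<Sum>i\<in>I. \<Sum>j\<in>J. \<Sum>k\<in>K. indicator (G j) y * corr (F i) (uminus ` H k) y)"
      by (subst sum.swap) (simp add: sum_distrib_left sum_distrib_right sum.swap[of _ K J])
  qed simp
  also have "\<dots> = (\<Sum>i\<in>I. \<Sum>j\<in>J. \<Sum>k\<in>K. trilinear (F i) (G j) (H k))"
    using s sH by (simp add: trilinear_eq Bochner_Integration.integral_sum corr_integrable
        Bochner_Integration.integrable_sum)
  finally show ?thesis .
qed

section \<open>The trilinear form of three arcs\<close>

text \<open>The length of the intersection of the intervals of radius \<open>a\<close> about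
  \<open>0\<close> and of radius \<open>b\<close> about \<open>z\<close>, i.e. the convolution of
  two centred interval indicators on the line. For nonnegative radii it is even and nonincreasing in
  \<open>\<bar>z\<bar>\<close>.\<close>

definition overlap :: "real \<Rightarrow> real \<Rightarrow> real \<Rightarrow> real"
  where "overlap a b z = max 0 (min a (z + b) - max (- a) (z - b))"

lemma overlap_antimono:
  "0 \<le> a \<Longrightarrow> 0 \<le> b \<Longrightarrow> \<bar>z\<bar> \<le> \<bar>w\<bar> \<Longrightarrow> overlap a b w \<le> overlap a b z"
  unfolding overlap_def by (auto simp: max_def min_def abs_real_def split: if_splits)

lemma overlap_scale: "0 < l \<Longrightarrow> overlap (l * a) (l * b) (l * z) = l * overlap a b z"
  by (simp add: overlap_def max_mult_distrib_left min_mult_distrib_left right_diff_distrib distrib_left)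

lemma continuous_on_overlap: "continuous_on UNIV (overlap a b)"
  unfolding overlap_def by (intro continuous_intros)

lemma measure_arc_Int:
  assumes r: "0 \<le> r" "r \<le> 1/2" "0 \<le> r'" "r' \<le> 1/2" and N: "\<bar>b - a\<bar> + 1 \<le> real_of_int N"
  shows "measure circle_measure (circle_arc a r \<inter> circle_arc b r') = (\<Sum>k\<in>{- N..N}. overlap r r' (b - a + of_int k))"
proof -
  let ?S = "to_circle -` (circle_arc a r \<inter> circle_arc b r')"
  let ?I = "\<lambda>k::int. {a - r<..<a + r} \<inter> {b + of_int k - r'<..<b + of_int k + r'}"
  have AB: "circle_arc a r \<inter> circle_arc b r' \<in> sets circle_measure" by (intro sets.Int arc_sets)
  then have S: "?S \<in> sets lebesgue" by (simp only: circle_sets_iff)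
  have "measure circle_measure (circle_arc a r \<inter> circle_arc b r') = mass ?S (a - 1/2) (a - 1/2 + 1)"
    unfolding measure_circle[OF AB] by (rule periodic_mass[OF S periodic_vimage, symmetric])
  also have "a - 1/2 + 1 = a + 1/2" by simp
  also have "mass ?S (a - 1/2) (a + 1/2) = measure lebesgue ({a - 1/2<..<a + 1/2} \<inter> ?S)"
    by (rule mass_open[OF S, symmetric])
  also have "{a - 1/2<..<a + 1/2} \<inter> ?S = {a - r<..<a + r} \<inter> to_circle -` circle_arc b r'"
    using arc_period[OF r(2), of a] by auto
  also have "\<dots> = (\<Union>k\<in>{- N..N}. ?I k)"
  proof (intro equalityI subsetI)
    fix x assume x: "x \<in> {a - r<..<a + r} \<inter> to_circle -` circle_arc b r'"
    then obtain k :: int where k: "\<bar>x - b - of_int k\<bar> < r'" by (auto simp: vimage_arc)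
    then have "\<bar>of_int k :: real\<bar> \<le> of_int N" using x r N by auto
    then have "k \<in> {- N..N}" by auto
    with k x show "x \<in> (\<Union>k\<in>{- N..N}. ?I k)" by (auto simp: abs_less_iff intro!: bexI[of _ k])
  next
    fix x assume "x \<in> (\<Union>k\<in>{- N..N}. ?I k)"
    then obtain k where "x \<in> ?I k" by blast
    then show "x \<in> {a - r<..<a + r} \<inter> to_circle -` circle_arc b r'"
      by (auto simp: vimage_arc abs_less_iff intro!: exI[of _ k])
  qed
  also have "measure lebesgue \<dots> = (\<Sum>k\<in>{- N..N}. measure lebesgue (?I k))"
  proof (rule measure_finite_Union)
    show "disjoint_family_on ?I {- N..N}"
    proof (unfold disjoint_family_on_def, intro ballI impI)
      fix k j :: int assume "k \<noteq> j"
      show "?I k \<inter> ?I j = {}"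
      proof (rule ccontr)
        assume "?I k \<inter> ?I j \<noteq> {}"
        then have "\<bar>of_int k - of_int j :: real\<bar> < 1" using r by auto
        then have "k = j" by linarith
        with \<open>k \<noteq> j\<close> show False by simp
      qed
    qed
    show "emeasure lebesgue (?I k) \<noteq> \<infinity>" for k
      unfolding infinity_ennreal_def by (rule fmeasurableD2) (simp add: Int_greaterThanLessThan)
  qed auto
  also have "\<dots> = (\<Sum>k\<in>{- N..N}. overlap r r' (b - a + of_int k))"
  proof (rule sum.cong)
    fix k :: int
    have "measure lebesgue (?I k) = max 0 (min (a + r) (b + of_int k + r') - max (a - r) (b + of_int k - r'))"
    proof -
      have "measure lebesgue {u<..<v} = max 0 (v - u)" for u v :: real
        by (cases "u \<le> v") auto
      then show ?thesis by (simp only: Int_greaterThanLessThan)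
    qed
    also have "min (a + r) (b + of_int k + r') - max (a - r) (b + of_int k - r')
        = min r (b - a + of_int k + r') - max (- r) (b - a + of_int k - r')"
      by (auto simp: min_def max_def)
    finally show "measure lebesgue (?I k) = overlap r r' (b - a + of_int k)"
      by (simp add: overlap_def)
  qed simp
  finally show ?thesis .
qed

lemma arc_translate: "{z. z - to_circle s \<in> circle_arc c r} = circle_arc (c + s) r"
proof (intro set_eqI)
  fix z
  obtain x where z: "z = to_circle x" by (rule to_circle_cases)
  show "z \<in> {z. z - to_circle s \<in> circle_arc c r} \<longleftrightarrow> z \<in> circle_arc (c + s) r"
    by (simp add: z vimage_arc to_circle_diff[symmetric] diff_diff_eq add.commute)
qed

lemma arc_uminus: "uminus ` circle_arc c r = circle_arc (- c) r"
proof (intro set_eqI)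
  fix z
  obtain x where z: "z = to_circle x" by (rule to_circle_cases)
  have "\<bar>- x - c - of_int k\<bar> = \<bar>x - (- c) - of_int (- k)\<bar>" for k :: int by simp
  then have "(\<exists>k::int. \<bar>- x - c - of_int k\<bar> < r) \<longleftrightarrow> (\<exists>k::int. \<bar>x - (- c) - of_int k\<bar> < r)"
    by (metis minus_minus)
  then show "z \<in> uminus ` circle_arc c r \<longleftrightarrow> z \<in> circle_arc (- c) r"
    by (simp add: z mem_uminus_image to_circle_minus[symmetric] vimage_arc)
qed

lemma corr_arc:
  assumes r: "0 \<le> r" "r \<le> 1/2" "0 \<le> r'" "r' \<le> 1/2" and N: "\<bar>c + c' + s\<bar> + 1 \<le> real_of_int N"
  shows "corr (circle_arc c r) (uminus ` circle_arc c' r') (to_circle s) = (\<Sum>k\<in>{- N..N}. overlap r' r (c + c' + s + of_int k))"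
proof -
  have "corr (circle_arc c r) (uminus ` circle_arc c' r') (to_circle s) = measure circle_measure (circle_arc (- c') r' \<inter> circle_arc (c + s) r)"
    by (simp add: corr_def arc_translate arc_uminus)
  also have "\<dots> = (\<Sum>k\<in>{- N..N}. overlap r' r (c + s - (- c') + of_int k))"
    by (rule measure_arc_Int) (use r N in \<open>auto simp: algebra_simps\<close>)
  finally show ?thesis by (simp add: algebra_simps)
qed

text \<open>Unfolded to the line, the form is a sum over integer shifts of integrals of
  \<open>overlap\<close> over the middle arc, and these are increments of the primitive
  \<open>P\<close>.\<close>

lemma trilinear_arc:
  assumes r: "0 \<le> r1" "r1 \<le> 1/2" "0 \<le> r2" "r2 \<le> 1/2" "0 \<le> r3" "r3 \<le> 1/2"
    and N: "\<bar>c1\<bar> + \<bar>c2\<bar> + \<bar>c3\<bar> + 2 \<le> real_of_int N"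
    and P: "\<And>z. (P has_real_derivative overlap r3 r1 z) (at z)"
  shows "trilinear (circle_arc c1 r1) (circle_arc c2 r2) (circle_arc c3 r3) =
    (\<Sum>k\<in>{- N..N}. P (c1 + c2 + c3 + of_int k + r2) - P (c1 + c2 + c3 + of_int k - r2))"
proof -
  let ?f = "corr (circle_arc c1 r1) (uminus ` circle_arc c3 r3)"
  \<comment> \<open>Translation by \<open>c2 - 1/2\<close> puts the middle arc at the centre of
    \<open>{0..<1}\<close>, where it is a single interval.\<close>
  let ?y = "to_circle (c2 - 1/2)"
  let ?o = "\<lambda>s. \<Sum>k\<in>{- N..N}. overlap r3 r1 (c1 + c3 + (s + (c2 - 1/2)) + of_int k)"
  have f: "?f \<in> borel_measurable circle_measure"
    by (intro corr_measurable arc_sets circle_uminus_sets)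
  have ind: "(\<lambda>y. indicator (circle_arc c2 r2) y * ?f y) \<in> borel_measurable circle_measure"
    using f arc_sets by measurable
  have shift: "to_circle s + ?y \<in> circle_arc c2 r2 \<longleftrightarrow> s \<in> {1/2 - r2<..<1/2 + r2}" if "s \<in> {0<..<1}" for s
  proof -
    have "s + (c2 - 1/2) \<in> {c2 - 1/2<..<c2 + 1/2}" using that by auto
    then have "s + (c2 - 1/2) \<in> to_circle -` circle_arc c2 r2 \<longleftrightarrow> s + (c2 - 1/2) \<in> {c2 - r2<..<c2 + r2}"
      using arc_period[OF r(4), of c2] by blast
    then show ?thesis by (auto simp: to_circle_add)
  qed
  have "trilinear (circle_arc c1 r1) (circle_arc c2 r2) (circle_arc c3 r3) = (\<integral>y. indicator (circle_arc c2 r2) y * ?f y \<partial>circle_measure)"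
    by (rule trilinear_eq) (rule arc_sets)+
  also have "\<dots> = (\<integral>y. indicator (circle_arc c2 r2) (y + ?y) * ?f (y + ?y) \<partial>circle_measure)"
    by (rule integral_circle_translate[OF ind, symmetric])
  also have "\<dots> = (LINT s:{0..<1}|lebesgue. indicator (circle_arc c2 r2) (to_circle s + ?y) * ?f (to_circle s + ?y))"
    by (rule integral_circle, rule measurable_compose[OF measurable_circle_translate ind])
  also have "\<dots> = (LINT s:{1/2 - r2<..<1/2 + r2}|lebesgue. ?o s)"
    unfolding set_lebesgue_integral_def
  proof (rule integral_cong_AE)
    \<comment> \<open>The point \<open>0\<close> is discarded because \<open>shift\<close> describes
      the arc only in the open period.\<close>
    have "AE s in lebesgue. s \<notin> {0::real}" by (rule AE_not_in) simp
    then show "AE s in lebesgue. indicator {0..<1} s *\<^sub>R (indicator (circle_arc c2 r2) (to_circle s + ?y) * ?f (to_circle s + ?y))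
        = indicator {1/2 - r2<..<1/2 + r2} s *\<^sub>R ?o s"
    proof eventually_elim
      fix s :: real assume s0: "s \<notin> {0}"
      show "indicator {0..<1} s *\<^sub>R (indicator (circle_arc c2 r2) (to_circle s + ?y) * ?f (to_circle s + ?y))
        = indicator {1/2 - r2<..<1/2 + r2} s *\<^sub>R ?o s"
      proof (cases "s \<in> {0..<1}")
        case True
        then have s: "s \<in> {0<..<1}" using s0 by auto
        have "?f (to_circle s + ?y) = ?o s"
          unfolding to_circle_add[symmetric]
          by (rule corr_arc[OF r(1,2,5,6)]) (use s N in auto)
        with True shift[OF s] show ?thesis by (simp add: indicator_def)
      next
        case False
        then have "s \<notin> {1/2 - r2<..<1/2 + r2}" using r by auto
        with False show ?thesis by simp
      qed
    qed
    have "(\<lambda>s. indicator (circle_arc c2 r2) (to_circle s + ?y) * ?f (to_circle s + ?y)) \<in> borel_measurable lebesgue"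
      by (rule measurable_compose[OF measurable_compose[OF measurable_to_circle measurable_circle_translate] ind])
    then show "(\<lambda>s. indicator {0..<1} s *\<^sub>R (indicator (circle_arc c2 r2) (to_circle s + ?y) * ?f (to_circle s + ?y)))
        \<in> borel_measurable lebesgue"
      by (intro borel_measurable_scaleR borel_measurable_indicator) simp_all
    have "continuous_on UNIV ?o"
      by (intro continuous_intros continuous_on_compose2[OF continuous_on_overlap]) auto
    then have "?o \<in> borel_measurable borel"
      by (rule borel_measurable_continuous_onI)
    then have "?o \<in> borel_measurable lebesgue"
      by (intro measurable_completion) simp
    then show "(\<lambda>s. indicator {1/2 - r2<..<1/2 + r2} s *\<^sub>R ?o s) \<in> borel_measurable lebesgue"
      by (intro borel_measurable_scaleR borel_measurable_indicator) simp_all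
  qed
  also have "\<dots> = (\<Sum>k\<in>{- N..N}. P (c1 + c2 + c3 + of_int k + r2) - P (c1 + c2 + c3 + of_int k - r2))"
  proof -
    have "continuous_on {1/2 - r2..1/2 + r2} ?o"
      by (intro continuous_intros continuous_on_compose2[OF continuous_on_overlap]) auto
    then have oi: "?o absolutely_integrable_on {1/2 - r2..1/2 + r2}"
      by (rule absolutely_integrable_continuous_real)
    have "(LINT s:{1/2 - r2<..<1/2 + r2}|lebesgue. ?o s) = integral {1/2 - r2<..<1/2 + r2} ?o"
      by (rule set_lebesgue_integral_eq_integral(2), rule set_integrable_subset[OF oi]) auto
    also have "\<dots> = integral {1/2 - r2..1/2 + r2} ?o"
      by (rule integral_open_interval_real[symmetric])
    finally have L: "(LINT s:{1/2 - r2<..<1/2 + r2}|lebesgue. ?o s) = integral {1/2 - r2..1/2 + r2} ?o" .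
    have "((\<lambda>s. overlap r3 r1 (c1 + c3 + (s + (c2 - 1/2)) + of_int k)) has_integral
        (P (c1 + c3 + ((1/2 + r2) + (c2 - 1/2)) + of_int k) - P (c1 + c3 + ((1/2 - r2) + (c2 - 1/2)) + of_int k)))
        {1/2 - r2..1/2 + r2}" for k :: int
    proof (rule fundamental_theorem_of_calculus)
      fix s
      have "((\<lambda>s. P (c1 + c3 + (s + (c2 - 1/2)) + of_int k)) has_real_derivative
          overlap r3 r1 (c1 + c3 + (s + (c2 - 1/2)) + of_int k) * 1) (at s within {1/2 - r2..1/2 + r2})"
        by (rule DERIV_chain2[OF P]) (auto intro!: derivative_eq_intros)
      then show "((\<lambda>s. P (c1 + c3 + (s + (c2 - 1/2)) + of_int k)) has_vector_derivative
          overlap r3 r1 (c1 + c3 + (s + (c2 - 1/2)) + of_int k)) (at s within {1/2 - r2..1/2 + r2})"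
        by (simp add: has_real_derivative_iff_has_vector_derivative)
    qed (use r in simp)
    then have "(?o has_integral (\<Sum>k\<in>{- N..N}. P (c1 + c3 + ((1/2 + r2) + (c2 - 1/2)) + of_int k)
        - P (c1 + c3 + ((1/2 - r2) + (c2 - 1/2)) + of_int k))) {1/2 - r2..1/2 + r2}"
      by (intro has_integral_sum) auto
    then have "integral {1/2 - r2..1/2 + r2} ?o = (\<Sum>k\<in>{- N..N}. P (c1 + c3 + ((1/2 + r2) + (c2 - 1/2)) + of_int k)
        - P (c1 + c3 + ((1/2 - r2) + (c2 - 1/2)) + of_int k))"
      by (rule integral_unique)
    also have "\<dots> = (\<Sum>k\<in>{- N..N}. P (c1 + c2 + c3 + of_int k + r2) - P (c1 + c2 + c3 + of_int k - r2))"
      by (intro sum.cong refl arg_cong2[of _ _ _ _ "(-)"] arg_cong[of _ _ P]) (simp_all add: algebra_simps)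
    finally show ?thesis using L by (rule trans[rotated])
  qed
  finally show ?thesis .
qed

text \<open>In the variable \<open>d = c1 + c2 + c3\<close>, scaling all radii by \<open>l\<close> amounts to the factor \<open>l\<^sup>2\<close> and to
  replacing \<open>d\<close> by \<open>d / l\<close>, where the symmetric decreasing overlap integral is larger.\<close>

lemma trilinear_arc_scale:
  assumes r: "0 < r1" "0 < r2" "0 < r3" and l: "1 \<le> l"
    and lr: "l * r1 \<le> 1/2" "l * r2 \<le> 1/2" "l * r3 \<le> 1/2"
  shows "l\<^sup>2 * trilinear (circle_arc c1 r1) (circle_arc c2 r2) (circle_arc c3 r3)
    \<le> trilinear (circle_arc c1 (l * r1)) (circle_arc c2 (l * r2)) (circle_arc c3 (l * r3))"
proof -
  have "r \<le> l * r" if "0 < r" for r using that l by simp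
  then have r2: "r1 \<le> 1/2" "r2 \<le> 1/2" "r3 \<le> 1/2" using r lr by (meson order_trans)+
  have "isCont (overlap r3 r1) x" for x
    using continuous_on_overlap by (simp add: continuous_on_eq_continuous_at)
  then obtain P where "\<And>x. (P has_vector_derivative overlap r3 r1 x) (at x)"
    using einterval_antiderivative[of "-\<infinity>" "\<infinity>" "overlap r3 r1"] by auto
  then have P: "(P has_real_derivative overlap r3 r1 z) (at z)" for z
    by (simp add: has_real_derivative_iff_has_vector_derivative)
  \<comment> \<open>By the scaling of \<open>overlap\<close> this is a primitive for the scaled
    radii, so \<open>trilinear_arc\<close> evaluates both forms through \<open>P\<close>.\<close>
  define R where "R z = l\<^sup>2 * P (z / l)" for z
  have R: "(R has_real_derivative overlap (l * r3) (l * r1) z) (at z)" for z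
  proof -
    have "(R has_real_derivative l\<^sup>2 * (overlap r3 r1 (z / l) * (1 / l))) (at z)"
      unfolding R_def by (intro DERIV_cmult DERIV_chain2[OF P] DERIV_cdivide DERIV_ident)
    also have "l\<^sup>2 * (overlap r3 r1 (z / l) * (1 / l)) = l * overlap r3 r1 (z / l)"
      using l by (simp add: power2_eq_square)
    also have "\<dots> = overlap (l * r3) (l * r1) z"
      using l overlap_scale[of l r3 r1 "z / l"] by simp
    finally show ?thesis .
  qed
  define Q where "Q d = P (d + r2) - P (d - r2)" for d
  have Q: "(Q has_real_derivative overlap r3 r1 (d + r2) * 1 - overlap r3 r1 (d - r2) * 1) (at d)" for d
    unfolding Q_def by (intro DERIV_diff DERIV_chain2[OF P]) (auto intro!: derivative_eq_intros)
  \<comment> \<open>The derivative of \<open>Q\<close> at \<open>d\<close> compares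
    \<open>overlap\<close> at \<open>d + r2\<close> and at \<open>d - r2\<close>, so it is
    nonpositive for \<open>d >= 0\<close> and nonnegative for \<open>d <= 0\<close>:
    \<open>Q\<close> does not decrease towards \<open>0\<close>.\<close>
  have Qmono: "Q d \<le> Q (d / l)" for d
  proof (cases "0 \<le> d")
    case True
    have "d / l \<le> d" "0 \<le> d / l" using True l by (auto simp: divide_le_eq mult_le_cancel_left1)
    moreover have "overlap r3 r1 (x + r2) * 1 - overlap r3 r1 (x - r2) * 1 \<le> 0" if "0 \<le> x" for x
      using overlap_antimono[of r3 r1 "x - r2" "x + r2"] r that by simp
    ultimately show ?thesis
      by (intro DERIV_nonpos_imp_nonincreasing[of "d / l" d Q]) (use Q in \<open>meson order_trans\<close>)+
  next
    case False
    have "d \<le> d / l" "d / l \<le> 0" using False l by (auto simp: divide_le_eq le_divide_eq mult_le_cancel_left2 mult_le_cancel_left1)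
    moreover have "0 \<le> overlap r3 r1 (x + r2) * 1 - overlap r3 r1 (x - r2) * 1" if "x \<le> 0" for x
      using overlap_antimono[of r3 r1 "x + r2" "x - r2"] r that by simp
    ultimately show ?thesis
      by (intro DERIV_nonneg_imp_nondecreasing[of d "d / l" Q]) (use Q in \<open>meson order_trans\<close>)+
  qed
  \<comment> \<open>\<open>N\<close> depends on the centres alone, so the sums for both sets of
    radii have the same range and can be compared term by term.\<close>
  define N where "N = \<lceil>\<bar>c1\<bar> + \<bar>c2\<bar> + \<bar>c3\<bar> + 2\<rceil>"
  have N: "\<bar>c1\<bar> + \<bar>c2\<bar> + \<bar>c3\<bar> + 2 \<le> real_of_int N" by (simp add: N_def)
  define d where "d k = c1 + c2 + c3 + of_int k" for k :: int
  have "l\<^sup>2 * trilinear (circle_arc c1 r1) (circle_arc c2 r2) (circle_arc c3 r3) = (\<Sum>k\<in>{- N..N}. l\<^sup>2 * Q (d k))"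
    using trilinear_arc[OF _ r2(1) _ r2(2) _ r2(3) N P] r by (simp add: Q_def d_def sum_distrib_left)
  also have "\<dots> \<le> (\<Sum>k\<in>{- N..N}. l\<^sup>2 * Q (d k / l))"
    by (intro sum_mono mult_left_mono Qmono) simp
  also have "\<dots> = (\<Sum>k\<in>{- N..N}. R (d k + l * r2) - R (d k - l * r2))"
    using l by (intro sum.cong refl) (simp add: Q_def R_def add_divide_distrib diff_divide_distrib right_diff_distrib)
  also have "\<dots> = trilinear (circle_arc c1 (l * r1)) (circle_arc c2 (l * r2)) (circle_arc c3 (l * r3))"
    using trilinear_arc[OF _ lr(1) _ lr(2) _ lr(3) N R] r l by (simp add: d_def)
  finally show ?thesis .
qed

lemma trilinear_arcs:
  assumes A: "config A" "config B" "config C" and sep: "separated l A" "separated l B" "separated l C"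
    and l: "0 < l"
  shows "trilinear (arcs l A) (arcs l B) (arcs l C) = (\<Sum>p\<in>A. \<Sum>q\<in>B. \<Sum>s\<in>C.
    trilinear (circle_arc (fst p) (l * snd p)) (circle_arc (fst q) (l * snd q)) (circle_arc (fst s) (l * snd s)))"
  unfolding arcs_def using A sep
  by (intro trilinear_UN separated_disjoint arc_sets) (auto simp: config_def)

section \<open>Monotonicity along the flow\<close>

text \<open>With the factor \<open>l\<close> absorbed into the radii, the evolved arcs can serve as
  initial configuration for the remaining time.\<close>

lemma rescale_config:
  assumes A: "config A" "separated l A" and l: "0 < l" "\<And>p. p \<in> A \<Longrightarrow> l * snd p \<le> 1/2"
  obtains B where "config B" "separated 1 B" "arcs 1 B = arcs l A" "card B \<le> card A"
proof -
  define B where "B = (\<lambda>p. (fst p, l * snd p)) ` A"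
  show ?thesis
  proof (rule that)
    show "config B" using A l by (auto simp: config_def B_def)
    show "arcs 1 B = arcs l A" by (simp add: arcs_def B_def)
    show "card B \<le> card A" using A(1) unfolding B_def config_def by (intro card_image_le) simp
    show "separated 1 B"
      unfolding separated_def
    proof (intro ballI impI)
      fix u v assume "u \<in> B" "v \<in> B" "u \<noteq> v"
      then obtain p q where "p \<in> A" "q \<in> A" "u = (fst p, l * snd p)" "v = (fst q, l * snd q)" "p \<noteq> q"
        unfolding B_def by blast
      then show "1 * (snd u + snd v) \<le> circle_norm (to_circle (fst u - fst v))"
        using A(2) by (auto simp: separated_def distrib_left)
    qed
  qed
qed

section \<open>Approximation by finite unions of arcs\<close>

lemma open_approx_intervals:
  fixes V :: "real set"
  assumes V: "open V" "V \<subseteq> {0<..<1}" "V \<noteq> {}" and e: "0 < e"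
  obtains C where "finite C" "C \<subseteq> components V" "measure lebesgue (V - \<Union>C) < e"
proof -
  have bV: "bounded V" using V(2) by (rule bounded_subset[rotated]) simp
  have oc: "open c" if "c \<in> components V" for c using open_components[OF V(1) that] .
  have cc: "countable (components V)"
    using oc components_nonoverlap[of _ V]
    by (intro countable_disjoint_open_subsets) (auto simp: pairwise_def disjnt_def)
  define f where "f = from_nat_into (components V)"
  have f: "range f = components V"
    unfolding f_def using V(3) cc by (intro range_from_nat_into) simp_all
  define B where "B n = (\<Union>i<n. f i)" for n
  have lm: "V \<in> lmeasurable" using V(1) bV by (intro lmeasurable_open)
  have Bs: "B n \<in> sets lebesgue" for n
  proof -
    have "open (B n)" unfolding B_def using f oc by (intro open_UN) auto
    then show ?thesis by (metis borel_open sets_completionI_sets sets_lborel)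
  qed
  have UB: "(\<Union>n. B n) = V"
  proof -
    have "(\<Union>n. B n) = \<Union>(range f)" unfolding B_def by blast
    then show ?thesis by (simp add: f Union_components)
  qed
  have "(\<lambda>n. measure lebesgue (B n)) \<longlonglongrightarrow> measure lebesgue (\<Union>n. B n)"
  proof (rule Lim_measure_incseq)
    show "range B \<subseteq> sets lebesgue" using Bs by blast
    show "incseq B" unfolding B_def incseq_def by (auto intro: less_le_trans)
    show "emeasure lebesgue (\<Union>i. B i) \<noteq> \<infinity>"
      unfolding UB infinity_ennreal_def using lm by (rule fmeasurableD2)
  qed
  then have "eventually (\<lambda>n. measure lebesgue V - e < measure lebesgue (B n)) sequentially"
    unfolding UB using e by (intro order_tendstoD) auto
  then obtain n where n: "measure lebesgue V - e < measure lebesgue (B n)"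
    by (auto simp: eventually_sequentially)
  show ?thesis
  proof (rule that[of "f ` {..<n}"])
    have "measure lebesgue (V - B n) = measure lebesgue V - measure lebesgue (B n)"
      using lm Bs[of n] UB by (intro measurable_measure_Diff) auto
    with n show "measure lebesgue (V - \<Union>(f ` {..<n})) < e" by (simp add: B_def)
  qed (use f in auto)
qed

lemma arcs_of_intervals:
  assumes C: "finite C" "C \<subseteq> components V" and V: "open V" "V \<subseteq> {0<..<1}"
  obtains A where "config A" "separated 1 A" "arcs 1 A = to_circle ` \<Union>C"
proof -
  have bV: "bounded V" using V(2) by (rule bounded_subset[rotated]) simp
  have C_int: "\<exists>a b. a < b \<and> 0 \<le> a \<and> b \<le> 1 \<and> c = {a<..<b}" if c: "c \<in> C" for c
  proof -
    have cV: "c \<in> components V" using c C(2) by blast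
    then obtain a b where ab: "a < b" "c = {a<..<b}" using real_component_interval[OF V(1) bV] by metis
    then have "{a<..<b} \<subseteq> {0<..<1}" using in_components_subset[OF cV] V(2) by blast
    with ab show ?thesis by (auto simp: greaterThanLessThan_subseteq_greaterThanLessThan)
  qed
  define F where "F c = ((Inf c + Sup c) / 2, (Sup c - Inf c) / 2)" for c :: "real set"
  have F: "F {a<..<b} = ((a + b) / 2, (b - a) / 2)" if "a < b" for a b
    using that by (simp add: F_def)
  define A where "A = F ` C"
  show ?thesis
  proof (rule that)
    show "config A"
      using C(1) C_int F unfolding config_def A_def by fastforce
    show "separated 1 A"
      unfolding separated_def
    proof (intro ballI impI)
      fix u v assume uv: "u \<in> A" "v \<in> A" "u \<noteq> v"
      then obtain c c' where c: "c \<in> C" "c' \<in> C" "c \<noteq> c'" "u = F c" "v = F c'" by (auto simp: A_def)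
      obtain a b where ab: "a < b" "0 \<le> a" "b \<le> 1" "c = {a<..<b}" using C_int[OF c(1)] by blast
      obtain a' b' where ab': "a' < b'" "0 \<le> a'" "b' \<le> 1" "c' = {a'<..<b'}" using C_int[OF c(2)] by blast
      have "c \<inter> c' = {}" using c(1-3) C(2) components_nonoverlap by blast
      then have dis: "b \<le> a' \<or> b' \<le> a"
      proof (rule_tac ccontr)
        assume "\<not> (b \<le> a' \<or> b' \<le> a)"
        then have "max a a' < min b b'" using ab(1) ab'(1) by auto
        then obtain x where "max a a' < x" "x < min b b'" using dense by blast
        then have "x \<in> c \<inter> c'" using ab(4) ab'(4) by auto
        with \<open>c \<inter> c' = {}\<close> show False by blast
      qed
      \<comment> \<open>For \<open>k = 0\<close> the two intervals are disjoint; for other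
        \<open>k\<close> they lie in \<open>{0..1}\<close> and in a translate of it that shares at
        most an endpoint with it.\<close>
      have "(b - a) / 2 + (b' - a') / 2 \<le> \<bar>(a + b) / 2 - (a' + b') / 2 - of_int k\<bar>" for k :: int
      proof -
        consider "k = 0" | "k \<ge> 1" | "k \<le> -1" by linarith
        then show ?thesis
        proof cases
          case 1
          then show ?thesis using dis ab ab' by (auto simp: abs_real_def field_simps)
        next
          case 2
          then have "1 \<le> (of_int k :: real)" by simp
          then show ?thesis using ab ab' by (auto simp: abs_real_def field_simps)
        next
          case 3
          then have "of_int k \<le> (-1 :: real)" by simp
          then show ?thesis using ab ab' by (auto simp: abs_real_def field_simps)
        qed
      qed
      then show "1 * (snd u + snd v) \<le> circle_norm (to_circle (fst u - fst v))"
        using c ab ab' F by (simp add: le_circle_norm_iff)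
    qed
    have "circle_arc (fst (F c)) (1 * snd (F c)) = to_circle ` c" if "c \<in> C" for c
    proof -
      obtain a b where ab: "a < b" "c = {a<..<b}" using C_int[OF \<open>c \<in> C\<close>] by blast
      have "(a + b) / 2 - (b - a) / 2 = a" "(a + b) / 2 + (b - a) / 2 = b" by (simp_all add: field_simps)
      then show ?thesis using ab F by (simp add: circle_arc_def)
    qed
    then show "arcs 1 A = to_circle ` \<Union>C" by (auto simp: arcs_def A_def)
  qed
qed

lemma sym_diff_triangle:
  assumes "A \<in> sets circle_measure" "B \<in> sets circle_measure" "C \<in> sets circle_measure"
  shows "measure circle_measure (sym_diff A C) \<le> measure circle_measure (sym_diff A B) + measure circle_measure (sym_diff B C)"
proof -
  have "measure circle_measure (sym_diff A C) \<le> measure circle_measure (sym_diff A B \<union> sym_diff B C)"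
    using assms by (intro circle.finite_measure_mono) auto
  also have "\<dots> \<le> measure circle_measure (sym_diff A B) + measure circle_measure (sym_diff B C)"
    using assms by (intro measure_Un_le) auto
  finally show ?thesis .
qed

text \<open>An open set around \<open>E\<close> is cut down to finitely many components. The result
  may still be larger than \<open>E\<close>, so the radii are finally shrunk: the bound on the
  measure is what keeps times up to \<open>max_time E\<close> admissible.\<close>

lemma approx_arcs:
  assumes E: "E \<in> L_sets" and e: "0 < e"
  obtains A where "config A" "separated 1 A" "arcs 1 A \<in> L_sets"
    "measure circle_measure (arcs 1 A) \<le> measure circle_measure E"
    "measure circle_measure (sym_diff (arcs 1 A) E) \<le> e"
proof -
  define m where "m = measure circle_measure E"
  have Es: "E \<in> sets circle_measure" and m: "0 < m" using E by (auto simp: L_sets_def m_def)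
  \<comment> \<open>Approximation costs \<open>2 * d\<close> and shrinking another
    \<open>2 * d\<close>, together at most \<open>e\<close>; \<open>4 * d <= m\<close> keeps the
    measure \<open>M\<close> of the arcs positive.\<close>
  define d where "d = min (e / 4) (m / 4)"
  have d: "0 < d" "4 * d \<le> e" "4 * d \<le> m" using e m by (auto simp: d_def)
  have lE: "to_circle -` E \<in> sets lebesgue" using Es by (simp add: circle_sets_iff)
  define S where "S = {0<..<1} \<inter> to_circle -` E"
  have S: "S \<in> lmeasurable"
    unfolding S_def using lE by (intro bounded_set_imp_lmeasurable) (auto simp: bounded_Int)
  have mS: "measure lebesgue S = m"
    unfolding S_def m_def measure_circle[OF Es] by (rule mass_open[OF lE])
  obtain W where W: "open W" "S \<subseteq> W" "W - S \<in> lmeasurable" "emeasure lebesgue (W - S) < ennreal d"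
    using sets_lebesgue_outer_open[OF fmeasurableD[OF S] d(1)] .
  define V where "V = W \<inter> {0<..<1}"
  have V: "open V" "V \<subseteq> {0<..<1}" "S \<subseteq> V" using W by (auto simp: V_def S_def)
  have lV: "V \<in> lmeasurable" using V by (intro lmeasurable_open bounded_subset[OF _ V(2)]) auto
  have "V \<noteq> {}" using V(3) mS m by auto
  have VS: "measure lebesgue (V - S) < d"
  proof -
    have "measure lebesgue (V - S) \<le> measure lebesgue (W - S)"
      by (rule measure_mono_fmeasurable) (use W lV S in \<open>auto simp: V_def\<close>)
    also have "\<dots> < d" using W(3,4) d(1) by (simp add: emeasure_eq_measure2 ennreal_less_iff)
    finally show ?thesis .
  qed
  obtain C where C: "finite C" "C \<subseteq> components V" "measure lebesgue (V - \<Union>C) < d"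
    using open_approx_intervals[OF V(1,2) \<open>V \<noteq> {}\<close> d(1)] .
  obtain A where A: "config A" "separated 1 A" "arcs 1 A = to_circle ` \<Union>C"
    using arcs_of_intervals[OF C(1,2) V(1,2)] .
  have fA: "finite A" using A by (simp add: config_def)
  have CV: "\<Union>C \<subseteq> V" using C(2) Union_components[of V] by blast
  have As: "arcs l A \<in> sets circle_measure" for l by (rule arcs_sets[OF fA])
  have D: "measure circle_measure (sym_diff (arcs 1 A) E) \<le> 2 * d"
  proof -
    have Ds: "sym_diff (arcs 1 A) E \<in> sets circle_measure" using As Es by auto
    then have lD: "to_circle -` sym_diff (arcs 1 A) E \<in> sets lebesgue" by (simp only: circle_sets_iff)
    have "{0<..<1} \<inter> to_circle -` sym_diff (arcs 1 A) E \<subseteq> (V - S) \<union> (V - \<Union>C)"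
    proof
      fix x assume x: "x \<in> {0<..<1} \<inter> to_circle -` sym_diff (arcs 1 A) E"
      have "to_circle x \<in> arcs 1 A \<longleftrightarrow> x \<in> \<Union>C"
      proof
        assume "to_circle x \<in> arcs 1 A"
        then obtain y where "y \<in> \<Union>C" "to_circle x = to_circle y" unfolding A(3) by (rule imageE)
        then have y: "y \<in> \<Union>C" "x - y \<in> \<int>" by (simp_all only: to_circle_eq_iff)
        then have "y \<in> {0<..<1}" using CV V(2) by blast
        moreover obtain k where "x - y = of_int k" using y(2) by (auto elim: Ints_cases)
        ultimately have "\<bar>of_int k :: real\<bar> < 1" using x by auto
        then have "k = 0" by linarith
        with \<open>x - y = of_int k\<close> y show "x \<in> \<Union>C" by simp
      qed (auto simp: A(3))
      then show "x \<in> (V - S) \<union> (V - \<Union>C)" using x CV V(3) by (auto simp: S_def)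
    qed
    then have "measure lebesgue ({0<..<1} \<inter> to_circle -` sym_diff (arcs 1 A) E) \<le> measure lebesgue ((V - S) \<union> (V - \<Union>C))"
    proof (rule measure_mono_fmeasurable)
      have "open (\<Union>C)" using C(2) open_components[OF V(1)] by (intro open_Union) auto
      then have "\<Union>C \<in> sets lebesgue" by (metis borel_open sets_completionI_sets sets_lborel)
      then show "(V - S) \<union> (V - \<Union>C) \<in> lmeasurable" using lV S by (intro fmeasurable.Un fmeasurable.Diff fmeasurable_Diff) auto
      show "{0<..<1} \<inter> to_circle -` sym_diff (arcs 1 A) E \<in> sets lebesgue"
        using lD by (intro sets.Int) auto
    qed
    also have "\<dots> \<le> measure lebesgue (V - S) + measure lebesgue (V - \<Union>C)"
    proof (rule measure_Un_le)
      have "open (\<Union>C)" using C(2) open_components[OF V(1)] by (intro open_Union) auto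
      then have "\<Union>C \<in> sets lebesgue" by (metis borel_open sets_completionI_sets sets_lborel)
      then show "V - S \<in> sets lebesgue" "V - \<Union>C \<in> sets lebesgue" using lV S by auto
    qed
    finally show ?thesis
      using VS C(3) mass_open[OF lD, of 0 1] measure_circle[OF Ds] by simp
  qed
  define M where "M = measure circle_measure (arcs 1 A)"
  have M: "\<bar>M - m\<bar> \<le> 2 * d"
    using measure_diff_le[OF As Es, of 1] D by (simp add: M_def m_def)
  then have "0 < M" using d m by linarith
  define l where "l = min 1 (m / M)"
  have l: "0 < l" "l \<le> 1" "l * M \<le> m" "M - l * M \<le> 2 * d"
    using \<open>0 < M\<close> m M d(1) by (auto simp: l_def min_def field_simps)
  have rad: "l * snd p \<le> 1/2" "0 < snd p" if "p \<in> A" for p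
  proof -
    have p: "0 < snd p" "snd p \<le> 1/2" using A(1) that by (auto simp: config_def)
    then have "l * snd p \<le> 1 * snd p" using l(2) by (intro mult_right_mono) auto
    then show "l * snd p \<le> 1/2" using p by linarith
    show "0 < snd p" by (rule p)
  qed
  have sl: "separated l A" using separated_mono[OF A(2,1) l(2)] .
  have Ml: "measure circle_measure (arcs l A) = l * M"
    using measure_arcs[OF A(1) sl _ rad(1)] measure_arcs[OF A(1,2)] A(1) l(1) by (simp add: M_def config_def)
  obtain B where B: "config B" "separated 1 B" "arcs 1 B = arcs l A"
    using rescale_config[OF A(1) sl l(1) rad(1)] by metis
  have sub: "arcs l A \<subseteq> arcs 1 A"
  proof -
    have "circle_arc (fst p) (l * snd p) \<subseteq> circle_arc (fst p) (1 * snd p)" if "p \<in> A" for p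
    proof -
      have "l * snd p \<le> 1 * snd p" using l(2) rad(2)[OF that] by (intro mult_right_mono) auto
      then have "fst p - 1 * snd p \<le> fst p - l * snd p" "fst p + l * snd p \<le> fst p + 1 * snd p" by linarith+
      then show ?thesis
        unfolding circle_arc_def by (intro image_mono) (simp only: greaterThanLessThan_subseteq_greaterThanLessThan, blast)
    qed
    then show ?thesis unfolding arcs_def by blast
  qed
  show ?thesis
  proof (rule that[OF B(1,2)])
    show "arcs 1 B \<in> L_sets" using B(3) Ml As l(1) \<open>0 < M\<close> by (simp add: L_sets_def)
    show "measure circle_measure (arcs 1 B) \<le> measure circle_measure E"
      using B(3) Ml l(3) by (simp add: m_def)
    have "sym_diff (arcs l A) (arcs 1 A) = arcs 1 A - arcs l A" using sub by blast
    then have "measure circle_measure (sym_diff (arcs l A) (arcs 1 A)) = M - l * M"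
      using circle.finite_measure_Diff[OF As As sub] Ml by (simp add: M_def)
    then show "measure circle_measure (sym_diff (arcs 1 B) E) \<le> e"
      using sym_diff_triangle[OF As As Es, of l 1] D l(4) d(2) B(3) by simp
  qed
qed

text \<open>Without collisions each set is a disjoint union of arcs at both times, so
  \<open>trilinear_arc_scale\<close> can be summed over all triples of arcs.\<close>

lemma trilinear_flow_separated:
  assumes A: "\<And>j. j < 3 \<Longrightarrow> config (A j)" "\<And>j. j < 3 \<Longrightarrow> separated 1 (A j)"
      "\<And>j. j < 3 \<Longrightarrow> E j \<doteq> arcs 1 (A j)" "\<And>j. j < (3::nat) \<Longrightarrow> E j \<in> L_sets"
    and t: "0 \<le> t" "\<And>j. j < 3 \<Longrightarrow> t \<le> max_time (E j)" and sep: "\<And>j. j < 3 \<Longrightarrow> separated (exp t) (A j)"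
  shows "exp (2 * t) * trilinear (E 0) (E 1) (E 2) \<le> trilinear (flow t (E 0)) (flow t (E 1)) (flow t (E 2))"
proof -
  have Es: "E j \<in> sets circle_measure" if "j < 3" for j using A(4)[OF that] by (simp add: L_sets_def)
  have fl: "flow t (E j) \<doteq> arcs (exp t) (A j)" if "j < 3" for j
    by (rule flow_arcs[OF A(1,2,3,4)[OF that] t(1) t(2)[OF that] sep[OF that]])
  have rad: "exp t * snd p \<le> 1/2" "0 < snd p" if "j < 3" "p \<in> A j" for j p
    using radius_bound(2)[OF A(1,2,3,4)[OF that(1)] t(2)[OF that(1)] that(2)] A(1)[OF that(1)] that(2)
    by (auto simp: config_def)
  have "exp (2 * t) * trilinear (E 0) (E 1) (E 2) = (exp t)\<^sup>2 * trilinear (arcs 1 (A 0)) (arcs 1 (A 1)) (arcs 1 (A 2))"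
    using trilinear_cong[OF Es Es Es A(3) A(3) A(3), of 0 1 2] by (simp add: exp_double)
  also have "\<dots> = (\<Sum>p\<in>A 0. \<Sum>q\<in>A 1. \<Sum>s\<in>A 2. (exp t)\<^sup>2 * trilinear (circle_arc (fst p) (snd p)) (circle_arc (fst q) (snd q)) (circle_arc (fst s) (snd s)))"
    using trilinear_arcs[OF A(1) A(1) A(1) A(2) A(2) A(2), of 0 1 2] by (simp add: sum_distrib_left)
  also have "\<dots> \<le> (\<Sum>p\<in>A 0. \<Sum>q\<in>A 1. \<Sum>s\<in>A 2. trilinear (circle_arc (fst p) (exp t * snd p)) (circle_arc (fst q) (exp t * snd q)) (circle_arc (fst s) (exp t * snd s)))"
    by (intro sum_mono trilinear_arc_scale) (use rad[of 0] rad[of 1] rad[of 2] t(1) in auto)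
  also have "\<dots> = trilinear (arcs (exp t) (A 0)) (arcs (exp t) (A 1)) (arcs (exp t) (A 2))"
    using trilinear_arcs[OF A(1) A(1) A(1) sep sep sep, of 0 1 2] by simp
  also have "\<dots> = trilinear (flow t (E 0)) (flow t (E 1)) (flow t (E 2))"
    using trilinear_cong[OF flow_sets[OF Es] flow_sets[OF Es] flow_sets[OF Es] fl fl fl, of 0 1 2] by simp
  finally show ?thesis .
qed

text \<open>Induction on the number of arcs: up to the first collision the arcs are merely scaled, and there
  at least two of them merge.\<close>

lemma trilinear_flow_arcs:
  assumes "\<And>j. j < 3 \<Longrightarrow> config (A j)" "\<And>j. j < 3 \<Longrightarrow> separated 1 (A j)"
      "\<And>j. j < 3 \<Longrightarrow> E j \<doteq> arcs 1 (A j)" "\<And>j. j < (3::nat) \<Longrightarrow> E j \<in> L_sets"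
    and "0 \<le> t" "\<And>j. j < 3 \<Longrightarrow> t \<le> max_time (E j)"
  shows "exp (2 * t) * trilinear (E 0) (E 1) (E 2) \<le> trilinear (flow t (E 0)) (flow t (E 1)) (flow t (E 2))"
  using assms
proof (induction "\<Sum>j<3. card (A j)" arbitrary: A E t rule: less_induct)
  case less
  note A = less.prems(1-4) and t = less.prems(5,6)
  show ?case
  proof (cases "\<forall>j<3. separated (exp t) (A j)")
    case True
    then show ?thesis by (intro trilinear_flow_separated[OF A t]) auto
  next
    case False
    \<comment> \<open>All pairs of distinct arcs of the same set; \<open>f\<close> is the scale at
      which such a pair touches, so the minimum \<open>l\<close> of \<open>f\<close> is the scale of
      the first collision.\<close>
    define X where "X = (SIGMA j:{..<3}. {z \<in> A j \<times> A j. fst z \<noteq> snd z})"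
    define f :: "nat \<times> (real \<times> real) \<times> (real \<times> real) \<Rightarrow> real"
      where "f x = circle_norm (to_circle (fst (fst (snd x)) - fst (snd (snd x)))) / (snd (fst (snd x)) + snd (snd (snd x)))" for x
    have fX: "finite X"
      unfolding X_def using A(1) by (intro finite_SigmaI) (auto simp: config_def)
    have sepX: "(\<forall>j<3. separated l (A j)) \<longleftrightarrow> (\<forall>x\<in>X. l \<le> f x)" for l
    proof -
      have "l * (snd p + snd q) \<le> circle_norm (to_circle (fst p - fst q)) \<longleftrightarrow> l \<le> f (j, p, q)"
        if "j < 3" "p \<in> A j" "q \<in> A j" for j p q
      proof -
        have "0 < snd p + snd q" using A(1)[OF that(1)] that by (auto simp: config_def intro: add_pos_pos)
        then show ?thesis by (simp add: f_def pos_le_divide_eq)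
      qed
      note eq = this
      show ?thesis
      proof
        assume sep: "\<forall>j<3. separated l (A j)"
        show "\<forall>x\<in>X. l \<le> f x"
        proof
          fix x assume "x \<in> X"
          then obtain j p q where "x = (j, p, q)" "j < 3" "p \<in> A j" "q \<in> A j" "p \<noteq> q"
            unfolding X_def by force
          with sep eq[of j p q] show "l \<le> f x" unfolding separated_def by blast
        qed
      next
        assume le: "\<forall>x\<in>X. l \<le> f x"
        show "\<forall>j<3. separated l (A j)"
          unfolding separated_def
        proof (intro allI ballI impI)
          fix j p q assume "j < 3" "p \<in> A j" "q \<in> A j" "p \<noteq> q"
          moreover from this have "(j, p, q) \<in> X" by (simp add: X_def)
          ultimately show "l * (snd p + snd q) \<le> circle_norm (to_circle (fst p - fst q))"
            using le eq[of j p q] by blast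
        qed
      qed
    qed
    have "X \<noteq> {}" using False sepX by fastforce
    define l where "l = Min (f ` X)"
    have lX: "\<forall>x\<in>X. l \<le> f x" using fX by (auto simp: l_def)
    have "l \<in> f ` X" unfolding l_def using fX \<open>X \<noteq> {}\<close> by (intro Min_in) auto
    then obtain j0 p q where x0: "(j0, p, q) \<in> X" "f (j0, p, q) = l" by auto
    then have j0: "j0 < 3" "p \<in> A j0" "q \<in> A j0" "p \<noteq> q" by (auto simp: X_def)
    have "0 < snd p + snd q" using A(1)[OF j0(1)] j0 by (auto simp: config_def intro: add_pos_pos)
    then have touch: "l * (snd p + snd q) = circle_norm (to_circle (fst p - fst q))"
      using x0(2) by (simp add: f_def field_simps)
    have l1: "1 \<le> l" using sepX[of 1] A(2) x0 by auto
    have lt: "l < exp t"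
    proof (rule ccontr)
      assume "\<not> l < exp t"
      then have "\<forall>x\<in>X. exp t \<le> f x" using lX by fastforce
      with sepX False show False by blast
    qed
    define s where "s = ln l"
    have s: "0 \<le> s" "exp s = l" using l1 by (simp_all add: s_def)
    then have "exp s < exp t" using lt by simp
    then have st: "s \<le> t" by simp
    note s = s(1) st s(2)
    have sT: "s \<le> max_time (E j)" if "j < 3" for j using t(2)[OF that] s(2) by simp
    have sepl: "separated l (A j)" if "j < 3" for j using sepX[of l] lX that by blast
    have flj: "flow s (E j) \<doteq> arcs l (A j)" if "j < 3" for j
      using flow_arcs[OF A(1,2,3,4)[OF that] s(1) sT[OF that]] sepl[OF that] s(3) by simp
    \<comment> \<open>The set with the touching pair loses at least one arc by merging, and the
      other two sets are merely rescaled. Further pairs touching at the same scale are left to the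
      induction, where the next collision may occur at scale \<open>1\<close>.\<close>
    have "\<exists>B. config B \<and> separated 1 B \<and> flow s (E j) \<doteq> arcs 1 B \<and> card B \<le> card (A j) \<and> (j = j0 \<longrightarrow> card B < card (A j))"
      if j: "j < 3" for j
    proof (cases "j = j0")
      case True
      have "l * (\<Sum>p\<in>A j. 2 * snd p) \<le> 1"
        using radius_bound(1)[OF A(1,2,3,4)[OF j] sT[OF j]] s(3) by simp
      then obtain B where "config B" "separated 1 B" "card B < card (A j)" "arcs l (A j) \<doteq> arcs 1 B"
        using merge_arcs[OF A(1)[OF j] sepl[OF j], of p q] j0 touch l1 True by (metis less_le_trans zero_less_one)
      then show ?thesis using flj[OF j] null_eq_trans by (meson less_imp_le)
    next
      case False
      have "l * snd p \<le> 1/2" if "p \<in> A j" for p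
        using radius_bound(2)[OF A(1,2,3,4)[OF j] sT[OF j] that] s(3) by simp
      then obtain B where "config B" "separated 1 B" "arcs 1 B = arcs l (A j)" "card B \<le> card (A j)"
        using rescale_config[OF A(1)[OF j] sepl[OF j]] l1 by (metis less_le_trans zero_less_one)
      then show ?thesis using flj[OF j] False by metis
    qed
    then obtain B where B: "\<And>j. j < 3 \<Longrightarrow> config (B j)" "\<And>j. j < 3 \<Longrightarrow> separated 1 (B j)"
      "\<And>j. j < 3 \<Longrightarrow> flow s (E j) \<doteq> arcs 1 (B j)" "\<And>j. j < 3 \<Longrightarrow> card (B j) \<le> card (A j)"
      "card (B j0) < card (A j0)"
      using j0(1) by metis
    have cd: "(\<Sum>j<3. card (B j)) < (\<Sum>j<3. card (A j))"
      by (rule sum_strict_mono_ex1) (use B(4,5) j0(1) in auto)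
    have FL: "flow s (E j) \<in> L_sets" "t - s \<le> max_time (flow s (E j))" if "j < 3" for j
      using flow_L_sets[OF A(4)[OF that] s(1) sT[OF that]] max_time_flow[OF A(4)[OF that] s(1) sT[OF that]] t(2)[OF that]
      by auto
    have IH: "exp (2 * (t - s)) * trilinear (flow s (E 0)) (flow s (E 1)) (flow s (E 2))
      \<le> trilinear (flow (t - s) (flow s (E 0))) (flow (t - s) (flow s (E 1))) (flow (t - s) (flow s (E 2)))"
      by (rule less.hyps[OF cd B(1-3) FL(1) _ FL(2)]) (use s in auto)
    have Es: "flow t (E j) \<in> sets circle_measure" if "j < 3" for j
      using A(4)[OF that] by (intro flow_sets) (simp add: L_sets_def)
    have ff: "flow t (E j) \<doteq> flow (t - s) (flow s (E j))" if "j < 3" for j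
      by (rule flow_flow[OF A(4)[OF that] s(1,2) t(2)[OF that]])
    have "exp (2 * t) * trilinear (E 0) (E 1) (E 2) = exp (2 * (t - s)) * (exp (2 * s) * trilinear (E 0) (E 1) (E 2))"
      by (simp add: mult.assoc[symmetric] exp_add[symmetric] algebra_simps)
    also have "\<dots> \<le> exp (2 * (t - s)) * trilinear (flow s (E 0)) (flow s (E 1)) (flow s (E 2))"
      using trilinear_flow_separated[OF A s(1) sT] sepl s(3) by (intro mult_left_mono) auto
    also note IH
    also have "trilinear (flow (t - s) (flow s (E 0))) (flow (t - s) (flow s (E 1))) (flow (t - s) (flow s (E 2)))
      = trilinear (flow t (E 0)) (flow t (E 1)) (flow t (E 2))"
      using trilinear_cong[OF Es Es Es ff ff ff, of 0 1 2] by simp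
    finally show ?thesis .
  qed
qed

text \<open>Both sides are stable under approximation by arcs: the form is Lipschitz in each set,
  and by \<open>flow_contraction\<close> the evolved approximations stay within
  \<open>exp t * d\<close>.\<close>

lemma trilinear_flow:
  assumes E: "E1 \<in> L_sets" "E2 \<in> L_sets" "E3 \<in> L_sets"
    and t: "0 \<le> t" "t \<le> max_time E1" "t \<le> max_time E2" "t \<le> max_time E3"
  shows "exp (2 * t) * trilinear E1 E2 E3 \<le> trilinear (flow t E1) (flow t E2) (flow t E3)"
proof (rule field_le_epsilon)
  fix e :: real assume e: "0 < e"
  \<comment> \<open>Three replacements on the left carry the factor \<open>exp (2 * t)\<close> and
    three on the right the factor \<open>exp t\<close>; this \<open>d\<close> makes the total error
    \<open>e\<close>.\<close>
  define d where "d = e / (3 * exp (2 * t) + 3 * exp t)"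
  have pos: "0 < 3 * exp (2 * t) + 3 * exp t" by (intro add_pos_pos) auto
  have d: "0 < d" "(3 * exp (2 * t) + 3 * exp t) * d = e"
    using e pos by (auto simp: d_def)
  have ap: "\<exists>A. config A \<and> separated 1 A \<and> arcs 1 A \<in> L_sets \<and> t \<le> max_time (arcs 1 A) \<and>
    measure circle_measure (sym_diff (arcs 1 A) E) \<le> d"
    if EL: "E \<in> L_sets" "t \<le> max_time E" for E
  proof -
    obtain A where A: "config A" "separated 1 A" "arcs 1 A \<in> L_sets"
      "measure circle_measure (arcs 1 A) \<le> measure circle_measure E"
      "measure circle_measure (sym_diff (arcs 1 A) E) \<le> d"
      using approx_arcs[OF EL(1) d(1)] .
    have "exp t * measure circle_measure (arcs 1 A) \<le> exp t * measure circle_measure E"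
      using A(4) by simp
    also have "\<dots> \<le> 1" using le_max_time_iff[OF EL(1)] EL(2) by simp
    finally have "t \<le> max_time (arcs 1 A)" using le_max_time_iff[OF A(3)] by simp
    with A show ?thesis by blast
  qed
  obtain A1 where A1: "config A1" "separated 1 A1" "arcs 1 A1 \<in> L_sets" "t \<le> max_time (arcs 1 A1)"
    "measure circle_measure (sym_diff (arcs 1 A1) E1) \<le> d" using ap[OF E(1) t(2)] by blast
  obtain A2 where A2: "config A2" "separated 1 A2" "arcs 1 A2 \<in> L_sets" "t \<le> max_time (arcs 1 A2)"
    "measure circle_measure (sym_diff (arcs 1 A2) E2) \<le> d" using ap[OF E(2) t(3)] by blast
  obtain A3 where A3: "config A3" "separated 1 A3" "arcs 1 A3 \<in> L_sets" "t \<le> max_time (arcs 1 A3)"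
    "measure circle_measure (sym_diff (arcs 1 A3) E3) \<le> d" using ap[OF E(3) t(4)] by blast
  define A where "A = (\<lambda>j::nat. if j = 0 then A1 else if j = 1 then A2 else A3)"
  have *: "exp (2 * t) * trilinear (arcs 1 A1) (arcs 1 A2) (arcs 1 A3)
    \<le> trilinear (flow t (arcs 1 A1)) (flow t (arcs 1 A2)) (flow t (arcs 1 A3))"
    using trilinear_flow_arcs[of A "\<lambda>j. arcs 1 (A j)" t] A1 A2 A3 t(1) by (simp add: A_def)
  have s: "X \<in> sets circle_measure" if "X \<in> L_sets" for X using that by (simp add: L_sets_def)
  have "\<bar>trilinear (arcs 1 A1) (arcs 1 A2) (arcs 1 A3) - trilinear E1 E2 E3\<bar> \<le> 3 * d"
    using trilinear_Lipschitz[OF s[OF A1(3)] s[OF A2(3)] s[OF A3(3)] s[OF E(1)] s[OF E(2)] s[OF E(3)]]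
      A1(5) A2(5) A3(5) by linarith
  then have "trilinear E1 E2 E3 \<le> trilinear (arcs 1 A1) (arcs 1 A2) (arcs 1 A3) + 3 * d" by linarith
  then have 1: "exp (2 * t) * trilinear E1 E2 E3 \<le> exp (2 * t) * (trilinear (arcs 1 A1) (arcs 1 A2) (arcs 1 A3) + 3 * d)"
    by (intro mult_left_mono) auto
  have fc: "measure circle_measure (sym_diff (flow t (arcs 1 B)) (flow t F)) \<le> exp t * d"
    if "arcs 1 B \<in> L_sets" "F \<in> L_sets" "t \<le> max_time (arcs 1 B)" "t \<le> max_time F"
      "measure circle_measure (sym_diff (arcs 1 B) F) \<le> d" for B F
    using flow_contraction[OF that(1,2) t(1) that(3,4)] that(5)
    by (meson exp_ge_zero mult_left_mono order_trans)
  have "\<bar>trilinear (flow t (arcs 1 A1)) (flow t (arcs 1 A2)) (flow t (arcs 1 A3)) - trilinear (flow t E1) (flow t E2) (flow t E3)\<bar>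
    \<le> exp t * d + exp t * d + exp t * d"
    using trilinear_Lipschitz[OF flow_sets[OF s[OF A1(3)]] flow_sets[OF s[OF A2(3)]] flow_sets[OF s[OF A3(3)]]
        flow_sets[OF s[OF E(1)]] flow_sets[OF s[OF E(2)]] flow_sets[OF s[OF E(3)]], of t t t t t t]
      fc[OF A1(3) E(1) A1(4) t(2) A1(5)] fc[OF A2(3) E(2) A2(4) t(3) A2(5)] fc[OF A3(3) E(3) A3(4) t(4) A3(5)]
    by linarith
  with * 1 d(2) show "exp (2 * t) * trilinear E1 E2 E3 \<le> trilinear (flow t E1) (flow t E2) (flow t E3) + e"
    by (simp add: algebra_simps)
qed

lemma UNIV_circle_sets [simp]: "UNIV \<in> sets circle_measure"
  using sets.top[of circle_measure] by simp

section \<open>The essential sumset\<close>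

lemma essential_sumset_eq:
  assumes "A \<in> sets circle_measure" "B \<in> sets circle_measure"
  shows "A +\<^sub>0 B = {z. 0 < corr (uminus ` A) B z}"
proof -
  have "convolution (indicator A) (indicator B) z = corr (uminus ` A) B z" for z
  proof -
    have X: "B \<inter> {y. z - y \<in> A} \<in> sets circle_measure" by (intro sets.Int reflect_sets assms)
    have "indicator A (z - y) * indicator B y = (indicator (B \<inter> {y. z - y \<in> A}) y :: real)" for y
      by (auto simp: indicator_def)
    then show ?thesis using X by (simp add: convolution_def corr_reflect)
  qed
  then show ?thesis by (simp add: essential_sumset_def)
qed

lemma essential_sumset_sets:
  assumes "A \<in> sets circle_measure" "B \<in> sets circle_measure"
  shows "A +\<^sub>0 B \<in> sets circle_measure"
proof -
  have [measurable]: "corr (uminus ` A) B \<in> borel_measurable circle_measure"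
    by (intro corr_measurable circle_uminus_sets assms)
  have "{z \<in> space circle_measure. 0 < corr (uminus ` A) B z} \<in> sets circle_measure" by measurable
  then show ?thesis by (simp add: essential_sumset_eq assms)
qed

lemma trilinear_uminus:
  assumes "A \<in> sets circle_measure" "B \<in> sets circle_measure" "Z \<in> sets circle_measure"
  shows "trilinear A B (uminus ` Z) = (\<integral>z. indicator Z z * corr (uminus ` A) B z \<partial>circle_measure)"
  using trilinear_eq[OF assms(1,2) circle_uminus_sets[OF assms(3)]] corr_Fubini[OF assms]
  by (simp add: image_image)

lemma integral_corr:
  assumes "A \<in> sets circle_measure" "B \<in> sets circle_measure"
  shows "(\<integral>z. corr (uminus ` A) B z \<partial>circle_measure) = measure circle_measure A * measure circle_measure B"
proof -
  have "corr A UNIV y = measure circle_measure A" for y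
    by (simp add: corr_def translate_eq circle_translate_measure assms)
  then show ?thesis
    using corr_Fubini[OF assms, of UNIV] assms by (simp add: mult.commute)
qed

text \<open>The trilinear form of \<open>A\<close>, \<open>B\<close> and \<open>- Z\<close> is at most \<open>|A| |B|\<close>, with equality iff \<open>Z\<close>
  contains the essential sumset; this property is preserved by the flow.\<close>

lemma trilinear_sumset:
  assumes "A \<in> sets circle_measure" "B \<in> sets circle_measure"
  shows "trilinear A B (uminus ` (A +\<^sub>0 B)) = measure circle_measure A * measure circle_measure B"
proof -
  have eq: "indicator (A +\<^sub>0 B) z * corr (uminus ` A) B z = corr (uminus ` A) B z" for z
    using corr_bounds(1)[of "uminus ` A" B z] by (auto simp: essential_sumset_eq assms indicator_def)
  show ?thesis
    by (simp only: trilinear_uminus[OF assms essential_sumset_sets[OF assms]] eq integral_corr[OF assms])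
qed

text \<open>The defect in the inequality is the integral of the convolution over the complement of
  \<open>Z\<close>; a nonnegative function with integral zero vanishes almost everywhere.\<close>

lemma sumset_null_subset:
  assumes AB: "A \<in> sets circle_measure" "B \<in> sets circle_measure" and Z: "Z \<in> sets circle_measure"
    and le: "measure circle_measure A * measure circle_measure B \<le> trilinear A B (uminus ` Z)"
  shows "A +\<^sub>0 B \<sqsubseteq> Z"
proof -
  let ?c = "corr (uminus ` A) B"
  have uA: "uminus ` A \<in> sets circle_measure" by (rule circle_uminus_sets[OF AB(1)])
  have int: "integrable circle_measure (\<lambda>z. indicator X z * ?c z)" if "X \<in> sets circle_measure" for X
    by (rule corr_integrable[OF uA that AB(2)])
  have "(\<integral>z. indicator (- Z) z * ?c z \<partial>circle_measure) = (\<integral>z. indicator UNIV z * ?c z - indicator Z z * ?c z \<partial>circle_measure)"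
    by (intro Bochner_Integration.integral_cong) (auto simp: indicator_def)
  also have "\<dots> = measure circle_measure A * measure circle_measure B - trilinear A B (uminus ` Z)"
    using int[of UNIV] int[OF Z] integral_corr[OF AB] trilinear_uminus[OF AB Z]
    by (subst Bochner_Integration.integral_diff) auto
  finally have "(\<integral>z. indicator (- Z) z * ?c z \<partial>circle_measure) \<le> 0" using le by simp
  moreover have nZ: "- Z \<in> sets circle_measure"
    using sets.compl_sets[OF Z] by (simp add: Compl_eq_Diff_UNIV)
  moreover have "0 \<le> (\<integral>z. indicator (- Z) z * ?c z \<partial>circle_measure)"
    by (intro integral_nonneg_AE) (simp add: corr_bounds)
  ultimately have "(\<integral>z. indicator (- Z) z * ?c z \<partial>circle_measure) = 0" by simp
  then have "AE z in circle_measure. indicator (- Z) z * ?c z = 0"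
    using int[OF nZ] by (subst (asm) integral_nonneg_eq_0_iff_AE) (simp_all add: corr_bounds)
  then have "AE z in circle_measure. z \<notin> A +\<^sub>0 B - Z"
    by eventually_elim (auto simp: essential_sumset_eq AB indicator_def split: if_splits)
  then show ?thesis
    unfolding null_subset_def using essential_sumset_sets[OF AB] Z
    by (subst AE_iff_null_sets) auto
qed

text \<open>The factor \<open>exp (2 * t)\<close> in \<open>trilinear_flow\<close> is exactly the
  growth of \<open>|E1| |E2|\<close>. Hence the equality in \<open>trilinear_sumset\<close>
  persists, which confines the sumset at time \<open>t\<close> to the flow of
  \<open>S\<close>.\<close>

lemma sumset_flow:
  assumes E: "E1 \<in> L_sets" "E2 \<in> L_sets" and t: "0 \<le> t" "t \<le> max_time E1" "t \<le> max_time E2"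
  shows "measure circle_measure (flow t E1 +\<^sub>0 flow t E2) \<le> exp t * measure circle_measure (E1 +\<^sub>0 E2)"
proof -
  have s: "E1 \<in> sets circle_measure" "E2 \<in> sets circle_measure" and pos: "0 < measure circle_measure E1" "0 < measure circle_measure E2"
    using E by (auto simp: L_sets_def)
  define S where "S = E1 +\<^sub>0 E2"
  have Ss: "S \<in> sets circle_measure" unfolding S_def by (rule essential_sumset_sets[OF s])
  have tri: "trilinear E1 E2 (uminus ` S) = measure circle_measure E1 * measure circle_measure E2"
    unfolding S_def by (rule trilinear_sumset[OF s])
  have "measure circle_measure S \<noteq> 0"
  proof
    assume "measure circle_measure S = 0"
    then have "S \<in> null_sets circle_measure" using Ss by (simp add: null_sets_def circle.emeasure_eq_measure)
    then have "AE z in circle_measure. indicator S z * corr (uminus ` E1) E2 z = 0"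
      by (rule AE_I') (auto split: split_indicator_asm)
    then have "trilinear E1 E2 (uminus ` S) = 0"
      unfolding trilinear_uminus[OF s Ss] by (rule integral_eq_zero_AE)
    with tri pos show False by simp
  qed
  then have S: "S \<in> L_sets" using Ss by (simp add: L_sets_def zero_less_measure_iff)
  show ?thesis
  proof (cases "t \<le> max_time S")
    case True
    have uS: "uminus ` S \<in> L_sets" "max_time (uminus ` S) = max_time S"
      using S by (simp_all add: L_sets_def circle_uminus_sets circle_uminus_measure max_time_def)
    have "measure circle_measure (flow t E1) * measure circle_measure (flow t E2)
      = exp (2 * t) * trilinear E1 E2 (uminus ` S)"
      using flow_measure[OF E(1) t(1,2)] flow_measure[OF E(2) t(1,3)] tri
      by (simp add: exp_double power2_eq_square)
    also have "\<dots> \<le> trilinear (flow t E1) (flow t E2) (flow t (uminus ` S))"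
      by (rule trilinear_flow[OF E uS(1) t]) (use True uS in simp)
    also have "flow t (uminus ` S) = uminus ` flow t S" by (rule flow_uminus)
    finally have "flow t E1 +\<^sub>0 flow t E2 \<sqsubseteq> flow t S"
      by (intro sumset_null_subset flow_sets s Ss)
    then have "measure circle_measure (flow t E1 +\<^sub>0 flow t E2) \<le> measure circle_measure (flow t S)"
      by (intro null_subset_measure essential_sumset_sets flow_sets s Ss)
    then show ?thesis using flow_measure[OF S t(1) True] by (simp add: S_def)
  next
    case False
    then have "1 \<le> exp t * measure circle_measure S" using le_max_time_iff[OF S] by simp
    then show ?thesis
      using measure_circle_le_1[of "flow t E1 +\<^sub>0 flow t E2"] by (simp add: S_def)
  qed
qed

section \<open>Bohr sets\<close>

lemma circle_norm_add: "circle_norm (a + b) \<le> circle_norm a + circle_norm b"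
proof -
  obtain x where x: "a = to_circle x" by (rule to_circle_cases)
  obtain y where y: "b = to_circle y" by (rule to_circle_cases)
  have "\<bar>(x + y) - of_int (round (x + y))\<bar> \<le> \<bar>(x + y) - of_int (round x + round y)\<bar>"
    by (rule round_diff_minimal)
  also have "\<dots> \<le> \<bar>x - of_int (round x)\<bar> + \<bar>y - of_int (round y)\<bar>" by simp
  finally show ?thesis by (simp add: x y to_circle_add[symmetric] circle_norm.abs_eq)
qed

lemma circle_norm_uminus: "circle_norm (- a) = circle_norm a"
proof -
  have "circle_norm (- a) \<le> circle_norm a" for a
  proof -
    obtain x where x: "a = to_circle x" by (rule to_circle_cases)
    have "\<bar>- x - of_int (round (- x))\<bar> \<le> \<bar>- x - of_int (- round x)\<bar>" by (rule round_diff_minimal)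
    also have "\<dots> = \<bar>x - of_int (round x)\<bar>" by simp
    finally show ?thesis by (simp add: x to_circle_minus[symmetric] circle_norm.abs_eq)
  qed
  from this[of a] this[of "- a"] show ?thesis by simp
qed

lemma circle_norm_nonneg: "0 \<le> circle_norm a"
  by (rule to_circle_cases[of a]) (simp add: circle_norm.abs_eq)

lemma circle_norm_le: "circle_norm (to_circle x) \<le> \<bar>x\<bar>"
  using round_diff_minimal[of x 0] by (simp add: circle_norm.abs_eq)

lemma circle_norm_eq_0: "circle_norm a = 0 \<Longrightarrow> a = 0"
proof -
  obtain x where x: "a = to_circle x" by (rule to_circle_cases)
  assume "circle_norm a = 0"
  then have "x = of_int (round x)" by (simp add: x circle_norm.abs_eq)
  then have "x \<in> \<int>" by (metis Ints_of_int)
  then show "a = 0" by (simp add: x to_circle_Ints)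
qed

lemma circle_norm_rep:
  obtains \<theta> where "a = to_circle \<theta>" "\<bar>\<theta>\<bar> = circle_norm a"
proof -
  obtain x where x: "a = to_circle x" by (rule to_circle_cases)
  show ?thesis
    by (rule that[of "x - of_int (round x)"]) (simp_all add: x to_circle_eq_iff circle_norm.abs_eq)
qed

lemma circle_hom_continuous:
  assumes cont: "continuous_on UNIV \<phi>" and add: "\<And>x y. \<phi> (x + y) = \<phi> x + \<phi> y" and e: "0 < (e::real)"
  obtains d where "0 < d" "\<And>x. \<bar>x\<bar> < d \<Longrightarrow> circle_norm (\<phi> (to_circle x)) < e"
proof -
  have "open {z. circle_norm z < e}"
  proof -
    have "to_circle -` {z. circle_norm z < e} = (\<Union>k::int. {x. \<bar>x - of_int k\<bar> < e})"
      using le_circle_norm_iff[of e] by (auto simp: not_le[symmetric])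
    then show ?thesis
      unfolding open_circle_def by (simp only:) (intro open_UN ballI open_Collect_less continuous_intros)
  qed
  then have "open (\<phi> -` {z. circle_norm z < e})"
    using cont continuous_on_open_vimage[OF open_UNIV, of \<phi>] by (metis Int_UNIV_right)
  then have op: "open (to_circle -` \<phi> -` {z. circle_norm z < e})"
    by (simp only: open_circle_def)
  have "\<phi> (to_circle 0) = 0" using add[of 0 0] by (simp add: to_circle_Ints)
  moreover have "circle_norm 0 = 0" using circle_norm_le[of 0] circle_norm_nonneg[of 0] by (simp add: to_circle_Ints)
  ultimately have "0 \<in> to_circle -` \<phi> -` {z. circle_norm z < e}" using e by simp
  then obtain d where "0 < d" "ball 0 d \<subseteq> to_circle -` \<phi> -` {z. circle_norm z < e}"
    by (rule openE[OF op])
  then show ?thesis by (intro that[of d]) (auto simp: subset_iff)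
qed

lemma additive_int_mult:
  fixes f :: "real \<Rightarrow> circle"
  assumes add: "\<And>x y. f (x + y) = f x + f y" and x: "f x = to_circle y"
  shows "f (of_int k * x) = to_circle (of_int k * y)"
proof -
  have f0: "f 0 = 0" using add[of 0 0] by simp
  have fm: "f (- z) = - f z" for z using add[of z "- z"] f0 by (simp add: eq_neg_iff_add_eq_0 add.commute)
  have nat: "f (of_nat n * x) = to_circle (of_nat n * y)" for n
    by (induction n) (simp_all add: distrib_right add to_circle_add x f0 to_circle_Ints)
  show ?thesis
  proof (cases "0 \<le> k")
    case True
    then show ?thesis using nat[of "nat k"] by simp
  next
    case False
    then have "f (- (of_int k * x)) = to_circle (- (of_int k * y))" using nat[of "nat (- k)"] by simp
    then show ?thesis by (simp add: fm to_circle_minus)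
  qed
qed

text \<open>Near \<open>0\<close> the values of a continuous homomorphism have small representatives, and these are halved
  along with the argument; this determines the homomorphism on a dense set.\<close>

lemma circle_hom_classification:
  assumes cont: "continuous_on UNIV \<phi>" and add: "\<And>x y. \<phi> (x + y) = \<phi> x + \<phi> y"
  obtains n :: int where "\<And>x. \<phi> (to_circle x) = to_circle (of_int n * x)"
proof -
  define f where "f x = \<phi> (to_circle x)" for x
  have fadd: "f (x + y) = f x + f y" for x y by (simp add: f_def to_circle_add add)
  have small: "\<exists>d>0. \<forall>x. \<bar>x\<bar> < d \<longrightarrow> circle_norm (f x) < e" if "0 < e" for e
    using circle_hom_continuous[OF cont add that] unfolding f_def by metis
  \<comment> \<open>With representatives below \<open>1/4\<close> the integer
    \<open>\<theta> k - 2 * \<theta> (Suc k)\<close> has absolute value below \<open>3/4\<close>,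
    hence is \<open>0\<close>.\<close>
  have "0 < (1/4 :: real)" by simp
  from small[OF this] obtain d where d: "0 < d" and "\<forall>x. \<bar>x\<bar> < d \<longrightarrow> circle_norm (f x) < 1/4"
    by (elim exE conjE)
  then have d4: "circle_norm (f x) < 1/4" if "\<bar>x\<bar> < d" for x using that by simp
  obtain M where M: "1 / real (Suc M) < d" using nat_approx_posE[OF d] .
  define N where "N = Suc M"
  have N: "0 < N" "1 / real N < d" using M by (simp_all add: N_def)
  \<comment> \<open>These points halve at each step and are all smaller than \<open>d\<close>. Since
    \<open>N * h 0 = 1\<close> is mapped to \<open>0\<close>, the number
    \<open>N * \<theta> 0\<close> is an integer, the degree \<open>n\<close>.\<close>
  define h where "h k = 1 / (real N * 2 ^ k)" for k :: nat
  have h: "0 < h k" "h k < d" "h k = 2 * h (Suc k)" for k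
  proof -
    have "1 \<le> (2::real) ^ k" by simp
    then have "real N * 1 \<le> real N * 2 ^ k" by (intro mult_left_mono) auto
    then have "h k \<le> 1 / real N" unfolding h_def using N(1) by (intro divide_left_mono) auto
    then show "h k < d" using N(2) by simp
    show "0 < h k" "h k = 2 * h (Suc k)" using N(1) by (simp_all add: h_def)
  qed
  have "\<exists>\<theta>. f (h k) = to_circle \<theta> \<and> \<bar>\<theta>\<bar> < 1/4" for k
      proof -
    obtain \<theta> where "f (h k) = to_circle \<theta>" "\<bar>\<theta>\<bar> = circle_norm (f (h k))" by (rule circle_norm_rep)
    then show ?thesis using d4[of "h k"] h[of k] by auto
  qed
  then obtain \<theta> where \<theta>: "\<And>k. f (h k) = to_circle (\<theta> k)" "\<And>k. \<bar>\<theta> k\<bar> < 1/4"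
    by metis
  have half: "\<theta> k = 2 * \<theta> (Suc k)" for k
  proof -
    have "f (of_int 2 * h (Suc k)) = to_circle (of_int 2 * \<theta> (Suc k))"
      by (rule additive_int_mult[OF fadd \<theta>(1)])
    then have "to_circle (\<theta> k) = to_circle (2 * \<theta> (Suc k))" using \<theta>(1)[of k] h(3)[of k] by simp
    then obtain j where j: "\<theta> k - 2 * \<theta> (Suc k) = of_int j"
      by (auto simp: to_circle_eq_iff elim: Ints_cases)
    then have "\<bar>of_int j :: real\<bar> < 1" using \<theta>(2)[of k] \<theta>(2)[of "Suc k"] by linarith
    then have "j = 0" by linarith
    with j show ?thesis by simp
  qed
  have "f (of_int (int N) * h 0) = to_circle (of_int (int N) * \<theta> 0)"
    by (rule additive_int_mult[OF fadd \<theta>(1)])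
  moreover have "of_int (int N) * h 0 = 1" using N(1) by (simp add: h_def)
  moreover have "f 1 = 0"
    using add[of 0 0] by (simp add: f_def to_circle_Ints)
  ultimately have "to_circle (real N * \<theta> 0) = to_circle 0" by (simp add: zero_circle_def)
  then obtain n where n: "real N * \<theta> 0 = of_int n" by (auto simp: to_circle_eq_iff elim: Ints_cases)
  have \<theta>h: "\<theta> k = of_int n * h k" for k
  proof (induction k)
    case 0
    then show ?case using n N(1) by (simp add: h_def field_simps)
  next
    case (Suc k)
    then show ?case using half[of k] h(3)[of k] by simp
  qed
  have "f x = to_circle (of_int n * x)" for x
  proof -
    define z where "z = f x - to_circle (of_int n * x)"
    have "circle_norm z \<le> 0 + e" if e: "0 < e" for e :: real
    proof -
      from small[OF half_gt_zero[OF e]] obtain d' where d': "0 < d'" "\<forall>x. \<bar>x\<bar> < d' \<longrightarrow> circle_norm (f x) < e / 2"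
        by (elim exE conjE)
      \<comment> \<open>Half of \<open>e\<close> is reserved for \<open>f w\<close> and half for
        \<open>of_int n * w\<close>, where \<open>w\<close> is the remainder of \<open>x\<close>
        modulo \<open>h k\<close>; the summand \<open>1\<close> keeps the denominator positive for
        \<open>n = 0\<close>.\<close>
      define b where "b = min d' (e / (2 * (\<bar>of_int n\<bar> + 1)))"
      have "0 < b" using d'(1) e by (auto simp: b_def intro!: divide_pos_pos)
      moreover have "h \<longlonglongrightarrow> 0"
      proof -
        have "(\<lambda>k. (1 / real N) * (1 / 2) ^ k) \<longlonglongrightarrow> (1 / real N) * 0"
          by (intro tendsto_mult tendsto_const LIMSEQ_power_zero) simp
        then show ?thesis by (simp add: h_def[abs_def] power_divide)
      qed
      ultimately obtain k where k: "h k < b"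
        using order_tendstoD(2)[of h 0 sequentially b] by (auto simp: eventually_sequentially)
      define j where "j = \<lfloor>x / h k\<rfloor>"
      define w where "w = x - of_int j * h k"
      have w: "0 \<le> w" "w < h k"
      proof -
        have "of_int j * h k \<le> x / h k * h k"
          unfolding j_def using h(1)[of k] by (intro mult_right_mono) auto
        then show "0 \<le> w" using h(1)[of k] by (simp add: w_def)
        have "x / h k < of_int j + 1" unfolding j_def by linarith
        then have "x < (of_int j + 1) * h k" using h(1)[of k] by (simp only: pos_divide_less_eq)
        then show "w < h k" by (simp add: w_def distrib_right)
      qed
      have "f (of_int j * h k) = to_circle (of_int j * (of_int n * h k))"
        by (rule additive_int_mult[OF fadd]) (simp add: \<theta> \<theta>h[symmetric])
      then have fj: "f (of_int j * h k) = to_circle (of_int n * (of_int j * h k))"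
        by (simp only: mult.left_commute)
      have "x = of_int j * h k + w" by (simp add: w_def)
      then have "z = f (of_int j * h k + w) - to_circle (of_int n * (of_int j * h k + w))"
        by (simp add: z_def)
      also have "\<dots> = f w + - to_circle (of_int n * w)"
        by (simp add: fadd fj distrib_left to_circle_add)
      finally have "circle_norm z \<le> circle_norm (f w) + circle_norm (to_circle (of_int n * w))"
        using circle_norm_add[of "f w" "- to_circle (of_int n * w)"] by (simp add: circle_norm_uminus)
      also have "circle_norm (f w) \<le> e / 2"
        using d'(2)[rule_format, of w] w k by (simp add: b_def less_imp_le)
      also have "circle_norm (to_circle (of_int n * w)) \<le> \<bar>of_int n * w\<bar>" by (rule circle_norm_le)
      also have "\<bar>of_int n * w\<bar> \<le> (\<bar>of_int n\<bar> + 1) * (e / (2 * (\<bar>of_int n\<bar> + 1)))"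
        unfolding abs_mult using w k by (intro mult_mono) (auto simp: b_def)
      also have "\<dots> = e / 2" by (simp add: field_simps)
      finally show ?thesis by simp
    qed
    then have "circle_norm z \<le> 0" by (rule field_le_epsilon)
    then have "z = 0" using circle_norm_nonneg[of z] by (intro circle_norm_eq_0) simp
    then show ?thesis by (simp add: z_def)
  qed
  then show ?thesis using that unfolding f_def by blast
qed

text \<open>Multiplication by \<open>n\<close> pulls the interval about \<open>0\<close> back to
  \<open>N = |n|\<close> intervals about the fractions \<open>j / N\<close>, with the radius divided
  by \<open>N\<close>. The arcs are open and the Bohr set is given by a weak inequality, so the
  difference consists of endpoints, countably many in the lift.\<close>

lemma bohr_arcs:
  fixes n :: int
  assumes n: "n \<noteq> 0" and phi: "\<And>x. \<phi> (to_circle x) = to_circle (of_int n * x)"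
  defines "N \<equiv> nat \<bar>n\<bar>"
  shows "{x. circle_norm (\<phi> x) \<le> l * r} \<doteq> arcs l ((\<lambda>j. (real j / real N, r / real N)) ` {..<N})"
    (is "?B \<doteq> ?A")
proof -
  have N: "0 < real N" "real N = \<bar>of_int n\<bar>" using n by (auto simp: N_def)
  have B: "to_circle x \<in> ?B \<longleftrightarrow> (\<exists>k::int. \<bar>real N * x - of_int k\<bar> \<le> l * r)" for x
  proof -
    have "to_circle x \<in> ?B \<longleftrightarrow> (\<exists>k::int. \<bar>of_int n * x - of_int k\<bar> \<le> l * r)"
      using round_diff_minimal[of "of_int n * x"]
      by (auto simp: phi circle_norm.abs_eq intro: order_trans)
    also have "\<dots> \<longleftrightarrow> (\<exists>k::int. \<bar>real N * x - of_int k\<bar> \<le> l * r)"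
    proof (cases "0 \<le> n")
      case False
      then have e: "\<bar>of_int n * x - of_int k\<bar> = \<bar>real N * x - of_int (- k)\<bar>" for k
        using N(2) by (simp add: abs_minus_commute)
      show ?thesis unfolding e by (metis minus_minus)
    qed (use N in simp)
    finally show ?thesis .
  qed
  have A: "to_circle x \<in> ?A \<longleftrightarrow> (\<exists>k::int. \<bar>real N * x - of_int k\<bar> < l * r)" for x
  proof -
    have sc: "\<bar>x - real j / real N - of_int m\<bar> < l * (r / real N) \<longleftrightarrow> \<bar>real N * x - of_int (int j + int N * m)\<bar> < l * r"
      for j and m :: int
    proof -
      have "\<bar>real N * x - of_int (int j + int N * m)\<bar> = real N * \<bar>x - real j / real N - of_int m\<bar>"
      proof -
        have "real N * x - of_int (int j + int N * m) = real N * (x - real j / real N - of_int m)"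
          using N(1) by (simp add: right_diff_distrib)
        then show ?thesis by (simp only: abs_mult abs_of_nat)
      qed
      then show ?thesis using N(1) by (simp add: pos_less_divide_eq mult.commute)
    qed
    have "to_circle x \<in> ?A \<longleftrightarrow> (\<exists>j<N. \<exists>m::int. \<bar>x - real j / real N - of_int m\<bar> < l * (r / real N))"
      by (auto simp: arcs_def vimage_arc)
    also have "\<dots> \<longleftrightarrow> (\<exists>k::int. \<bar>real N * x - of_int k\<bar> < l * r)"
      unfolding sc
    proof
      assume "\<exists>k::int. \<bar>real N * x - of_int k\<bar> < l * r"
      then obtain k :: int where k: "\<bar>real N * x - of_int k\<bar> < l * r" by blast
      \<comment> \<open>Division of \<open>k\<close> by \<open>N\<close>: the remainder selects the
        arc and the quotient its lift.\<close>
      have "int (nat (k mod int N)) + int N * (k div int N) = k" "nat (k mod int N) < N"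
        using N(1) by (simp_all add: nat_less_iff)
      with k show "\<exists>j<N. \<exists>m::int. \<bar>real N * x - of_int (int j + int N * m)\<bar> < l * r" by metis
    qed blast
    finally show ?thesis .
  qed
  have "?A \<subseteq> ?B"
    unfolding to_circle_vimage_subset[symmetric]
  proof
    fix x assume "x \<in> to_circle -` ?A"
    then have "\<exists>k::int. \<bar>real N * x - of_int k\<bar> \<le> l * r" using A[of x] less_imp_le by blast
    then show "x \<in> to_circle -` ?B" using B[of x] by blast
  qed
  moreover have "?B - ?A \<in> null_sets circle_measure"
  proof -
    have "to_circle -` (?B - ?A) \<subseteq> (\<Union>k::int. {(of_int k + l * r) / real N, (of_int k - l * r) / real N})"
    proof
      fix x assume "x \<in> to_circle -` (?B - ?A)"
      then obtain k :: int where "\<bar>real N * x - of_int k\<bar> = l * r"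
        using A[of x] B[of x] by (metis Diff_iff antisym_conv2 vimage_eq)
      then have "real N * x = of_int k + l * r \<or> real N * x = of_int k - l * r"
        by (auto simp: abs_real_def split: if_splits)
      then show "x \<in> (\<Union>k::int. {(of_int k + l * r) / real N, (of_int k - l * r) / real N})"
        using N(1) by (auto simp: eq_divide_eq mult.commute intro!: exI[of _ k])
    qed
    then have "countable (to_circle -` (?B - ?A))" by (rule countable_subset) auto
    then show ?thesis
      unfolding circle_null_iff by (simp add: countable_imp_null_set_lborel null_sets_completionI)
  qed
  ultimately show ?thesis
    by (auto simp: null_eq_iff null_subset_def intro: subset_null_subset[unfolded null_subset_def])
qed

text \<open>Distinct centres differ by at least \<open>1 / N\<close> modulo integers, since
  \<open>i - j - N * k\<close> is a nonzero integer, while the two scaled radii add up to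
  \<open>2 * l * r / N\<close>.\<close>

lemma bohr_separated:
  assumes N: "0 < N" and r: "0 < r" "l * r \<le> 1/2"
  shows "separated l ((\<lambda>j. (real j / real N, r / real N)) ` {..<N})"
  unfolding separated_def
proof (intro ballI impI)
  fix p q assume "p \<in> (\<lambda>j. (real j / real N, r / real N)) ` {..<N}"
    "q \<in> (\<lambda>j. (real j / real N, r / real N)) ` {..<N}" "p \<noteq> q"
  then obtain i j where ij: "i < N" "j < N" "i \<noteq> j" "p = (real i / real N, r / real N)" "q = (real j / real N, r / real N)"
    by auto
  have "l * (snd p + snd q) \<le> \<bar>real i / real N - real j / real N - of_int k\<bar>" for k :: int
  proof -
    have "int i - int j - int N * k \<noteq> 0"
    proof
      assume "int i - int j - int N * k = 0"
      then have "int N dvd int i - int j" by auto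
      then have "int i mod int N = int j mod int N" by (simp add: mod_eq_dvd_iff)
      with ij show False by simp
    qed
    then have "(1::int) \<le> \<bar>int i - int j - int N * k\<bar>" by linarith
    then have "(1::real) \<le> of_int \<bar>int i - int j - int N * k\<bar>" by (metis of_int_1_le_iff)
    also have "\<dots> = \<bar>real N * (real i / real N - real j / real N - of_int k)\<bar>"
      using N by (simp add: right_diff_distrib)
    also have "\<dots> = real N * \<bar>real i / real N - real j / real N - of_int k\<bar>" by (simp add: abs_mult)
    finally have "1 / real N \<le> \<bar>real i / real N - real j / real N - of_int k\<bar>"
      using N by (simp add: pos_divide_le_eq mult.commute)
    moreover have "l * (snd p + snd q) = 2 * (l * r) / real N" by (simp add: ij)
    moreover have "2 * (l * r) / real N \<le> 1 / real N" using r N by (intro divide_right_mono) auto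
    ultimately show ?thesis by linarith
  qed
  then show "l * (snd p + snd q) \<le> circle_norm (to_circle (fst p - fst q))"
    by (simp add: ij le_circle_norm_iff)
qed

lemma flow_bohr:
  fixes \<phi> :: "circle \<Rightarrow> circle"
  assumes cont: "continuous_on UNIV \<phi>" and add: "\<And>x y. \<phi> (x + y) = \<phi> x + \<phi> y"
    and nc: "\<not> \<phi> constant_on UNIV" and r: "0 < r" "r \<le> 1/2"
    and E: "E \<in> L_sets" "E \<doteq> {x. circle_norm (\<phi> x) \<le> r}" and t: "0 \<le> t" "t \<le> max_time E"
  shows "flow t E \<doteq> {x. circle_norm (\<phi> x) \<le> exp t * r}"
proof -
  obtain n where n: "\<And>x. \<phi> (to_circle x) = to_circle (of_int n * x)"
    using circle_hom_classification[OF cont add] by blast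
  have "n \<noteq> 0"
  proof
    assume "n = 0"
    then have "\<phi> z = 0" for z using n by (cases z rule: to_circle_cases) (simp add: to_circle_Ints)
    with nc show False unfolding constant_on_def by blast
  qed
  define N where "N = nat \<bar>n\<bar>"
  have N: "0 < N" using \<open>n \<noteq> 0\<close> by (simp add: N_def)
  define A where "A = (\<lambda>j. (real j / real N, r / real N)) ` {..<N}"
  have B: "{x. circle_norm (\<phi> x) \<le> l * r} \<doteq> arcs l A" for l
    unfolding A_def N_def by (rule bohr_arcs[OF \<open>n \<noteq> 0\<close> n])
  have "r / real N \<le> 1/2"
  proof -
    have "r / real N \<le> r / 1" using N r by (intro divide_left_mono) auto
    then show ?thesis using r by linarith
  qed
  then have cA: "config A" using N r by (auto simp: config_def A_def)
  have sA: "separated 1 A" unfolding A_def using N r by (intro bohr_separated) auto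
  have EA: "E \<doteq> arcs 1 A" using null_eq_trans[OF E(2)] B[of 1] by simp
  have "inj_on (\<lambda>j. (real j / real N, r / real N)) {..<N}" using N by (auto simp: inj_on_def)
  then have "(\<Sum>p\<in>A. 2 * snd p) = 2 * r" using N by (simp add: A_def sum.reindex)
  \<comment> \<open>The arcs have total length \<open>2 * r\<close>, so up to
    \<open>max_time E\<close> the scaled radius \<open>exp t * r\<close> is at most
    \<open>1/2\<close>: the arcs touch at the earliest when they fill the circle.\<close>
  then have "exp t * r \<le> 1/2" using radius_bound(1)[OF cA sA EA E(1) t(2)] by simp
  then have "separated (exp t) A" unfolding A_def using N r by (intro bohr_separated) auto
  from flow_arcs[OF cA sA EA E(1) t this] B[of "exp t"] show ?thesis
    using null_eq_trans null_eq_sym by blast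
qed

section \<open>Continuity in time, and restarting the flow at an intermediate time\<close>

text \<open>The sets are nested in time, so the symmetric difference has measure
  \<open>|exp s - exp t|\<close> times that of \<open>E\<close>.\<close>

lemma flow_measure_continuous:
  assumes E: "E \<in> L_sets" and t: "t \<in> {0..max_time E}"
  shows "((\<lambda>s. measure circle_measure (sym_diff (flow s E) (flow t E))) \<longlongrightarrow> 0) (at t within {0..max_time E})"
proof -
  have Es: "E \<in> sets circle_measure" using E by (simp add: L_sets_def)
  let ?m = "measure circle_measure E"
  have d: "measure circle_measure (sym_diff (flow s E) (flow t E)) = \<bar>exp s * ?m - exp t * ?m\<bar>"
    if s: "s \<in> {0..max_time E}" for s
  proof -
    have le: "measure circle_measure (sym_diff (flow a E) (flow b E)) = exp b * ?m - exp a * ?m"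
      if ab: "a \<le> b" "a \<in> {0..max_time E}" "b \<in> {0..max_time E}" for a b
    proof -
      have sub: "flow a E \<subseteq> flow b E" by (rule flow_mono_time[OF Es ab(1)])
      then have "sym_diff (flow a E) (flow b E) = flow b E - flow a E" by blast
      then show ?thesis
        using circle.finite_measure_Diff[OF flow_sets[OF Es] flow_sets[OF Es] sub] ab
        by (simp add: flow_measure[OF E])
    qed
    show ?thesis
    proof (cases "s \<le> t")
      case True
      have "exp s * ?m \<le> exp t * ?m" using True by (intro mult_right_mono) auto
      with le[OF True s t] show ?thesis by simp
    next
      case False
      then have "t \<le> s" by simp
      moreover have "exp t * ?m \<le> exp s * ?m" using \<open>t \<le> s\<close> by (intro mult_right_mono) auto
      ultimately show ?thesis using le[OF _ t s] by (simp add: Un_commute)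
    qed
  qed
  have "((\<lambda>s. \<bar>exp s * ?m - exp t * ?m\<bar>) \<longlongrightarrow> \<bar>exp t * ?m - exp t * ?m\<bar>) (at t within {0..max_time E})"
    by (intro tendsto_intros)
  then have "((\<lambda>s. \<bar>exp s * ?m - exp t * ?m\<bar>) \<longlongrightarrow> 0) (at t within {0..max_time E})" by simp
  then show ?thesis
  proof (rule tendsto_cong[THEN iffD1, rotated])
    show "\<forall>\<^sub>F s in at t within {0..max_time E}. \<bar>exp s * ?m - exp t * ?m\<bar> = measure circle_measure (sym_diff (flow s E) (flow t E))"
      unfolding eventually_at_filter by (rule eventuallyI) (simp add: d)
  qed
qed

text \<open>By the semigroup property it suffices to compare times \<open>s \<le> t\<close> starting from \<open>flow s E\<close>.\<close>

lemma flow_contraction_le: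
  assumes E: "E1 \<in> L_sets" "E2 \<in> L_sets" and st: "0 \<le> s" "s \<le> t" "t \<le> max_time E1" "t \<le> max_time E2"
  shows "exp (- t) * measure circle_measure (sym_diff (flow t E1) (flow t E2))
    \<le> exp (- s) * measure circle_measure (sym_diff (flow s E1) (flow s E2))"
proof -
  have s: "E1 \<in> sets circle_measure" "E2 \<in> sets circle_measure" using E by (auto simp: L_sets_def)
  have F: "flow s E1 \<in> L_sets" "flow s E2 \<in> L_sets"
    "t - s \<le> max_time (flow s E1)" "t - s \<le> max_time (flow s E2)"
    using st E by (auto simp: flow_L_sets max_time_flow)
  have ff: "flow t E1 \<doteq> flow (t - s) (flow s E1)" "flow t E2 \<doteq> flow (t - s) (flow s E2)"
    using st E by (auto intro: flow_flow)
  have "measure circle_measure (sym_diff (flow t E1) (flow t E2))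
      = measure circle_measure (sym_diff (flow (t - s) (flow s E1)) (flow (t - s) (flow s E2)))"
  proof (rule null_eq_measure)
    show "sym_diff (flow t E1) (flow t E2) \<in> sets circle_measure"
      using s by (intro sets.Un sets.Diff flow_sets)
    have "sym_diff (flow t E1) (flow (t - s) (flow s E1)) \<union> sym_diff (flow t E2) (flow (t - s) (flow s E2)) \<in> null_sets circle_measure"
      using ff unfolding null_eq_def by (rule null_sets.Un)
    then show "sym_diff (flow t E1) (flow t E2) \<doteq> sym_diff (flow (t - s) (flow s E1)) (flow (t - s) (flow s E2))"
      unfolding null_eq_def by (rule circle_null_subset) blast
  qed
  also have "\<dots> \<le> exp (t - s) * measure circle_measure (sym_diff (flow s E1) (flow s E2))"
    using st by (intro flow_contraction F) auto
  finally have "exp (- t) * measure circle_measure (sym_diff (flow t E1) (flow t E2))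
      \<le> exp (- t) * (exp (t - s) * measure circle_measure (sym_diff (flow s E1) (flow s E2)))"
    by (rule mult_left_mono) simp
  then show ?thesis by (simp add: mult.assoc[symmetric] exp_add[symmetric])
qed

text \<open>The convolution does not see null sets at any point, so the sumsets agree as sets and
  not only as classes.\<close>

lemma essential_sumset_cong:
  assumes "A \<doteq> A'" "B \<doteq> B'" "A \<in> sets circle_measure" "B \<in> sets circle_measure"
  shows "A +\<^sub>0 B = A' +\<^sub>0 B'"
  using corr_cong[OF uminus_null_eq[OF assms(1,3)] assms(2) circle_uminus_sets[OF assms(3)] assms(4)]
    null_eq_sets[OF assms(1,3)] null_eq_sets[OF assms(2,4)] assms
  by (simp add: essential_sumset_eq)

text \<open>The bound from time \<open>0\<close> is applied to the sets at time \<open>s\<close>,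
  and \<open>exp (- t) * exp (t - s) = exp (- s)\<close> restores the weights.\<close>

lemma sumset_flow_antimono:
  assumes E: "E1 \<in> L_sets" "E2 \<in> L_sets"
  shows "antimono_on {0..min (max_time E1) (max_time E2)}
    (\<lambda>t. exp (- t) * measure circle_measure (flow t E1 +\<^sub>0 flow t E2))"
proof (rule monotone_onI)
  fix s t assume st: "s \<in> {0..min (max_time E1) (max_time E2)}" "t \<in> {0..min (max_time E1) (max_time E2)}" "s \<le> t"
  have s: "E1 \<in> sets circle_measure" "E2 \<in> sets circle_measure" using E by (auto simp: L_sets_def)
  have F: "flow s E1 \<in> L_sets" "flow s E2 \<in> L_sets"
    "t - s \<le> max_time (flow s E1)" "t - s \<le> max_time (flow s E2)"
    using st E by (auto simp: flow_L_sets max_time_flow)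
  have ff: "flow t E1 \<doteq> flow (t - s) (flow s E1)" "flow t E2 \<doteq> flow (t - s) (flow s E2)"
    using st E by (auto intro: flow_flow)
  have "flow t E1 +\<^sub>0 flow t E2 = flow (t - s) (flow s E1) +\<^sub>0 flow (t - s) (flow s E2)"
    by (intro essential_sumset_cong ff flow_sets s)
  then have "measure circle_measure (flow t E1 +\<^sub>0 flow t E2) \<le> exp (t - s) * measure circle_measure (flow s E1 +\<^sub>0 flow s E2)"
    using sumset_flow[OF F(1,2) _ F(3,4)] st by simp
  then have "exp (- t) * measure circle_measure (flow t E1 +\<^sub>0 flow t E2)
      \<le> exp (- t) * (exp (t - s) * measure circle_measure (flow s E1 +\<^sub>0 flow s E2))"
    by (rule mult_left_mono) simp
  then show "exp (- s) * measure circle_measure (flow s E1 +\<^sub>0 flow s E2)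
      \<ge> exp (- t) * measure circle_measure (flow t E1 +\<^sub>0 flow t E2)"
    by (simp add: mult.assoc[symmetric] exp_add[symmetric])
qed

lemma trilinear_flow_mono:
  assumes E: "E1 \<in> L_sets" "E2 \<in> L_sets" "E3 \<in> L_sets"
    and \<tau>: "\<tau> \<le> max_time E1" "\<tau> \<le> max_time E2" "\<tau> \<le> max_time E3"
  shows "mono_on {0..\<tau>} (\<lambda>t. exp (- 2 * t) * trilinear (flow t E1) (flow t E2) (flow t E3))"
proof (rule mono_onI)
  fix s t assume st: "s \<in> {0..\<tau>}" "t \<in> {0..\<tau>}" "s \<le> t"
  have s: "E1 \<in> sets circle_measure" "E2 \<in> sets circle_measure" "E3 \<in> sets circle_measure"
    using E by (auto simp: L_sets_def)
  have F: "flow s E1 \<in> L_sets" "flow s E2 \<in> L_sets" "flow s E3 \<in> L_sets"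
    "t - s \<le> max_time (flow s E1)" "t - s \<le> max_time (flow s E2)" "t - s \<le> max_time (flow s E3)"
    using st E \<tau> by (auto simp: flow_L_sets max_time_flow)
  have ff: "flow t E1 \<doteq> flow (t - s) (flow s E1)" "flow t E2 \<doteq> flow (t - s) (flow s E2)"
    "flow t E3 \<doteq> flow (t - s) (flow s E3)"
    using st E \<tau> by (auto intro: flow_flow)
  have "exp (2 * (t - s)) * trilinear (flow s E1) (flow s E2) (flow s E3)
      \<le> trilinear (flow (t - s) (flow s E1)) (flow (t - s) (flow s E2)) (flow (t - s) (flow s E3))"
    using trilinear_flow[OF F(1-3) _ F(4-6)] st by simp
  also have "\<dots> = trilinear (flow t E1) (flow t E2) (flow t E3)"
    using trilinear_cong[OF flow_sets[OF s(1)] flow_sets[OF s(2)] flow_sets[OF s(3)] ff] by simp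
  finally have "exp (- 2 * t) * (exp (2 * (t - s)) * trilinear (flow s E1) (flow s E2) (flow s E3))
      \<le> exp (- 2 * t) * trilinear (flow t E1) (flow t E2) (flow t E3)"
    by (rule mult_left_mono) simp
  then show "exp (- 2 * s) * trilinear (flow s E1) (flow s E2) (flow s E3)
      \<le> exp (- 2 * t) * trilinear (flow t E1) (flow t E2) (flow t E3)"
    by (simp add: mult.assoc[symmetric] exp_add[symmetric])
qed

lemma flow_max_time: "E \<in> L_sets \<Longrightarrow> flow (max_time E) E \<doteq> UNIV"
proof -
  assume E: "E \<in> L_sets"
  then have Es: "E \<in> sets circle_measure" and m: "0 < measure circle_measure E" by (auto simp: L_sets_def)
  show ?thesis
  proof (rule null_eqI)
    show "flow (max_time E) E \<sqsubseteq> UNIV" by (rule subset_null_subset) simp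
    show "flow (max_time E) E \<in> sets circle_measure" by (rule flow_sets[OF Es])
    show "measure circle_measure UNIV \<le> measure circle_measure (flow (max_time E) E)"
      using flow_measure[OF E max_time_nonneg[OF E]] m by (simp add: max_time_def exp_minus)
  qed simp
qed

theorem theorem15p1:
  shows "\<exists>\<Phi> :: real \<Rightarrow> circle set \<Rightarrow> circle set.
    \<comment> \<open>a map into \<open>L_sets\<close>, well defined on equivalence classes\<close>
    (\<forall>E\<in>L_sets. \<forall>t\<in>{0..max_time E}. \<Phi> t E \<in> L_sets) \<and>
    (\<forall>E\<in>L_sets. \<forall>E'\<in>L_sets. E \<doteq> E' \<longrightarrow> (\<forall>t\<in>{0..max_time E}. \<Phi> t E \<doteq> \<Phi> t E')) \<and>
    \<comment> \<open>1\<close>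
    (\<forall>E\<in>L_sets. \<Phi> 0 E \<doteq> E \<and> \<Phi> (max_time E) E \<doteq> UNIV) \<and>
    \<comment> \<open>2\<close>
    (\<forall>E\<in>L_sets. \<forall>s\<in>{0..max_time E}. \<forall>t\<in>{0..max_time E}. s \<le> t \<longrightarrow> \<Phi> s E \<sqsubseteq> \<Phi> t E) \<and>
    \<comment> \<open>3\<close>
    (\<forall>E\<in>L_sets. \<forall>t\<in>{0..max_time E}.
      measure circle_measure (\<Phi> t E) = exp t * measure circle_measure E) \<and>
    \<comment> \<open>4\<close>
    (\<forall>E\<in>L_sets. \<forall>t\<in>{0..max_time E}.
      ((\<lambda>s. measure circle_measure (sym_diff (\<Phi> s E) (\<Phi> t E))) \<longlongrightarrow> 0)
        (at t within {0..max_time E})) \<and>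
    \<comment> \<open>5\<close>
    (\<forall>E\<in>L_sets. \<forall>E'\<in>L_sets. E \<sqsubseteq> E' \<longrightarrow> (\<forall>s\<in>{0..max_time E'}. \<Phi> s E \<sqsubseteq> \<Phi> s E')) \<and>
    \<comment> \<open>6\<close>
    (\<forall>E1\<in>L_sets. \<forall>E2\<in>L_sets. \<forall>s t.
      0 \<le> s \<and> s \<le> t \<and> t \<le> min (max_time E1) (max_time E2) \<longrightarrow>
      exp (- t) * measure circle_measure (sym_diff (\<Phi> t E1) (\<Phi> t E2))
        \<le> exp (- s) * measure circle_measure (sym_diff (\<Phi> s E1) (\<Phi> s E2))) \<and>
    \<comment> \<open>7\<close>
    (\<forall>E\<in>L_sets. \<forall>s t. 0 \<le> s \<and> s \<le> t \<and> t \<le> max_time E \<longrightarrow>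
      \<Phi> t E \<doteq> \<Phi> (t - s) (\<Phi> s E)) \<and>
    \<comment> \<open>8\<close>
    (\<forall>(\<phi> :: circle \<Rightarrow> circle) r. \<forall>E\<in>L_sets.
      continuous_on UNIV \<phi> \<and> (\<forall>x y. \<phi> (x + y) = \<phi> x + \<phi> y) \<and> \<not> \<phi> constant_on UNIV \<and>
      0 < r \<and> r \<le> 1/2 \<and> E \<doteq> {x. circle_norm (\<phi> x) \<le> r} \<longrightarrow>
      (\<forall>t\<in>{0..max_time E}. \<Phi> t E \<doteq> {x. circle_norm (\<phi> x) \<le> exp t * r})) \<and>
    \<comment> \<open>9\<close>
    (\<forall>E\<in>L_sets. \<forall>y. \<forall>t\<in>{0..max_time E}.
      \<Phi> t ((\<lambda>x. x + y) ` E) \<doteq> (\<lambda>x. x + y) ` \<Phi> t E) \<and>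
    (\<forall>E\<in>L_sets. \<forall>t\<in>{0..max_time E}. \<Phi> t (uminus ` E) \<doteq> uminus ` \<Phi> t E) \<and>
    \<comment> \<open>10\<close>
    (\<forall>E1\<in>L_sets. \<forall>E2\<in>L_sets.
      antimono_on {0..min (max_time E1) (max_time E2)}
        (\<lambda>t. exp (- t) * measure circle_measure (\<Phi> t E1 +\<^sub>0 \<Phi> t E2))) \<and>
    \<comment> \<open>11\<close>
    (\<forall>E1\<in>L_sets. \<forall>E2\<in>L_sets. \<forall>E3\<in>L_sets. \<forall>\<tau>.
      0 \<le> \<tau> \<and> \<tau> \<le> min (max_time E1) (min (max_time E2) (max_time E3)) \<and>
      measure circle_measure (\<Phi> \<tau> E1) + measure circle_measure (\<Phi> \<tau> E2)
        + measure circle_measure (\<Phi> \<tau> E3) \<le> 2 \<longrightarrow>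
      mono_on {0..\<tau>}
        (\<lambda>t. exp (- 2 * t) * trilinear (\<Phi> t E1) (\<Phi> t E2) (\<Phi> t E3)))"
proof (intro exI[of _ flow] conjI)
  have s: "E \<in> sets circle_measure" if "E \<in> L_sets" for E using that by (simp add: L_sets_def)
  show "\<forall>E\<in>L_sets. \<forall>t\<in>{0..max_time E}. flow t E \<in> L_sets"
    by (simp add: flow_L_sets)
  show "\<forall>E\<in>L_sets. \<forall>E'\<in>L_sets. E \<doteq> E' \<longrightarrow> (\<forall>t\<in>{0..max_time E}. flow t E \<doteq> flow t E')"
    by (simp add: flow_null_cong s)
  show "\<forall>E\<in>L_sets. flow 0 E \<doteq> E \<and> flow (max_time E) E \<doteq> UNIV"
    by (simp add: flow_0 s flow_max_time)
  show "\<forall>E\<in>L_sets. \<forall>s\<in>{0..max_time E}. \<forall>t\<in>{0..max_time E}. s \<le> t \<longrightarrow> flow s E \<sqsubseteq> flow t E"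
    by (simp add: flow_mono_time s subset_null_subset)
  show "\<forall>E\<in>L_sets. \<forall>t\<in>{0..max_time E}. measure circle_measure (flow t E) = exp t * measure circle_measure E"
    by (simp add: flow_measure)
  show "\<forall>E\<in>L_sets. \<forall>t\<in>{0..max_time E}.
      ((\<lambda>s. measure circle_measure (sym_diff (flow s E) (flow t E))) \<longlongrightarrow> 0) (at t within {0..max_time E})"
    using flow_measure_continuous by blast
  show "\<forall>E\<in>L_sets. \<forall>E'\<in>L_sets. E \<sqsubseteq> E' \<longrightarrow> (\<forall>s\<in>{0..max_time E'}. flow s E \<sqsubseteq> flow s E')"
    by (simp add: flow_null_mono s)
  show "\<forall>E1\<in>L_sets. \<forall>E2\<in>L_sets. \<forall>s t. 0 \<le> s \<and> s \<le> t \<and> t \<le> min (max_time E1) (max_time E2) \<longrightarrow>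
      exp (- t) * measure circle_measure (sym_diff (flow t E1) (flow t E2))
        \<le> exp (- s) * measure circle_measure (sym_diff (flow s E1) (flow s E2))"
    using flow_contraction_le by simp
  show "\<forall>E\<in>L_sets. \<forall>s t. 0 \<le> s \<and> s \<le> t \<and> t \<le> max_time E \<longrightarrow> flow t E \<doteq> flow (t - s) (flow s E)"
    using flow_flow by blast
  show "\<forall>(\<phi> :: circle \<Rightarrow> circle) r. \<forall>E\<in>L_sets.
      continuous_on UNIV \<phi> \<and> (\<forall>x y. \<phi> (x + y) = \<phi> x + \<phi> y) \<and> \<not> \<phi> constant_on UNIV \<and>
      0 < r \<and> r \<le> 1/2 \<and> E \<doteq> {x. circle_norm (\<phi> x) \<le> r} \<longrightarrow>
      (\<forall>t\<in>{0..max_time E}. flow t E \<doteq> {x. circle_norm (\<phi> x) \<le> exp t * r})"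
    by (intro allI ballI impI, elim conjE, rule flow_bohr) (assumption | simp)+
  show "\<forall>E\<in>L_sets. \<forall>y. \<forall>t\<in>{0..max_time E}. flow t ((\<lambda>x. x + y) ` E) \<doteq> (\<lambda>x. x + y) ` flow t E"
    by (simp add: flow_translate)
  show "\<forall>E\<in>L_sets. \<forall>t\<in>{0..max_time E}. flow t (uminus ` E) \<doteq> uminus ` flow t E"
    by (simp add: flow_uminus)
  show "\<forall>E1\<in>L_sets. \<forall>E2\<in>L_sets. antimono_on {0..min (max_time E1) (max_time E2)}
        (\<lambda>t. exp (- t) * measure circle_measure (flow t E1 +\<^sub>0 flow t E2))"
    using sumset_flow_antimono by blast
  show "\<forall>E1\<in>L_sets. \<forall>E2\<in>L_sets. \<forall>E3\<in>L_sets. \<forall>\<tau>.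
      0 \<le> \<tau> \<and> \<tau> \<le> min (max_time E1) (min (max_time E2) (max_time E3)) \<and>
      measure circle_measure (flow \<tau> E1) + measure circle_measure (flow \<tau> E2)
        + measure circle_measure (flow \<tau> E3) \<le> 2 \<longrightarrow>
      mono_on {0..\<tau>} (\<lambda>t. exp (- 2 * t) * trilinear (flow t E1) (flow t E2) (flow t E3))"
    using trilinear_flow_mono by simp
qed

end
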